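(* Let $n\geq1$, $d\geq3$, and let $X=V(f)\subseteq\mathbb{P}^n$ be a hypersurface defined by a nonzero homogeneous polynomial $f\in\mathbb{C}[x_0,\ldots,x_n]$ of degree $d$. If $X$ has at most isolated singularities and $\tau(X)<(d-2)(d-1)^{n-1}$, then $\dim\operatorname{Aut}_{\mathbb{P}^n}(X)=0$.
   Context: For $p\in\operatorname{Sing}(X)$, with local coordinates $y_1,\ldots,y_n$ at $p$ and a local equation $h\in\mathcal{O}_{\mathbb{P}^n,p}$ of $X$, the local Tjurina number is $\tau(X,p)=\dim_{\mathbb{C}}\mathcal{O}_{\mathbb{P}^n,p}/(h,\partial h/\partial y_1,\ldots,\partial h/\partial y_n)$, and $\tau(X)=\sum_{p\in\operatorname{Sing}(X)}\tau(X,p)$. $\operatorname{Aut}_{\mathbb{P}^n}(X)=\{g\in PGL_{n+1}(\mathbb{C})\mid g(X)=X\}$, i.e. the stabilizer of $[f]\in\mathbb{P}(\mathbb{C}[x_0,\ldots,x_n]_d)$. *)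

theory Defs
  imports
    "HOL-Library.Poly_Mapping"
    "HOL-Library.Extended_Nat"
    "HOL-Computational_Algebra.Fraction_Field"
    "HOL-Analysis.Abstract_Topology"
    "HOL-Algebra.Embedded_Algebras"
    "HOL-Algebra.Group_Action"
    "Jordan_Normal_Form.Matrix"
begin

subsection \<open>Multivariate polynomials over the complex numbers\<close>

text \<open>A polynomial is a finitely supported map from monomials (finitely supported
  exponent vectors) to coefficients; ring operations are those of \<^theory>\<open>HOL-Library.Poly_Mapping\<close>.\<close>

type_synonym 'v mpol = "('v \<Rightarrow>\<^sub>0 nat) \<Rightarrow>\<^sub>0 complex"

definition Const :: "complex \<Rightarrow> 'v mpol" where
  "Const c = Poly_Mapping.single 0 c"

definition Var :: "'v \<Rightarrow> 'v mpol" where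
  "Var v = Poly_Mapping.single (Poly_Mapping.single v 1) 1"

definition mpols :: "'v set \<Rightarrow> 'v mpol set" where
  "mpols V = {f. \<forall>m \<in> Poly_Mapping.keys f. Poly_Mapping.keys m \<subseteq> V}"

definition homogeneous :: "nat \<Rightarrow> 'v mpol \<Rightarrow> bool" where
  "homogeneous d f \<longleftrightarrow>
     (\<forall>m \<in> Poly_Mapping.keys f. (\<Sum>v\<in>Poly_Mapping.keys m. Poly_Mapping.lookup m v) = d)"

definition peval :: "('v \<Rightarrow> complex) \<Rightarrow> 'v mpol \<Rightarrow> complex" where
  "peval a f = (\<Sum>m\<in>Poly_Mapping.keys f.
     Poly_Mapping.lookup f m * (\<Prod>v\<in>Poly_Mapping.keys m. a v ^ Poly_Mapping.lookup m v))"

definition psubst :: "('v \<Rightarrow> 'w mpol) \<Rightarrow> 'v mpol \<Rightarrow> 'w mpol" where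
  "psubst s f = (\<Sum>m\<in>Poly_Mapping.keys f.
     Const (Poly_Mapping.lookup f m) * (\<Prod>v\<in>Poly_Mapping.keys m. s v ^ Poly_Mapping.lookup m v))"

text \<open>Truncated subtraction of exponents is harmless: the coefficient vanishes when the
  exponent of \<open>v\<close> is zero.\<close>

definition pderiv_mpol :: "'v \<Rightarrow> 'v mpol \<Rightarrow> 'v mpol" where
  "pderiv_mpol v f = (\<Sum>m\<in>Poly_Mapping.keys f.
     Poly_Mapping.single (m - Poly_Mapping.single v 1)
       (of_nat (Poly_Mapping.lookup m v) * Poly_Mapping.lookup f m))"

subsection \<open>Projective space\<close>

text \<open>A point is the set of all its homogeneous coordinate vectors.\<close>

definition proj_space :: "nat \<Rightarrow> complex vec set set" where
  "proj_space n =
     {{c \<cdot>\<^sub>v v | c. c \<noteq> 0} | v. v \<in> carrier_vec (n + 1) \<and> v \<noteq> 0\<^sub>v (n + 1)}"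

definition zariski_proj :: "nat \<Rightarrow> complex vec set topology" where
  "zariski_proj n = topology_generated_by
     {{p \<in> proj_space n. \<forall>v\<in>p. peval (\<lambda>i. v $ i) q \<noteq> 0} | q k. q \<in> mpols {..n} \<and> homogeneous k q}"

text \<open>The singular points of the hypersurface (scheme) defined by \<open>f\<close>; in particular all points on
  a multiple component are singular.\<close>

definition sing_points :: "nat \<Rightarrow> nat mpol \<Rightarrow> complex vec set set" where
  "sing_points n f =
     {p \<in> proj_space n. \<forall>v\<in>p. peval (\<lambda>i. v $ i) f = 0 \<and>
        (\<forall>j\<le>n. peval (\<lambda>i. v $ i) (pderiv_mpol j f) = 0)}"

definition at_most_isolated_singularities :: "nat \<Rightarrow> nat mpol \<Rightarrow> bool" where
  "at_most_isolated_singularities n f \<longleftrightarrow>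
     (\<forall>p\<in>sing_points n f. openin (subtopology (zariski_proj n) (sing_points n f)) {p})"

subsection \<open>Tjurina numbers\<close>

text \<open>The local ring at the point \<open>a\<close> of affine space with coordinate functions indexed by \<open>V\<close>,
  inside the field of rational functions.\<close>

definition local_ring :: "nat set \<Rightarrow> (nat \<Rightarrow> complex) \<Rightarrow> nat mpol fract ring" where
  "local_ring V a =
     \<lparr> carrier = {Fract r s | r s. r \<in> mpols V \<and> s \<in> mpols V \<and> peval a s \<noteq> 0},
       monoid.mult = (*), one = 1, zero = 0, add = (+) \<rparr>"

text \<open>The dimension of \<open>R / J\<close> over \<open>\<complex>\<close>; it is infinite if there is no finite one.\<close>

definition quot_dim :: "nat mpol fract ring \<Rightarrow> nat mpol fract set \<Rightarrow> enat" where
  "quot_dim R J = Inf {enat k | k.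
     ring.dimension (R Quot J) k {J +>\<^bsub>R\<^esub> Fract (Const c) 1 | c. True} (carrier (R Quot J))}"

text \<open>Around \<open>p\<close> we use the standard chart \<open>x\<^sub>i \<noteq> 0\<close>, for the least possible \<open>i\<close>. The functions
  \<open>y\<^sub>j = x\<^sub>j / x\<^sub>i\<close> for \<open>j \<noteq> i\<close> are the local coordinates (translating them so that they vanish at \<open>p\<close>
  does not change partial derivatives); the variable \<open>y\<^sub>j\<close> is again called \<open>Var j\<close>. The local
  equation is \<open>f\<close> with \<open>x\<^sub>i\<close> replaced by 1.\<close>

definition chart :: "complex vec set \<Rightarrow> nat" where
  "chart p = (LEAST i. \<forall>v\<in>p. v $ i \<noteq> 0)"

definition affine_point :: "complex vec set \<Rightarrow> nat \<Rightarrow> complex" where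
  "affine_point p = (\<lambda>j. (THE v. v \<in> p \<and> v $ chart p = 1) $ j)"

definition local_ring_at :: "nat \<Rightarrow> complex vec set \<Rightarrow> nat mpol fract ring" where
  "local_ring_at n p = local_ring ({..n} - {chart p}) (affine_point p)"

definition local_equation :: "nat mpol \<Rightarrow> complex vec set \<Rightarrow> nat mpol" where
  "local_equation f p = psubst (\<lambda>j. if j = chart p then 1 else Var j) f"

definition tjurina_at :: "nat \<Rightarrow> nat mpol \<Rightarrow> complex vec set \<Rightarrow> enat" where
  "tjurina_at n f p =
     (let R = local_ring_at n p; h = local_equation f p in
      quot_dim R (Idl\<^bsub>R\<^esub> (insert (Fract h 1)
        {Fract (pderiv_mpol j h) 1 | j. j \<in> {..n} - {chart p}})))"

text \<open>Meaningful when the singular locus is finite, as it is for isolated singularities.\<close>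

definition tjurina :: "nat \<Rightarrow> nat mpol \<Rightarrow> enat" where
  "tjurina n f = (\<Sum>p\<in>sing_points n f. tjurina_at n f p)"

subsection \<open>The projective linear group and automorphisms\<close>

definition GL :: "nat \<Rightarrow> complex mat monoid" where
  "GL m = units_of (ring_mat TYPE(complex) m ())"

definition PGL :: "nat \<Rightarrow> complex mat set monoid" where
  "PGL m = GL m Mod {c \<cdot>\<^sub>m 1\<^sub>m m | c. c \<noteq> 0}"

text \<open>The Zariski topology that \<open>PGL\<close> inherits as an open subset of the projective space of
  matrices.\<close>

definition zariski_PGL :: "nat \<Rightarrow> complex mat set topology" where
  "zariski_PGL m = topology_generated_by
     {{g \<in> carrier (PGL m). \<forall>A\<in>g. peval (\<lambda>ij. A $$ ij) q \<noteq> 0} | q k.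
        q \<in> mpols ({..<m} \<times> {..<m}) \<and> homogeneous k q}"

text \<open>The left action \<open>(A \<cdot> f)(x) = f(A\<^sup>-\<^sup>1 x)\<close>, for which \<open>A(V(f)) = V(A \<cdot> f)\<close>.\<close>

definition GL_act :: "nat \<Rightarrow> complex mat \<Rightarrow> nat mpol \<Rightarrow> nat mpol" where
  "GL_act m A f =
     psubst (\<lambda>i. \<Sum>j<m. Const ((inv\<^bsub>GL m\<^esub> A) $$ (i, j)) * Var j) f"

definition PGL_act :: "nat \<Rightarrow> complex mat set \<Rightarrow> nat mpol set \<Rightarrow> nat mpol set" where
  "PGL_act m g P = {GL_act m A q | A q. A \<in> g \<and> q \<in> P}"

text \<open>The stabilizer of the class \<open>[f]\<close> in the projective space of forms.\<close>

definition Aut_hypersurface :: "nat \<Rightarrow> nat mpol \<Rightarrow> complex mat set set" where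
  "Aut_hypersurface n f =
     stabilizer (PGL (n + 1)) (PGL_act (n + 1)) {Const c * f | c. c \<noteq> 0}"

subsection \<open>Krull dimension of a topological space\<close>

definition irreducible_in :: "'a topology \<Rightarrow> 'a set \<Rightarrow> bool" where
  "irreducible_in T S \<longleftrightarrow> S \<subseteq> topspace T \<and> S \<noteq> {} \<and>
     (\<forall>A B. closedin T A \<and> closedin T B \<and> S \<subseteq> A \<union> B \<longrightarrow> S \<subseteq> A \<or> S \<subseteq> B)"

text \<open>The supremum of the lengths of chains of irreducible closed subsets; the empty space gets
  dimension 0 here, but stabilizers are never empty.\<close>

definition krull_dim :: "'a topology \<Rightarrow> enat" where
  "krull_dim T = Sup {enat k | k. \<exists>Z :: nat \<Rightarrow> 'a set.
     (\<forall>i\<le>k. closedin T (Z i) \<and> irreducible_in T (Z i)) \<and> (\<forall>i<k. Z i \<subset> Z (Suc i))}"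

definition dim_Aut :: "nat \<Rightarrow> nat mpol \<Rightarrow> enat" where
  "dim_Aut n f = krull_dim (subtopology (zariski_PGL (n + 1)) (Aut_hypersurface n f))"

end

theory Submission
  imports Defs "HOL-Analysis.Continuum_Not_Denumerable" "Jordan_Normal_Form.Char_Poly"
begin

text \<open>If the automorphism group had positive dimension, its Lie algebra would contain a non-scalar
  matrix, and subtracting a multiple of the Euler relation one would get a nontrivial linear syzygy
  \<open>\<Sum>i. l i * \<partial>f/\<partial>x i = 0\<close>. Put \<open>m = d - 1\<close>. Any \<open>n + 1\<close> forms of degree \<open>m\<close> with such a syzygy
  generate an ideal whose codimension in all large degrees is at least
  \<open>m ^ n - m ^ (n - 1) = (d - 2) * (d - 1) ^ (n - 1)\<close>. Indeed, ranks can only drop under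
  specialization, so \<open>n\<close> forms of degree \<open>m\<close> have codimension at least that of a complete
  intersection, \<open>m ^ n\<close>; modulo \<open>n\<close> of the forms the last one is killed by a linear form \<open>l\<close>, hence
  adds at most the codimension of the ideal generated by \<open>l\<close> and those \<open>n\<close> forms, and this is at most
  \<open>m ^ (n - 1)\<close> for one special solution of the syzygy equation, hence for almost all members of a
  pencil through it. On the other hand, if the singularities are isolated, then by the Nullstellensatz
  the quotient by the Jacobian ideal embeds, in large degrees, into the product of the local Tjurina
  algebras, so its dimension is at most \<open>\<tau>(X)\<close>.\<close>

text \<open>Nothing is known about how the partial derivatives restrict to the hyperplane where a
  linear form of the syzygy vanishes, so the bound cannot be read off them directly. What saves the
  argument is that the solutions of a fixed linear syzygy form a vector space: the pencil
  \<open>h i + Const s * f i\<close> through a well-behaved solution \<open>h\<close> keeps the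
  syzygy, almost all of its members inherit the spanning properties of \<open>h\<close>, and almost
  all of them generate at least as much in degree \<open>k\<close> as \<open>f\<close> does.
  Everything is therefore a comparison of dimensions in one degree \<open>k\<close>, up to finitely
  many exceptional \<open>s\<close>. The same \<open>k\<close> must serve for the comparison with
  the Tjurina numbers, which is why the torsion modulo the Jacobian ideal is shown to vanish in some
  degree beyond any given bound. The Lie algebra enters only through a first order expansion:
  without a nontrivial linear syzygy, a determinant that is polynomial in the matrix entries
  separates each point of the stabilizer from all others, and a discrete space has Krull dimension
  0.\<close>

abbreviation lookup where "lookup \<equiv> Poly_Mapping.lookup"
abbreviation keys where "keys \<equiv> Poly_Mapping.keys"
abbreviation single where "single \<equiv> Poly_Mapping.single"

lemma poly_mapping_sum_single:
  fixes f :: "'a \<Rightarrow>\<^sub>0 'b::comm_monoid_add"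
  shows "f = (\<Sum>m\<in>keys f. single m (lookup f m))"
proof (rule poly_mapping_eqI)
  fix k
  have "(\<Sum>m\<in>keys f. lookup (single m (lookup f m)) k) = (\<Sum>m\<in>keys f. if m = k then lookup f k else 0)"
    by (rule sum.cong) (auto simp: lookup_single when_def)
  also have "\<dots> = lookup f k"
    by (simp add: not_in_keys_iff_lookup_eq_zero)
  finally show "lookup f k = lookup (\<Sum>m\<in>keys f. single m (lookup f m)) k"
    by (simp add: lookup_sum)
qed

text \<open>The \<open>single\<close> case remembers \<open>m \<in> keys f\<close>, so that
  conditions on the support of \<open>f\<close> can be used term by term.\<close>

lemma sum_single_induct [case_names single add zero]:
  fixes f :: "'a \<Rightarrow>\<^sub>0 'b::comm_monoid_add"
  assumes "\<And>m c. m \<in> keys f \<Longrightarrow> P (single m c)" "\<And>g h. P g \<Longrightarrow> P h \<Longrightarrow> P (g + h)" "P 0"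
  shows "P f"
proof -
  have "P (\<Sum>m\<in>M. single m (lookup f m))" if "finite M" "M \<subseteq> keys f" for M
    using that
  proof induction
    case (insert m M)
    then show ?case using assms(1)[of m "lookup f m"] assms(2) by simp
  qed (simp add: assms(3))
  from this[of "keys f"] show ?thesis by (simp flip: poly_mapping_sum_single)
qed

subsection \<open>Evaluation homomorphisms\<close>

definition mono_eval :: "('v \<Rightarrow> 'r::comm_semiring_1) \<Rightarrow> ('v \<Rightarrow>\<^sub>0 nat) \<Rightarrow> 'r" where
  "mono_eval s m = (\<Prod>v\<in>keys m. s v ^ lookup m v)"

lemma mono_eval_superset:
  assumes "finite V" "keys m \<subseteq> V"
  shows "mono_eval s m = (\<Prod>v\<in>V. s v ^ lookup m v)"
  unfolding mono_eval_def
  by (rule prod.mono_neutral_left) (use assms in \<open>auto simp: in_keys_iff\<close>)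

lemma mono_eval_0 [simp]: "mono_eval s 0 = 1"
  by (simp add: mono_eval_def)

lemma mono_eval_single [simp]: "mono_eval s (single v k) = s v ^ k"
  by (simp add: mono_eval_def)

lemma keys_add_nat: "keys (m + m') = keys m \<union> keys (m' :: 'v \<Rightarrow>\<^sub>0 nat)"
  by (auto simp: in_keys_iff lookup_add)

lemma mono_eval_add: "mono_eval s (m + m') = mono_eval s m * mono_eval s m'"
proof -
  let ?V = "keys m \<union> keys m'"
  have "mono_eval s (m + m') = (\<Prod>v\<in>?V. s v ^ lookup (m + m') v)"
    by (rule mono_eval_superset) (auto simp: keys_add_nat)
  moreover have "mono_eval s m = (\<Prod>v\<in>?V. s v ^ lookup m v)"
    by (rule mono_eval_superset) auto
  moreover have "mono_eval s m' = (\<Prod>v\<in>?V. s v ^ lookup m' v)"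
    by (rule mono_eval_superset) auto
  ultimately show ?thesis by (simp add: lookup_add power_add prod.distrib)
qed

lemma ring_hom_mono_eval:
  assumes "\<And>a b. h (a * b) = h a * h b" "h 1 = 1"
  shows "h (mono_eval s m) = mono_eval (\<lambda>v. h (s v)) m"
proof -
  have p: "h (a ^ k) = h a ^ k" for a k by (induction k) (auto simp: assms)
  have "h (\<Prod>v\<in>V. s v ^ lookup m v) = (\<Prod>v\<in>V. h (s v) ^ lookup m v)" if "finite V" for V
    using that by induction (auto simp: assms p)
  then show ?thesis by (simp add: mono_eval_def)
qed

text \<open>The common form of \<open>peval\<close> (with \<open>h = id\<close>) and
  \<open>psubst\<close> (with \<open>h = Const\<close>), so that additivity and multiplicativity are
  proved once for both.\<close>

definition gen_eval :: "('b::zero \<Rightarrow> 'r::comm_semiring_1) \<Rightarrow> ('v \<Rightarrow> 'r) \<Rightarrow> (('v \<Rightarrow>\<^sub>0 nat) \<Rightarrow>\<^sub>0 'b) \<Rightarrow> 'r" where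
  "gen_eval h s f = (\<Sum>m\<in>keys f. h (lookup f m) * mono_eval s m)"

lemma peval_gen_eval: "peval a = gen_eval id a"
  by (auto simp: fun_eq_iff peval_def gen_eval_def mono_eval_def)

lemma psubst_gen_eval: "psubst s = gen_eval Const s"
  by (auto simp: fun_eq_iff psubst_def gen_eval_def mono_eval_def)

lemma gen_eval_single: "h 0 = 0 \<Longrightarrow> gen_eval h s (single m c) = h c * mono_eval s m"
  by (auto simp: gen_eval_def)

lemma gen_eval_0 [simp]: "gen_eval h s 0 = 0"
  by (simp add: gen_eval_def)

lemma gen_eval_add:
  assumes "h 0 = 0" "\<And>a b. h (a + b) = h a + h b"
  shows "gen_eval h s (f + g) = gen_eval h s f + gen_eval h s g"
  unfolding gen_eval_def
  by (rule setsum_keys_plus_distrib[of "\<lambda>m c. h c * mono_eval s m"]) (auto simp: assms distrib_right)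

lemma gen_eval_mult:
  fixes h :: "'b::comm_semiring_1 \<Rightarrow> 'r::comm_semiring_1"
  assumes "h 0 = 0" "\<And>a b. h (a + b) = h a + h b" "\<And>a b. h (a * b) = h a * h b"
  shows "gen_eval h s (f * g) = gen_eval h s f * gen_eval h s g"
proof (induction f rule: sum_single_induct)
  case (single m c)
  show ?case
  proof (induction g rule: sum_single_induct)
    case (single m' c')
    show ?case using assms
      by (simp add: mult_single gen_eval_single mono_eval_add mult_ac)
  qed (use assms in \<open>auto simp: gen_eval_add distrib_left\<close>)
qed (use assms in \<open>auto simp: gen_eval_add distrib_right\<close>)

lemma Const_0 [simp]: "Const 0 = 0" and Const_1 [simp]: "Const 1 = 1"
  by (auto simp: Const_def)

lemma Const_add: "Const (a + b) = Const a + Const b"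
  by (simp add: Const_def single_add)

lemma Const_mult: "Const (a * b) = Const a * Const b"
  by (simp add: Const_def mult_single)

lemma Const_uminus: "Const (- a) = - Const a"
  by (simp add: Const_def single_uminus)

lemma Const_diff: "Const (a - b) = Const a - Const b"
  by (simp add: Const_def single_diff)

lemma Const_power: "Const (a ^ k) = Const a ^ k"
  by (induction k) (auto simp: Const_mult)

lemma Const_sum: "Const (sum g A) = (\<Sum>x\<in>A. Const (g x))"
  by (induction A rule: infinite_finite_induct) (auto simp: Const_add)

lemma Const_of_nat: "Const (of_nat k) = of_nat k"
  by (induction k) (auto simp: Const_add)

lemma Const_eq_0_iff [simp]: "Const c = 0 \<longleftrightarrow> c = 0"
  by (metis Const_0 Const_def lookup_single_eq)

lemma lookup_Const_mult: "lookup (Const c * f) m = c * lookup f m"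
proof -
  have "lookup (Poly_Mapping.map ((*) c) f) m = c * lookup f m"
    by (simp add: Poly_Mapping.map.rep_eq when_def)
  then show ?thesis by (simp add: Const_def mult_map_scale_conv_mult)
qed

lemma single_Const: "single m c = Const c * single m 1"
  by (simp add: Const_def mult_single)

lemma peval_0 [simp]: "peval a 0 = 0" and peval_1 [simp]: "peval a 1 = 1"
  and peval_add [simp]: "peval a (f + g) = peval a f + peval a g"
  and peval_mult [simp]: "peval a (f * g) = peval a f * peval a g"
  and peval_single: "peval a (single m c) = c * mono_eval a m"
  and peval_Const [simp]: "peval a (Const c) = c"
  and peval_Var [simp]: "peval a (Var v) = a v"
proof -
  show "peval a 1 = 1" by (metis (no_types) gen_eval_single id_apply mono_eval_0 mult_1 peval_gen_eval single_one)
qed (simp_all add: peval_gen_eval gen_eval_add gen_eval_mult gen_eval_single Const_def Var_def)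

lemma peval_power [simp]: "peval a (f ^ k) = peval a f ^ k"
  by (induction k) auto

lemma peval_sum [simp]: "peval a (sum g A) = (\<Sum>x\<in>A. peval a (g x))"
  by (induction A rule: infinite_finite_induct) auto

lemma psubst_0 [simp]: "psubst s 0 = 0" and psubst_1 [simp]: "psubst s 1 = 1"
  and psubst_add [simp]: "psubst s (f + g) = psubst s f + psubst s g"
  and psubst_mult [simp]: "psubst s (f * g) = psubst s f * psubst s g"
  and psubst_single: "psubst s (single m c) = Const c * mono_eval s m"
  and psubst_Const [simp]: "psubst s (Const c) = Const c"
  and psubst_Var [simp]: "psubst s (Var v) = s v"
proof -
  show "psubst s 1 = 1"
    by (metis (no_types) gen_eval_single Const_0 Const_1 mono_eval_0 mult_1 psubst_gen_eval single_one)
  show "psubst s (Const c) = Const c"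
    by (simp add: psubst_gen_eval gen_eval_single Const_def[of c])
  show "psubst s (Var v) = s v"
    unfolding Var_def by (simp add: psubst_gen_eval gen_eval_single)
qed (simp_all add: psubst_gen_eval gen_eval_add gen_eval_mult gen_eval_single Const_add Const_mult)

lemma psubst_uminus [simp]: "psubst s (- f) = - psubst s f"
  by (metis add.right_inverse add_eq_0_iff psubst_0 psubst_add)

lemma psubst_diff [simp]: "psubst s (f - g) = psubst s f - psubst s g"
  using psubst_add[of s f "- g"] by simp

lemma psubst_power [simp]: "psubst s (f ^ k) = psubst s f ^ k"
  by (induction k) auto

lemma psubst_sum [simp]: "psubst s (sum g A) = (\<Sum>x\<in>A. psubst s (g x))"
  by (induction A rule: infinite_finite_induct) auto

lemma peval_psubst: "peval a (psubst s f) = peval (\<lambda>v. peval a (s v)) f"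
proof (induction f rule: sum_single_induct)
  case (single m c)
  show ?case
    by (simp add: psubst_single peval_single ring_hom_mono_eval[of "peval a"])
qed auto

lemma psubst_psubst: "psubst t (psubst s f) = psubst (\<lambda>v. psubst t (s v)) f"
proof (induction f rule: sum_single_induct)
  case (single m c)
  show ?case
    by (simp add: psubst_single ring_hom_mono_eval[of "psubst t"])
qed auto

lemma mono_eval_Var: "mono_eval Var m = single m 1"
proof -
  have p: "Var v ^ k = single (single v k) 1" for v :: 'a and k
    by (induction k) (auto simp: Var_def mult_single simp flip: single_add single_one)
  have "(\<Prod>v\<in>V. Var v ^ lookup m v) = single (\<Sum>v\<in>V. single v (lookup m v)) 1" if "finite V" for V
    using that by induction (auto simp: p mult_single)
  then show ?thesis
    by (simp add: mono_eval_def poly_mapping_sum_single[symmetric])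
qed

lemma psubst_Var_id [simp]: "psubst Var f = f"
proof (induction f rule: sum_single_induct)
  case (single m c)
  show ?case
    by (simp add: psubst_single mono_eval_Var single_Const[symmetric])
qed auto

lemma mono_eval_cong: "(\<And>v. v \<in> keys m \<Longrightarrow> s v = t v) \<Longrightarrow> mono_eval s m = mono_eval t m"
  by (simp add: mono_eval_def)

lemma peval_cong_mpols:
  assumes "f \<in> mpols V" "\<And>v. v \<in> V \<Longrightarrow> a v = b v"
  shows "peval a f = peval b f"
  unfolding peval_gen_eval gen_eval_def
  by (intro sum.cong refl arg_cong2[of _ _ _ _ "(*)"] mono_eval_cong)
     (use assms in \<open>auto simp: mpols_def\<close>)

lemma psubst_cong_mpols:
  assumes "f \<in> mpols V" "\<And>v. v \<in> V \<Longrightarrow> s v = t v"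
  shows "psubst s f = psubst t f"
  unfolding psubst_gen_eval gen_eval_def
  by (intro sum.cong refl arg_cong2[of _ _ _ _ "(*)"] mono_eval_cong)
     (use assms in \<open>auto simp: mpols_def\<close>)

subsection \<open>Degrees and forms\<close>

definition mdeg :: "('v \<Rightarrow>\<^sub>0 nat) \<Rightarrow> nat" where
  "mdeg m = (\<Sum>v\<in>keys m. lookup m v)"

lemma mdeg_superset:
  assumes "finite V" "keys m \<subseteq> V"
  shows "mdeg m = (\<Sum>v\<in>V. lookup m v)"
  unfolding mdeg_def
  by (rule sum.mono_neutral_left) (use assms in \<open>auto simp: in_keys_iff\<close>)

lemma mdeg_0 [simp]: "mdeg 0 = 0"
  by (simp add: mdeg_def)

lemma mdeg_single [simp]: "mdeg (single v k) = k"
  by (simp add: mdeg_def)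

lemma mdeg_add [simp]: "mdeg (m + m') = mdeg m + mdeg m'"
proof -
  let ?V = "keys m \<union> keys m'"
  show ?thesis
    by (simp add: mdeg_superset[of ?V] keys_add_nat lookup_add sum.distrib)
qed

lemma lookup_le_mdeg: "lookup m v \<le> mdeg m"
proof (cases "v \<in> keys m")
  case True
  then show ?thesis by (auto simp: mdeg_def intro: member_le_sum)
qed (auto simp: in_keys_iff)

lemma homogeneous_mdeg: "homogeneous d f \<longleftrightarrow> (\<forall>m\<in>keys f. mdeg m = d)"
  by (simp add: homogeneous_def mdeg_def)

lemma homogeneous_0 [simp]: "homogeneous d 0"
  by (simp add: homogeneous_mdeg)

lemma homogeneous_add: "homogeneous d f \<Longrightarrow> homogeneous d g \<Longrightarrow> homogeneous d (f + g)"
  using keys_add[of f g] by (auto simp: homogeneous_mdeg)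

lemma homogeneous_mult: "homogeneous d f \<Longrightarrow> homogeneous e g \<Longrightarrow> homogeneous (d + e) (f * g)"
  using keys_mult[of f g] by (fastforce simp: homogeneous_mdeg)

lemma homogeneous_Const [simp]: "homogeneous 0 (Const c)"
  by (auto simp: homogeneous_mdeg Const_def split: if_splits)

lemma homogeneous_1 [simp]: "homogeneous 0 1"
  using homogeneous_Const[of 1] by simp

lemma homogeneous_Var [simp]: "homogeneous 1 (Var v)"
  by (auto simp: homogeneous_mdeg Var_def)

lemma homogeneous_Const_mult: "homogeneous d f \<Longrightarrow> homogeneous d (Const c * f)"
  using homogeneous_mult[of 0 "Const c" d f] by simp

lemma homogeneous_sum: "(\<And>i. i \<in> A \<Longrightarrow> homogeneous d (g i)) \<Longrightarrow> homogeneous d (sum g A)"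
  by (induction A rule: infinite_finite_induct) (auto intro: homogeneous_add)

lemma homogeneous_prod:
  "finite A \<Longrightarrow> (\<And>i. i \<in> A \<Longrightarrow> homogeneous (e i) (g i)) \<Longrightarrow> homogeneous (sum e A) (prod g A)"
  by (induction A rule: finite_induct) (auto intro: homogeneous_mult)

lemma homogeneous_power: "homogeneous d f \<Longrightarrow> homogeneous (k * d) (f ^ k)"
  by (induction k) (auto intro: homogeneous_mult)

lemma mpols_0 [simp]: "0 \<in> mpols V" and mpols_Const [simp]: "Const c \<in> mpols V"
  and mpols_Var: "v \<in> V \<Longrightarrow> Var v \<in> mpols V"
  by (auto simp: mpols_def Const_def Var_def split: if_splits)

lemma mpols_1 [simp]: "1 \<in> mpols V"
  using mpols_Const[of 1 V] by simp

lemma mpols_add: "f \<in> mpols V \<Longrightarrow> g \<in> mpols V \<Longrightarrow> f + g \<in> mpols V"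
  using keys_add[of f g] by (fastforce simp: mpols_def)

lemma mpols_mult: "f \<in> mpols V \<Longrightarrow> g \<in> mpols V \<Longrightarrow> f * g \<in> mpols V"
  using keys_mult[of f g] by (fastforce simp: mpols_def keys_add_nat)

lemma mpols_uminus: "f \<in> mpols V \<Longrightarrow> - f \<in> mpols V"
  using mpols_mult[of "Const (-1)" V f, OF mpols_Const] by (simp add: Const_uminus)

lemma mpols_sum: "(\<And>i. i \<in> A \<Longrightarrow> g i \<in> mpols V) \<Longrightarrow> sum g A \<in> mpols V"
  by (induction A rule: infinite_finite_induct) (auto intro: mpols_add)

lemma mpols_prod: "(\<And>i. i \<in> A \<Longrightarrow> g i \<in> mpols V) \<Longrightarrow> prod g A \<in> mpols V"
  by (induction A rule: infinite_finite_induct) (auto intro: mpols_mult)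

lemma mpols_power: "f \<in> mpols V \<Longrightarrow> f ^ k \<in> mpols V"
  by (induction k) (auto intro: mpols_mult)

lemma psubst_mpols:
  assumes "f \<in> mpols V" "\<And>v. v \<in> V \<Longrightarrow> s v \<in> mpols W"
  shows "psubst s f \<in> mpols W"
  unfolding psubst_def
  by (intro mpols_sum mpols_mult mpols_prod mpols_power mpols_Const assms(2))
     (use assms(1) in \<open>auto simp: mpols_def\<close>)

definition forms :: "nat \<Rightarrow> nat \<Rightarrow> nat mpol set" where
  "forms n k = {f \<in> mpols {..n}. homogeneous k f}"

lemma forms_0 [simp]: "0 \<in> forms n k"
  by (simp add: forms_def)

lemma forms_add: "f \<in> forms n k \<Longrightarrow> g \<in> forms n k \<Longrightarrow> f + g \<in> forms n k"
  by (simp add: forms_def mpols_add homogeneous_add)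

lemma forms_mult: "f \<in> forms n k \<Longrightarrow> g \<in> forms n l \<Longrightarrow> f * g \<in> forms n (k + l)"
  by (simp add: forms_def mpols_mult homogeneous_mult)

lemma forms_Const_mult: "f \<in> forms n k \<Longrightarrow> Const c * f \<in> forms n k"
  by (simp add: forms_def homogeneous_Const_mult mpols_mult)

lemma forms_uminus: "f \<in> forms n k \<Longrightarrow> - f \<in> forms n k"
  using forms_Const_mult[of f n k "-1"] by (simp add: Const_uminus)

lemma forms_diff: "f \<in> forms n k \<Longrightarrow> g \<in> forms n k \<Longrightarrow> f - g \<in> forms n k"
  using forms_add[of f n k "- g"] forms_uminus by fastforce

lemma forms_sum: "(\<And>i. i \<in> A \<Longrightarrow> g i \<in> forms n k) \<Longrightarrow> sum g A \<in> forms n k"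
  by (simp add: forms_def homogeneous_sum mpols_sum)

lemma forms_Var: "i \<le> n \<Longrightarrow> Var i \<in> forms n 1"
  using homogeneous_Var by (simp add: forms_def mpols_Var)

lemma forms_power: "f \<in> forms n k \<Longrightarrow> f ^ e \<in> forms n (e * k)"
  by (simp add: forms_def homogeneous_power mpols_power)

lemma forms_prod:
  "finite A \<Longrightarrow> (\<And>i. i \<in> A \<Longrightarrow> g i \<in> forms n (e i)) \<Longrightarrow> prod g A \<in> forms n (sum e A)"
  by (simp add: forms_def homogeneous_prod mpols_prod)

definition monoms :: "nat \<Rightarrow> nat \<Rightarrow> (nat \<Rightarrow>\<^sub>0 nat) set" where
  "monoms n k = {m. keys m \<subseteq> {..n} \<and> mdeg m = k}"

lemma finite_monoms: "finite (monoms n k)"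
proof (rule finite_subset)
  let ?F = "{g. g \<in> {..n} \<rightarrow>\<^sub>E {..k}}"
  show "finite ((\<lambda>g. Abs_poly_mapping (\<lambda>i. if i \<le> n then g i else 0)) ` ?F)"
    by (intro finite_imageI) (simp add: finite_PiE)
  show "monoms n k \<subseteq> (\<lambda>g. Abs_poly_mapping (\<lambda>i. if i \<le> n then g i else 0)) ` ?F"
  proof
    fix m assume m: "m \<in> monoms n k"
    let ?g = "restrict (lookup m) {..n}"
    have "m = Abs_poly_mapping (\<lambda>i. if i \<le> n then ?g i else 0)"
      using m by (intro poly_mapping_eqI) (auto simp: monoms_def in_keys_iff)
    moreover have "?g \<in> {..n} \<rightarrow>\<^sub>E {..k}"
      using m lookup_le_mdeg[of m] by (auto simp: monoms_def)
    ultimately show "m \<in> (\<lambda>g. Abs_poly_mapping (\<lambda>i. if i \<le> n then g i else 0)) ` ?F"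
      by blast
  qed
qed

lemma forms_keys: "f \<in> forms n k \<longleftrightarrow> keys f \<subseteq> monoms n k"
  by (auto simp: forms_def mpols_def homogeneous_mdeg monoms_def)

lemma single_add_minus:
  fixes m :: "'v \<Rightarrow>\<^sub>0 nat"
  assumes "e \<le> lookup m i"
  shows "single i e + (m - single i e) = m"
  using assms by (intro poly_mapping_eqI) (auto simp: lookup_add lookup_minus lookup_single when_def)

lemma monoms_add: "m \<in> monoms n k \<Longrightarrow> m' \<in> monoms n l \<Longrightarrow> m + m' \<in> monoms n (k + l)"
  by (auto simp: monoms_def keys_add_nat)

lemma monoms_add_cancel: "m + m' \<in> monoms n k \<Longrightarrow> m' \<in> monoms n (k - mdeg m) \<and> mdeg m \<le> k"
  by (auto simp: monoms_def keys_add_nat)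

lemma forms_single: "m \<in> monoms n k \<Longrightarrow> single m c \<in> forms n k"
  by (auto simp: forms_keys)

text \<open>The homogeneous component of degree \<open>k\<close>, with all terms that involve
  variables beyond \<open>n\<close> discarded as well. It turns a representation with arbitrary
  polynomial coefficients into one by forms.\<close>

definition form_part :: "nat \<Rightarrow> nat \<Rightarrow> nat mpol \<Rightarrow> nat mpol" where
  "form_part n k f = (\<Sum>m\<in>monoms n k. single m (lookup f m))"

lemma lookup_form_part: "lookup (form_part n k f) m = (if m \<in> monoms n k then lookup f m else 0)"
proof -
  have "(\<Sum>x\<in>monoms n k. lookup (single x (lookup f x)) m) = (\<Sum>x\<in>monoms n k. if x = m then lookup f m else 0)"
    by (rule sum.cong) (auto simp: lookup_single when_def)
  then show ?thesis by (auto simp: form_part_def lookup_sum finite_monoms)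
qed

lemma form_part_forms: "form_part n k f \<in> forms n k"
  by (auto simp: forms_keys in_keys_iff lookup_form_part split: if_splits)

lemma form_part_id: "f \<in> forms n k \<Longrightarrow> form_part n k f = f"
  by (rule poly_mapping_eqI) (auto simp: forms_keys lookup_form_part in_keys_iff)

lemma form_part_add: "form_part n k (f + g) = form_part n k f + form_part n k g"
  by (rule poly_mapping_eqI) (auto simp: lookup_form_part lookup_add)

lemma form_part_0 [simp]: "form_part n k 0 = 0"
  by (rule poly_mapping_eqI) (auto simp: lookup_form_part)

lemma form_part_sum: "form_part n k (sum g A) = (\<Sum>i\<in>A. form_part n k (g i))"
  by (induction A rule: infinite_finite_induct) (auto simp: form_part_add)

lemma form_part_single: "form_part n k (single m c) = (if m \<in> monoms n k then single m c else 0)"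
  by (rule poly_mapping_eqI) (auto simp: lookup_form_part lookup_single when_def)

lemma form_part_mult:
  assumes "f \<in> forms n e" "e \<le> k"
  shows "form_part n k (q * f) = form_part n (k - e) q * f"
proof (induction q rule: sum_single_induct)
  case (single m c)
  have "form_part n k (single m c * g) = form_part n (k - e) (single m c) * g" if "g \<in> forms n e" for g
  proof -
    have *: "m' \<in> monoms n e" if "m' \<in> keys g" for m'
      using \<open>g \<in> forms n e\<close> that by (auto simp: forms_keys)
    show ?thesis
    proof (induction g rule: sum_single_induct)
      case (single m' c')
      then have m': "m' \<in> monoms n e" by (rule *)
      have "m + m' \<in> monoms n k \<longleftrightarrow> m \<in> monoms n (k - e)"
        using m' assms(2) by (auto simp: monoms_def keys_add_nat)
      then show ?case by (simp add: mult_single form_part_single)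
    qed (auto simp: form_part_add distrib_left)
  qed
  with assms show ?case by blast
qed (auto simp: form_part_add distrib_right)

subsection \<open>Partial derivatives\<close>

lemma pderiv_mpol_single:
  "pderiv_mpol v (single m c) = single (m - single v 1) (of_nat (lookup m v) * c)"
  by (auto simp: pderiv_mpol_def)

lemma pderiv_mpol_0 [simp]: "pderiv_mpol v 0 = 0"
  by (simp add: pderiv_mpol_def)

lemma pderiv_mpol_add: "pderiv_mpol v (f + g) = pderiv_mpol v f + pderiv_mpol v g"
  unfolding pderiv_mpol_def
  by (rule setsum_keys_plus_distrib[of "\<lambda>m c. single (m - single v 1) (of_nat (lookup m v) * c)"])
     (auto simp: distrib_left single_add)

lemma add_minus_single:
  "0 < lookup m v \<Longrightarrow> (m - single v 1) + m' = (m + m') - single v (1 :: nat)"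
  by (rule poly_mapping_eqI) (auto simp: lookup_add lookup_minus lookup_single when_def)

lemma pderiv_mpol_mult:
  "pderiv_mpol v (f * g) = pderiv_mpol v f * g + f * pderiv_mpol v g"
proof (induction f rule: sum_single_induct)
  case (single m c)
  show ?case
  proof (induction g rule: sum_single_induct)
    case (single m' c')
    have 1: "single ((m - single v 1) + m') (of_nat (lookup m v) * c * c') =
        single (m + m' - single v 1) (of_nat (lookup m v) * c * c')"
      by (cases "lookup m v = 0") (simp_all add: add_minus_single del: One_nat_def)
    have 2: "single (m + (m' - single v 1)) (c * (of_nat (lookup m' v) * c')) =
        single (m + m' - single v 1) (c * (of_nat (lookup m' v) * c'))"
      by (cases "lookup m' v = 0") (use add_minus_single[of m' v m] in \<open>simp_all add: ac_simps\<close>)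
    show ?case
      unfolding mult_single pderiv_mpol_single 1 2 lookup_add
      by (simp add: algebra_simps flip: single_add)
  qed (auto simp: pderiv_mpol_add algebra_simps)
qed (auto simp: pderiv_mpol_add algebra_simps)

lemma pderiv_mpol_Const [simp]: "pderiv_mpol v (Const c) = 0"
  by (simp add: Const_def pderiv_mpol_single)

lemma pderiv_mpol_1 [simp]: "pderiv_mpol v 1 = 0"
  using pderiv_mpol_Const[of v 1] by simp

lemma pderiv_mpol_Var: "pderiv_mpol v (Var w) = (if v = w then 1 else 0)"
  by (auto simp: Var_def pderiv_mpol_single lookup_single when_def)

lemma pderiv_mpol_forms:
  assumes "f \<in> forms n d"
  shows "pderiv_mpol v f \<in> forms n (d - 1)"
proof -
  have "single (m - single v 1) (of_nat (lookup m v) * lookup f m) \<in> forms n (d - 1)" if "m \<in> keys f" for m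
  proof (cases "lookup m v = 0")
    case False
    define m' where "m' = m - single v 1"
    have "m = m' + single v 1"
      using single_add_minus[of 1 m v] False by (simp add: m'_def add.commute)
    then have "m' \<in> monoms n (d - 1)"
      using assms that by (fastforce simp: forms_keys monoms_def keys_add_nat)
    then show ?thesis by (metis forms_single m'_def)
  qed auto
  then show ?thesis unfolding pderiv_mpol_def by (rule forms_sum)
qed

lemma Euler_mpol:
  assumes "f \<in> forms n d"
  shows "(\<Sum>i\<le>n. Var i * pderiv_mpol i f) = of_nat d * f"
proof -
  have key: "(\<Sum>i\<le>n. Var i * pderiv_mpol i (single m c)) = of_nat d * single m c" if m: "m \<in> monoms n d" for m c
  proof -
    have "Var i * pderiv_mpol i (single m c) = of_nat (lookup m i) * single m c" for i
    proof (cases "lookup m i = 0")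
      case False
      have "single i 1 + (m - single i 1) = m"
        using False by (intro single_add_minus) simp
      then show ?thesis
        by (simp add: Var_def pderiv_mpol_single mult_single flip: single_of_nat)
    qed (auto simp: pderiv_mpol_single)
    moreover have "(\<Sum>i\<le>n. lookup m i) = d"
      using m mdeg_superset[of "{..n}" m] by (auto simp: monoms_def)
    ultimately show ?thesis
      by (simp flip: sum_distrib_right of_nat_sum)
  qed
  show ?thesis
  proof (induction f rule: sum_single_induct)
    case (single m c)
    then have "m \<in> monoms n d" using assms by (auto simp: forms_keys)
    then show ?case by (rule key)
  qed (auto simp: pderiv_mpol_add algebra_simps sum.distrib)
qed

subsection \<open>The vector space of polynomials\<close>

text \<open>A separate constant, so that rewriting with commutativity does not affect the scalar
  multiplication inside \<open>mpolv.span\<close> and \<open>mpolv.subspace\<close>.\<close>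

definition cscale :: "complex \<Rightarrow> 'v mpol \<Rightarrow> 'v mpol" where
  cscale_eq: "cscale c f = Const c * f"

global_interpretation mpolv: vector_space cscale
  by unfold_locales (auto simp: cscale_eq Const_add Const_mult algebra_simps)

lemma mpolv_span_scale: "f \<in> mpolv.span S \<Longrightarrow> Const c * f \<in> mpolv.span S"
  using mpolv.span_scale[of f S c] cscale_eq[of c f] by simp

lemma mpolv_subspaceI:
  assumes "0 \<in> S" "\<And>f g. f \<in> S \<Longrightarrow> g \<in> S \<Longrightarrow> f + g \<in> S" "\<And>c f. f \<in> S \<Longrightarrow> Const c * f \<in> S"
  shows "mpolv.subspace S"
proof (rule mpolv.subspaceI)
  show "cscale c f \<in> S" if "f \<in> S" for c f
    using assms(3)[OF that, of c] cscale_eq[of c f] by simp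
qed (use assms in auto)

lemma mpolv_subspace_scale: "mpolv.subspace S \<Longrightarrow> f \<in> S \<Longrightarrow> Const c * f \<in> S"
  using mpolv.subspace_scale[of S f c] cscale_eq[of c f] by simp

lemma forms_subspace: "mpolv.subspace (forms n k)"
  by (rule mpolv_subspaceI) (auto intro: forms_add forms_Const_mult)

lemma forms_span_monoms: "forms n k = mpolv.span ((\<lambda>m. single m 1) ` monoms n k)"
proof
  show "forms n k \<subseteq> mpolv.span ((\<lambda>m. single m 1) ` monoms n k)"
  proof
    fix f assume f: "f \<in> forms n k"
    have "(\<Sum>m\<in>keys f. Const (lookup f m) * single m 1) \<in> mpolv.span ((\<lambda>m. single m 1) ` monoms n k)"
      using f by (intro mpolv.span_sum mpolv_span_scale[OF mpolv.span_base]) (auto simp: forms_keys)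
    then show "f \<in> mpolv.span ((\<lambda>m. single m 1) ` monoms n k)"
      by (simp flip: single_Const poly_mapping_sum_single)
  qed
  show "mpolv.span ((\<lambda>m. single m 1) ` monoms n k) \<subseteq> forms n k"
    by (rule mpolv.span_minimal) (auto intro: forms_single forms_subspace)
qed

lemma single_1_eq_iff [simp]: "single m (1::complex) = single m' 1 \<longleftrightarrow> m = m'"
  by (metis keys_single singleton_inject zero_neq_one)

lemma inj_single_1: "inj_on (\<lambda>m. single m (1::complex)) A"
  by (rule inj_onI) simp

lemma independent_monoms: "mpolv.independent ((\<lambda>m. single m 1) ` A)"
proof -
  have "u v = 0" if "finite t" "t \<subseteq> (\<lambda>m. single m 1) ` A" "(\<Sum>v\<in>t. cscale (u v) v) = 0" and v: "v \<in> t"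
    for u and t :: "'a mpol set" and v
  proof -
    obtain m where m: "v = single m 1" using v \<open>t \<subseteq> _\<close> by blast
    have "lookup (cscale (u w) w) m = (if w = v then u v else 0)" if w: "w \<in> t" for w
    proof -
      obtain m' where "w = single m' 1" using w \<open>t \<subseteq> _\<close> by blast
      then show ?thesis using m by (auto simp: cscale_eq lookup_Const_mult lookup_single when_def)
    qed
    then have "lookup (\<Sum>v\<in>t. cscale (u v) v) m = (\<Sum>w\<in>t. if w = v then u v else 0)"
      by (simp add: lookup_sum)
    then show ?thesis using that by simp
  qed
  then show ?thesis by (auto simp: mpolv.independent_explicit_module)
qed

lemma dim_forms: "mpolv.dim (forms n k) = card (monoms n k)"
  unfolding forms_span_monoms mpolv.dim_span_eq_card_independent[OF independent_monoms]
  by (simp add: card_image inj_single_1)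

subsection \<open>Perturbation of ranks\<close>

context vector_space
begin

text \<open>The ambient space may be infinite-dimensional, where \<open>dim\<close> is the
  \<open>card\<close> of a basis and hence 0 for an infinite one; a finite \<open>V\<close> excludes
  this.\<close>

lemma card_le_dim_finite:
  assumes "finite V" "independent B" "B \<subseteq> span V"
  shows "card B \<le> dim V"
proof -
  obtain C where C: "C \<subseteq> V" "independent C" "V \<subseteq> span C" "card C = dim V"
    by (rule basis_exists)
  have "finite C" using C assms finite_subset by blast
  moreover have "B \<subseteq> span C" using assms C(3) by (metis span_mono span_span subset_trans)
  ultimately show ?thesis using independent_span_bound assms C by metis
qed

lemma dim_Un_le:
  assumes "finite V" "finite T" "A \<subseteq> span V"
  shows "dim (A \<union> T) \<le> dim A + card T"
proof -
  obtain C where C: "C \<subseteq> A" "independent C" "A \<subseteq> span C" "card C = dim A"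
    by (rule basis_exists)
  have "finite C" using independent_span_bound[OF assms(1) C(2)] C(1) assms(3) by auto
  have "A \<union> T \<subseteq> span (C \<union> T)"
    using C(3) span_mono[of C "C \<union> T"] span_superset[of "C \<union> T"] by blast
  then have "dim (A \<union> T) \<le> card (C \<union> T)"
    using \<open>finite C\<close> assms(2) by (intro dim_le_card) auto
  then show ?thesis using card_Un_le[of C T] C(4) by linarith
qed

lemma subspace_eq_of_dim_le:
  assumes "finite V" "U \<subseteq> span V" "dim V \<le> dim U"
  shows "span U = span V"
proof (rule ccontr)
  assume "span U \<noteq> span V"
  moreover have "span U \<subseteq> span V" using assms(2) span_minimal by blast
  ultimately obtain x where x: "x \<in> span V" "x \<notin> span U" by blast
  obtain C where C: "C \<subseteq> U" "independent C" "U \<subseteq> span C" "card C = dim U"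
    by (rule basis_exists)
  have "span C \<subseteq> span U" using C(1) span_mono by blast
  then have x': "x \<notin> span C" using x by blast
  then have *: "independent (insert x C)" using C(2) by (simp add: independent_insert)
  have **: "insert x C \<subseteq> span V" using x C(1) assms(2) by blast
  have "card (insert x C) \<le> dim V" by (rule card_le_dim_finite[OF assms(1) * **])
  moreover have "finite (insert x C)" using independent_span_bound[OF assms(1) * **] by (rule conjunct1)
  then have "finite C" by simp
  moreover have "x \<notin> C" using x' span_base by blast
  ultimately show False using C(4) assms(3) \<open>card (insert x C) \<le> dim V\<close> by simp
qed

lemma family_independent:
  fixes N :: nat
  assumes "\<And>c i. (\<Sum>i<N. c i *s v i) = 0 \<Longrightarrow> i < N \<Longrightarrow> c i = 0"
  shows "inj_on v {..<N} \<and> independent (v ` {..<N})"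
proof
  show inj: "inj_on v {..<N}"
  proof (rule inj_onI)
    fix i j assume ij: "i \<in> {..<N}" "j \<in> {..<N}" "v i = v j"
    show "i = j"
    proof (rule ccontr)
      assume "i \<noteq> j"
      define c :: "nat \<Rightarrow> 'a" where "c k = (if k = i then 1 else if k = j then -1 else 0)" for k
      have "(\<Sum>k<N. c k *s v k) = (\<Sum>k\<in>{i,j}. c k *s v k)"
        using ij by (intro sum.mono_neutral_right) (auto simp: c_def)
      also have "\<dots> = 0" using ij \<open>i \<noteq> j\<close> by (simp add: c_def)
      finally have "c i = 0" using ij assms by blast
      then show False by (simp add: c_def)
    qed
  qed
  show "independent (v ` {..<N})"
  proof (rule independent_if_scalars_zero)
    fix f x assume f: "(\<Sum>x\<in>v ` {..<N}. f x *s x) = 0" and x: "x \<in> v ` {..<N}"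
    from x obtain i where i: "i < N" "x = v i" by auto
    have "(\<Sum>i<N. f (v i) *s v i) = 0" using f by (simp add: sum.reindex[OF inj])
    from assms[OF this i(1)] i(2) show "f x = 0" by simp
  qed auto
qed

text \<open>Coordinate functions with respect to a basis of the whole space that extends the given
  family.\<close>

lemma dual_functionals:
  fixes N :: nat
  assumes inj: "inj_on v {..<N}" and ind: "independent (v ` {..<N})"
  obtains \<phi> :: "nat \<Rightarrow> 'b \<Rightarrow> 'a" where "\<forall>i x y. \<phi> i (x + y) = \<phi> i x + \<phi> i y"
    "\<forall>i c x. \<phi> i (c *s x) = c * \<phi> i x" "\<forall>i<N. \<forall>j<N. \<phi> i (v j) = (if i = j then 1 else 0)"
proof -
  define E where "E = extend_basis (v ` {..<N})"
  have E: "independent E" "span E = UNIV" "v ` {..<N} \<subseteq> E"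
    unfolding E_def using independent_extend_basis[OF ind] span_extend_basis[OF ind]
      extend_basis_superset[OF ind] by blast+
  define \<phi> where "\<phi> i x = representation E x (v i)" for i x
  have 1: "\<forall>i x y. \<phi> i (x + y) = \<phi> i x + \<phi> i y" and 2: "\<forall>i c x. \<phi> i (c *s x) = c * \<phi> i x"
    using E by (auto simp: \<phi>_def representation_add representation_scale)
  have "\<phi> i (v j) = (if i = j then 1 else 0)" if "i < N" "j < N" for i j
  proof -
    have "v j \<in> E" using E(3) that by auto
    then have "representation E (v j) = (\<lambda>b. if b = v j then 1 else 0)"
      by (rule representation_basis[OF E(1)])
    moreover have "v i = v j \<longleftrightarrow> i = j" using inj that by (auto dest: inj_onD)
    ultimately show ?thesis unfolding \<phi>_def by (simp only:)
  qed
  then have "\<forall>i<N. \<forall>j<N. \<phi> i (v j) = (if i = j then 1 else 0)" by blast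
  then show ?thesis by (rule that[OF 1 2])
qed

text \<open>Applying the dual functionals of \<open>v 0\<close> to \<open>v s\<close> gives a matrix
  with polynomial entries in \<open>s\<close> that is the identity at \<open>s = 0\<close>. Its
  determinant is a nonzero polynomial, and the family is independent away from the finitely many
  roots.\<close>

lemma independent_perturb:
  fixes N :: nat
  assumes poly: "\<And>i s. i < N \<Longrightarrow> v s i = (\<Sum>k<K i. (s ^ k) *s w i k)"
    and inj: "inj_on (v 0) {..<N}" and ind: "independent (v 0 ` {..<N})"
  shows "finite {s. \<not> (inj_on (v s) {..<N} \<and> independent (v s ` {..<N}))}"
proof -
  obtain \<phi> where \<phi>: "\<forall>i x y. \<phi> i (x + y) = \<phi> i x + \<phi> i y"
    "\<forall>i c x. \<phi> i (c *s x) = c * \<phi> i x"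
    and dual: "\<forall>i<N. \<forall>j<N. \<phi> i (v 0 j) = (if i = j then 1 else 0)"
    by (rule dual_functionals[OF inj ind])
  have lin: "\<phi> i (x + y) = \<phi> i x + \<phi> i y" "\<phi> i (a *s x) = a * \<phi> i x" for i x y a
    using \<phi> by blast+
  have lin0: "\<phi> i 0 = 0" for i using lin(2)[of i 0 0] by simp
  have lin_sum: "\<phi> i (sum g A) = (\<Sum>a\<in>A. \<phi> i (g a))" for i g and A :: "nat set"
    by (induction A rule: infinite_finite_induct) (auto simp: lin lin0)
  define P where "P = mat N N (\<lambda>(i,j). \<Sum>k<K j. monom (\<phi> i (w j k)) k)"
  define p where "p = Determinant.det P"
  have P: "P \<in> carrier_mat N N" by (simp add: P_def)
  have ev: "comm_ring_hom (\<lambda>q::'a poly. poly q s)" for s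
    by unfold_locales auto
  have entry: "poly (P $$ (i,j)) s = \<phi> i (v s j)" if "i < N" "j < N" for i j s
    using that by (simp add: P_def poly poly_sum poly_monom lin_sum lin mult.commute)
  have "Determinant.det (map_mat (\<lambda>q. poly q 0) P) = 1"
  proof -
    have "map_mat (\<lambda>q. poly q 0) P = 1\<^sub>m N"
      using P by (intro eq_matI) (auto simp: entry dual)
    then show ?thesis by simp
  qed
  then have "p \<noteq> 0" by (auto simp: p_def comm_ring_hom.hom_det[OF ev])
  then have "finite {s. poly p s = 0}" by (rule poly_roots_finite)
  moreover have "{s. \<not> (inj_on (v s) {..<N} \<and> independent (v s ` {..<N}))} \<subseteq> {s. poly p s = 0}"
  proof (clarify, rule ccontr)
    fix s assume not: "\<not> (inj_on (v s) {..<N} \<and> independent (v s ` {..<N}))" and p: "poly p s \<noteq> 0"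
    have "inj_on (v s) {..<N} \<and> independent (v s ` {..<N})"
    proof (rule family_independent)
      fix c i assume c: "(\<Sum>i<N. c i *s v s i) = 0" and "i < N"
      have "map_mat (\<lambda>q. poly q s) P *\<^sub>v vec N c = 0\<^sub>v N"
      proof (rule eq_vecI)
        fix j assume j: "j < dim_vec (0\<^sub>v N :: 'a vec)"
        have "(\<Sum>i = 0..<N. poly (P $$ (j, i)) s * c i) = \<phi> j (\<Sum>i<N. c i *s v s i)"
          using j by (simp add: lin_sum lin entry lessThan_atLeast0 mult.commute)
        then show "(map_mat (\<lambda>q. poly q s) P *\<^sub>v vec N c) $ j = 0\<^sub>v N $ j"
          using j P c by (simp add: scalar_prod_def lin0)
      qed (use P in auto)
      moreover have "Determinant.det (map_mat (\<lambda>q. poly q s) P) \<noteq> 0"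
        using p by (simp add: p_def comm_ring_hom.hom_det[OF ev])
      moreover have "map_mat (\<lambda>q. poly q s) P \<in> carrier_mat N N" using P by simp
      ultimately have "vec N c = 0\<^sub>v N"
        using det_0_iff_vec_prod_zero by (metis vec_carrier)
      then show "c i = 0" using \<open>i < N\<close> by (metis index_vec index_zero_vec(1))
    qed
    with not show False by blast
  qed
  ultimately show ?thesis by (rule finite_subset[rotated])
qed

text \<open>Semicontinuity of the rank: a basis chosen among the vectors at \<open>s = 0\<close>
  remains independent for almost all \<open>s\<close>.\<close>

lemma dim_perturb:
  assumes "finite I" and poly: "\<And>i. i \<in> I \<Longrightarrow> \<exists>K w. \<forall>s. g s i = (\<Sum>k<K::nat. (s ^ k) *s w k)"
  shows "finite {s. dim (g s ` I) < dim (g 0 ` I)}"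
proof -
  obtain B where B: "B \<subseteq> g 0 ` I" "independent B" "g 0 ` I \<subseteq> span B" "card B = dim (g 0 ` I)"
    by (rule basis_exists)
  \<comment> \<open>The basis is recorded by indices, so that the same vectors can be followed to
    other values of \<open>s\<close>.\<close>
  obtain J where J: "J \<subseteq> I" "inj_on (g 0) J" "B = g 0 ` J"
    using B(1) by (auto simp: subset_image_inj)
  have "finite J" using J assms finite_subset by auto
  then obtain e where e: "bij_betw e {0..<card J} J" using ex_bij_betw_nat_finite by blast
  define N where "N = card J"
  have e: "bij_betw e {..<N} J" using e by (simp add: N_def lessThan_atLeast0)
  have eJ: "e i \<in> J" if "i < N" for i using e that by (auto simp: bij_betw_def)
  obtain K w where w: "\<And>i s. i \<in> I \<Longrightarrow> g s i = (\<Sum>k<K i::nat. (s ^ k) *s w i k)"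
    using poly by metis
  have inj_e: "inj_on e {..<N}" and im_e: "e ` {..<N} = J" using e by (auto simp: bij_betw_def)
  have fin: "finite {s. \<not> (inj_on (\<lambda>i. g s (e i)) {..<N} \<and> independent ((\<lambda>i. g s (e i)) ` {..<N}))}"
  proof (rule independent_perturb[where K = "\<lambda>i. K (e i)" and w = "\<lambda>i. w (e i)"])
    show "inj_on (\<lambda>i. g 0 (e i)) {..<N}"
      using comp_inj_on[OF inj_e, of "g 0"] J(2) im_e by (simp add: comp_def)
    have "(\<lambda>i. g 0 (e i)) ` {..<N} = B" using J(3) im_e by (metis image_image)
    then show "independent ((\<lambda>i. g 0 (e i)) ` {..<N})" using B(2) by simp
  qed (use w eJ J in auto)
  have "dim (g 0 ` I) \<le> dim (g s ` I)"
    if s: "inj_on (\<lambda>i. g s (e i)) {..<N}" "independent ((\<lambda>i. g s (e i)) ` {..<N})" for s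
  proof -
    have "card ((\<lambda>i. g s (e i)) ` {..<N}) \<le> dim (g s ` I)"
    proof (rule card_le_dim_finite)
      show "(\<lambda>i. g s (e i)) ` {..<N} \<subseteq> span (g s ` I)"
        using eJ J(1) by (auto intro: span_base)
    qed (use assms s in auto)
    moreover have "N = card B" using J by (simp add: N_def card_image)
    ultimately show ?thesis using s(1) B(4) by (simp add: card_image)
  qed
  then have "{s. dim (g s ` I) < dim (g 0 ` I)}
      \<subseteq> {s. \<not> (inj_on (\<lambda>i. g s (e i)) {..<N} \<and> independent ((\<lambda>i. g s (e i)) ` {..<N}))}"
    by fastforce
  then show ?thesis using fin finite_subset by blast
qed

end

text \<open>Polynomial dependence on \<open>s\<close> is witnessed by a univariate polynomial over
  the polynomial ring. Since its evaluation respects ring operations, products and powers of curves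
  are immediate.\<close>

definition poly_curve :: "(complex \<Rightarrow> 'v mpol) \<Rightarrow> bool" where
  "poly_curve v \<longleftrightarrow> (\<exists>p. \<forall>s. v s = poly p (Const s))"

lemma poly_curve_const: "poly_curve (\<lambda>s. f)"
  unfolding poly_curve_def by (rule exI[of _ "[:f:]"]) simp

lemma poly_curve_id: "poly_curve Const"
  unfolding poly_curve_def by (rule exI[of _ "[:0, 1:]"]) simp

lemma poly_curve_add: "poly_curve v \<Longrightarrow> poly_curve w \<Longrightarrow> poly_curve (\<lambda>s. v s + w s)"
  unfolding poly_curve_def by (metis poly_add)

lemma poly_curve_mult: "poly_curve v \<Longrightarrow> poly_curve w \<Longrightarrow> poly_curve (\<lambda>s. v s * w s)"
  unfolding poly_curve_def by (metis poly_mult)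

lemma poly_curve_power: "poly_curve v \<Longrightarrow> poly_curve (\<lambda>s. v s ^ k)"
  unfolding poly_curve_def by (metis poly_power)

lemma poly_curve_prod: "(\<And>i. i \<in> A \<Longrightarrow> poly_curve (v i)) \<Longrightarrow> poly_curve (\<lambda>s. \<Prod>i\<in>A. v i s)"
  by (induction A rule: infinite_finite_induct) (auto intro: poly_curve_const poly_curve_mult)

lemmas poly_curve_intros = poly_curve_const poly_curve_id poly_curve_add poly_curve_mult
  poly_curve_power poly_curve_prod

lemma dim_poly_curve:
  assumes "finite I" "\<And>i. i \<in> I \<Longrightarrow> poly_curve (\<lambda>s. g s i)"
  shows "finite {s. mpolv.dim (g s ` I) < mpolv.dim (g 0 ` I)}"
proof (rule mpolv.dim_perturb[OF assms(1)])
  fix i assume "i \<in> I"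
  then obtain p where p: "\<And>s. g s i = poly p (Const s)"
    using assms(2) by (auto simp: poly_curve_def)
  show "\<exists>K w. \<forall>s. g s i = (\<Sum>k<K::nat. cscale (s ^ k) (w k))"
    by (rule exI[of _ "Suc (degree p)"], rule exI[of _ "coeff p"])
      (simp add: cscale_eq p poly_altdef lessThan_Suc_atMost Const_power mult.commute)
qed

section \<open>Graded pieces of ideals and their behaviour in pencils\<close>

lemma mult_span_in:
  assumes "q \<in> mpolv.span B" "mpolv.subspace U" "\<And>b. b \<in> B \<Longrightarrow> f * b \<in> U"
  shows "f * q \<in> U"
  using assms(1)
proof (induction rule: mpolv.span_induct_alt)
  case base
  then show ?case using assms(2) by (simp add: mpolv.subspace_0)
next
  case (step c x y)
  have "f * (cscale c x + y) = Const c * (f * x) + f * y" by (simp add: cscale_eq algebra_simps)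
  then show ?case
    using step assms by (simp add: mpolv.subspace_add mpolv_subspace_scale)
qed

text \<open>For forms \<open>f i\<close> of degree \<open>e \<le> k\<close> this is the degree
  \<open>k\<close> piece of the ideal that they generate. It is written as the span of a finite
  indexed family, the shape to which \<open>dim_poly_curve\<close> applies.\<close>

definition ideal_part :: "nat \<Rightarrow> nat \<Rightarrow> nat \<Rightarrow> nat set \<Rightarrow> (nat \<Rightarrow> nat mpol) \<Rightarrow> nat mpol set" where
  "ideal_part n e k I f = mpolv.span ((\<lambda>(i, \<nu>). f i * single \<nu> 1) ` (I \<times> monoms n (k - e)))"

lemma ideal_part_subspace [simp]: "mpolv.subspace (ideal_part n e k I f)"
  by (simp add: ideal_part_def)

lemma ideal_part_mult: "i \<in> I \<Longrightarrow> q \<in> forms n (k - e) \<Longrightarrow> f i * q \<in> ideal_part n e k I f"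
  unfolding forms_span_monoms
  by (erule mult_span_in) (auto simp: ideal_part_def intro!: mpolv.span_base)

lemma ideal_part_minimal:
  assumes "mpolv.subspace U" "\<And>i q. i \<in> I \<Longrightarrow> q \<in> forms n (k - e) \<Longrightarrow> f i * q \<in> U"
  shows "ideal_part n e k I f \<subseteq> U"
  unfolding ideal_part_def using assms by (intro mpolv.span_minimal) (auto intro: forms_single)

lemma ideal_part_forms:
  assumes "\<And>i. i \<in> I \<Longrightarrow> f i \<in> forms n e" "e \<le> k"
  shows "ideal_part n e k I f \<subseteq> forms n k"
proof (rule ideal_part_minimal[OF forms_subspace])
  fix i q assume "i \<in> I" "q \<in> forms n (k - e)"
  then show "f i * q \<in> forms n k" using forms_mult[OF assms(1), of i q "k - e"] assms(2) by simp
qed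

lemma forms_span_finite: "forms n k \<subseteq> mpolv.span ((\<lambda>m. single m 1) ` monoms n k)"
  "finite ((\<lambda>m. single m (1::complex)) ` monoms n k)"
  by (simp_all add: forms_span_monoms finite_monoms)

lemma finite_independent_forms:
  assumes "C \<subseteq> forms n k" "mpolv.independent C"
  shows "finite C"
proof -
  have "C \<subseteq> mpolv.span ((\<lambda>m. single m 1) ` monoms n k)" using assms(1) forms_span_finite(1) by blast
  from mpolv.independent_span_bound[OF forms_span_finite(2) assms(2) this] show ?thesis by (rule conjunct1)
qed

lemma dim_forms_mono:
  assumes "U \<subseteq> V" "V \<subseteq> forms n k"
  shows "mpolv.dim U \<le> mpolv.dim V"
proof -
  obtain C where C: "C \<subseteq> V" "mpolv.independent C" "V \<subseteq> mpolv.span C" "card C = mpolv.dim V"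
    by (rule mpolv.basis_exists)
  have "finite C" using finite_independent_forms[OF _ C(2)] C(1) assms(2) by blast
  then show ?thesis using mpolv.dim_le_card[of U C] C assms(1) by auto
qed

lemma span_eq_forms:
  assumes "S \<subseteq> forms n l" "card (monoms n l) \<le> mpolv.dim S"
  shows "mpolv.span S = forms n l"
  using mpolv.subspace_eq_of_dim_le[OF forms_span_finite(2), of S n l] assms dim_forms[of n l]
  by (simp add: forms_span_monoms)

definition mono_of :: "nat \<Rightarrow> (nat \<Rightarrow> nat) \<Rightarrow> (nat \<Rightarrow>\<^sub>0 nat)" where
  "mono_of n a = (\<Sum>i\<le>n. single i (a i))"

lemma lookup_mono_of: "lookup (mono_of n a) i = (if i \<le> n then a i else 0)"
proof -
  have "(\<Sum>j\<le>n. lookup (single j (a j)) i) = (\<Sum>j\<le>n. if j = i then a i else 0)"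
    by (rule sum.cong) (auto simp: lookup_single when_def)
  then show ?thesis by (simp add: mono_of_def lookup_sum)
qed

lemma mono_of_monoms: "(\<Sum>i\<le>n. a i) = k \<Longrightarrow> mono_of n a \<in> monoms n k"
proof -
  have "keys (mono_of n a) \<subseteq> {..n}" by (auto simp: in_keys_iff lookup_mono_of split: if_splits)
  then show "(\<Sum>i\<le>n. a i) = k \<Longrightarrow> mono_of n a \<in> monoms n k"
    using mdeg_superset[of "{..n}" "mono_of n a"] by (auto simp: monoms_def lookup_mono_of)
qed

lemma monoms_sum_lookup: "\<mu> \<in> monoms n k \<Longrightarrow> (\<Sum>i\<le>n. lookup \<mu> i) = k"
  using mdeg_superset[of "{..n}" \<mu>] by (auto simp: monoms_def)

lemma mono_eval_atMost: "\<mu> \<in> monoms n k \<Longrightarrow> mono_eval s \<mu> = (\<Prod>i\<le>n. s i ^ lookup \<mu> i)"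
  by (rule mono_eval_superset) (auto simp: monoms_def)

lemma atMost_insert_1: "{..n} = insert 0 {1..n::nat}"
  by auto

text \<open>For \<open>u = 1 / s\<close> the form \<open>g i + Const s * f i\<close> is proportional
  to \<open>f i + Const u * g i\<close>, which specializes to \<open>f i\<close> at
  \<open>u = 0\<close>; ranks only drop under specialization. The set \<open>bad\<close> leaves room
  for further finite exclusions on \<open>s\<close>.\<close>

lemma dim_ideal_part_deform:
  assumes "finite I" "finite bad" "m \<le> k"
    and f: "\<And>i. i \<in> I \<Longrightarrow> f i \<in> forms n m" and g: "\<And>i. i \<in> I \<Longrightarrow> g i \<in> forms n m"
  obtains s where "s \<notin> bad"
    "mpolv.dim (ideal_part n m k I f) \<le> mpolv.dim (ideal_part n m k I (\<lambda>i. g i + Const s * f i))"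
proof -
  define G where "G u = (\<lambda>(i, \<nu>). (f i + Const u * g i) * single \<nu> 1)" for u
  let ?I = "I \<times> monoms n (k - m)"
  define bad' where "bad' = {u. mpolv.dim (G u ` ?I) < mpolv.dim (G 0 ` ?I)}"
  have "finite bad'" unfolding bad'_def
    using assms(1) by (intro dim_poly_curve) (auto simp: finite_monoms G_def intro!: poly_curve_intros)
  \<comment> \<open>The values forbidden for \<open>s\<close> are carried over to \<open>u\<close>;
    \<open>u = 0\<close> is excluded so that \<open>s = 1 / u\<close> makes sense.\<close>
  then have "infinite (UNIV - ({0} \<union> bad' \<union> inverse ` bad))"
    using assms(2) by (intro Diff_infinite_finite) (auto simp: infinite_UNIV_char_0)
  then obtain u where u: "u \<notin> {0} \<union> bad' \<union> inverse ` bad"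
    by (metis DiffE ex_in_conv finite.emptyI)
  have "G 0 ` ?I = (\<lambda>(i, \<nu>). f i * single \<nu> 1) ` ?I" by (auto simp: G_def image_iff)
  then have "mpolv.dim (ideal_part n m k I f) = mpolv.dim (G 0 ` ?I)"
    by (simp add: ideal_part_def)
  also have "\<dots> \<le> mpolv.dim (G u ` ?I)" using u by (simp add: bad'_def)
  also have "\<dots> \<le> mpolv.dim (ideal_part n m k I (\<lambda>i. g i + Const (inverse u) * f i))"
  proof (rule dim_forms_mono)
    show "ideal_part n m k I (\<lambda>i. g i + Const (inverse u) * f i) \<subseteq> forms n k"
      using f g assms(3) by (intro ideal_part_forms forms_add forms_Const_mult) auto
    show "G u ` ?I \<subseteq> ideal_part n m k I (\<lambda>i. g i + Const (inverse u) * f i)"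
    proof clarify
      fix i \<nu> assume i: "i \<in> I" and \<nu>: "\<nu> \<in> monoms n (k - m)"
      have "Const u * ((g i + Const (inverse u) * f i) * single \<nu> 1) =
          (Const u * Const (inverse u)) * f i * single \<nu> 1 + Const u * g i * single \<nu> 1"
        by (simp only: algebra_simps)
      also have "Const u * Const (inverse u) = (1 :: nat mpol)" using u by (simp flip: Const_mult)
      finally have "G u (i, \<nu>) = Const u * ((g i + Const (inverse u) * f i) * single \<nu> 1)"
        by (simp add: G_def distrib_right)
      then show "G u (i, \<nu>) \<in> ideal_part n m k I (\<lambda>i. g i + Const (inverse u) * f i)"
        using ideal_part_mult[OF i forms_single[OF \<nu>], of "\<lambda>i. g i + Const (inverse u) * f i" 1]
        by (simp add: mpolv_subspace_scale)
    qed
  qed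
  finally have "mpolv.dim (ideal_part n m k I f) \<le> mpolv.dim (ideal_part n m k I (\<lambda>i. g i + Const (inverse u) * f i))" .
  moreover have "inverse u \<notin> bad"
  proof
    assume "inverse u \<in> bad"
    then have "inverse (inverse u) \<in> inverse ` bad" by (rule imageI)
    then show False using u by simp
  qed
  ultimately show ?thesis using that by blast
qed

text \<open>For \<open>g = 0\<close> the forms \<open>x\<^sub>i\<^sup>m + s g\<^sub>i\<close> together with \<open>x\<^sub>0\<close> make the polynomial ring
  a free module of rank \<open>m\<^sup>n\<close>, with a basis of monomials; a spanning set stays spanning for almost all \<open>s\<close>.\<close>

lemma dim_ideal_part_n_forms:
  assumes m: "m \<ge> 1" and g: "\<And>i. i \<in> {1..n} \<Longrightarrow> g i \<in> forms n m" and k: "n * m + m \<le> k"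
  shows "mpolv.dim (ideal_part n m k {1..n} g) + m ^ n \<le> card (monoms n k)"
proof -
  define y where "y s i = Var i ^ m + Const s * g i" for s i
  \<comment> \<open>Each complete factor \<open>Var i ^ m\<close> with \<open>i \<ge> 1\<close> of
    the monomial \<mu> is replaced by \<open>y s i\<close>, so that \<open>w 0 \<mu>\<close> is the
    monomial itself.\<close>
  define w where "w s \<mu> = Var 0 ^ lookup \<mu> 0 *
      (\<Prod>i\<in>{1..n}. Var i ^ (lookup \<mu> i mod m) * y s i ^ (lookup \<mu> i div m))" for s \<mu>
  have y_forms: "y s i \<in> forms n m" if "i \<in> {1..n}" for s i
    using that g forms_power[OF forms_Var, of i n m] by (auto simp: y_def intro!: forms_add forms_Const_mult)
  have w_forms: "w s \<mu> \<in> forms n l" if "\<mu> \<in> monoms n l" for s \<mu> l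
  proof -
    have "w s \<mu> \<in> forms n (lookup \<mu> 0 * 1 + (\<Sum>i\<in>{1..n}. (lookup \<mu> i mod m) * 1 + (lookup \<mu> i div m) * m))"
      unfolding w_def using y_forms
      by (intro forms_mult forms_prod forms_power forms_Var) auto
    also have "lookup \<mu> 0 * 1 + (\<Sum>i\<in>{1..n}. (lookup \<mu> i mod m) * 1 + (lookup \<mu> i div m) * m) = l"
      using monoms_sum_lookup[OF that] by (simp add: atMost_insert_1)
    finally show ?thesis .
  qed
  have w0: "w 0 \<mu> = single \<mu> 1" if "\<mu> \<in> monoms n l" for \<mu> l
  proof -
    have "w 0 \<mu> = mono_eval Var \<mu>"
      unfolding mono_eval_atMost[OF that] w_def y_def atMost_insert_1
      by (simp flip: power_mult power_add)
    then show ?thesis by (simp add: mono_eval_Var)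
  qed
  define l where "l = k - m"
  have curve_w: "poly_curve (\<lambda>s. w s \<mu>)" for \<mu>
    unfolding w_def y_def by (intro poly_curve_intros)
  have fin1: "finite {s. mpolv.dim (w s ` monoms n l) < mpolv.dim (w 0 ` monoms n l)}"
    by (intro dim_poly_curve finite_monoms curve_w)
  have bound_y: "mpolv.dim (ideal_part n m k {1..n} (y s)) + m ^ n \<le> card (monoms n k)"
    if s: "\<not> mpolv.dim (w s ` monoms n l) < mpolv.dim (w 0 ` monoms n l)" for s
  proof -
    have "w 0 ` monoms n l = (\<lambda>\<mu>. single \<mu> 1) ` monoms n l" using w0 by auto
    then have "mpolv.dim (w 0 ` monoms n l) = card (monoms n l)"
      by (metis dim_forms forms_span_monoms mpolv.dim_span)
    then have sp: "mpolv.span (w s ` monoms n l) = forms n l"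
      using s w_forms by (intro span_eq_forms) auto
    \<comment> \<open>The reduced monomials of degree \<open>k\<close>. There are at least
      \<open>m ^ n\<close> of them, and the ideal lies in the span of the \<open>w s \<mu>\<close>
      with \<mu> not reduced.\<close>
    define R where "R = {\<mu> \<in> monoms n k. \<forall>i\<in>{1..n}. lookup \<mu> i < m}"
    have "ideal_part n m k {1..n} (y s) \<subseteq> mpolv.span (w s ` (monoms n k - R))"
    proof (rule ideal_part_minimal[OF mpolv.subspace_span])
      fix i q assume i: "i \<in> {1..n}" and q: "q \<in> forms n (k - m)"
      show "y s i * q \<in> mpolv.span (w s ` (monoms n k - R))"
      proof (rule mult_span_in[of _ "w s ` monoms n l"])
        show "q \<in> mpolv.span (w s ` monoms n l)" using q sp l_def by simp
        fix b assume "b \<in> w s ` monoms n l"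
        then obtain \<nu> where \<nu>: "\<nu> \<in> monoms n l" "b = w s \<nu>" by auto
        define \<mu> where "\<mu> = single i m + \<nu>"
        have lk: "lookup \<mu> j = (if j = i then m + lookup \<nu> j else lookup \<nu> j)" for j
          by (auto simp: \<mu>_def lookup_add lookup_single when_def)
        have \<mu>: "\<mu> \<in> monoms n k - R"
        proof -
          have "single i m \<in> monoms n m" using i by (auto simp: monoms_def split: if_splits)
          then have "\<mu> \<in> monoms n k" using monoms_add[of "single i m" n m \<nu> l] \<nu>(1) k by (simp add: \<mu>_def l_def)
          moreover have "\<mu> \<notin> R" using i lk[of i] by (auto simp: R_def intro!: bexI[of _ i])
          ultimately show ?thesis by simp
        qed
        \<comment> \<open>Raising the exponent of index \<open>i\<close> by \<open>m\<close> leaves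
          its remainder modulo \<open>m\<close> unchanged and adds one factor
          \<open>y s i\<close>.\<close>
        have "w s \<mu> = y s i * w s \<nu>"
        proof -
          have "(\<Prod>j\<in>{1..n}. Var j ^ (lookup \<mu> j mod m) * y s j ^ (lookup \<mu> j div m)) =
              (\<Prod>j\<in>{1..n}. (if j = i then y s i else 1) * (Var j ^ (lookup \<nu> j mod m) * y s j ^ (lookup \<nu> j div m)))"
            using m by (intro prod.cong) (auto simp: lk)
          also have "\<dots> = y s i * (\<Prod>j\<in>{1..n}. Var j ^ (lookup \<nu> j mod m) * y s j ^ (lookup \<nu> j div m))"
            using i by (simp add: prod.distrib)
          finally show ?thesis using i lk[of 0] by (simp add: w_def)
        qed
        then show "y s i * b \<in> mpolv.span (w s ` (monoms n k - R))"
          using \<mu> \<nu> by (metis imageI mpolv.span_base)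
      qed auto
    qed
    then have "mpolv.dim (ideal_part n m k {1..n} (y s)) \<le> card (w s ` (monoms n k - R))"
      by (intro mpolv.dim_le_card) (auto simp: finite_monoms)
    also have "\<dots> \<le> card (monoms n k - R)" by (intro card_image_le) (auto simp: finite_monoms)
    also have "\<dots> = card (monoms n k) - card R"
      by (intro card_Diff_subset) (auto simp: R_def finite_monoms intro: finite_subset[OF _ finite_monoms])
    finally have *: "mpolv.dim (ideal_part n m k {1..n} (y s)) \<le> card (monoms n k) - card R" .
    have "m ^ n = card ({1..n} \<rightarrow>\<^sub>E {..<m})" by (simp add: card_PiE)
    also have "\<dots> \<le> card R"
    proof (rule card_inj_on_le)
      \<comment> \<open>The exponents at \<open>1..n\<close> may be any numbers below
        \<open>m\<close>; the exponent at 0 fills up the degree, which is possible because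
        \<open>n * m \<le> k\<close>.\<close>
      let ?F = "\<lambda>a. mono_of n (\<lambda>i. if i = 0 then k - (\<Sum>i\<in>{1..n}. a i) else a i)"
      show "inj_on ?F ({1..n} \<rightarrow>\<^sub>E {..<m})"
      proof (rule inj_onI)
        fix a b assume a: "a \<in> {1..n} \<rightarrow>\<^sub>E {..<m}" and b: "b \<in> {1..n} \<rightarrow>\<^sub>E {..<m}" and "?F a = ?F b"
        then have F: "lookup (?F a) i = lookup (?F b) i" for i by simp
        have "a i = b i" if "i \<in> {1..n}" for i
          using that F[of i] by (simp add: lookup_mono_of)
        then show "a = b" by (rule PiE_ext[OF a b])
      qed
      show "?F ` ({1..n} \<rightarrow>\<^sub>E {..<m}) \<subseteq> R"
      proof clarify
        fix a assume a: "a \<in> {1..n} \<rightarrow>\<^sub>E {..<m}"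
        have "(\<Sum>i\<in>{1..n}. a i) \<le> (\<Sum>i\<in>{1..n}. m)" using a by (intro sum_mono) (force simp: PiE_def)
        then have "(\<Sum>i\<in>{1..n}. a i) \<le> k" using k by simp
        moreover have "(\<Sum>i\<in>{1..n}. if i = 0 then k - (\<Sum>i\<in>{1..n}. a i) else a i) = (\<Sum>i\<in>{1..n}. a i)"
          by (intro sum.cong) auto
        ultimately have "?F a \<in> monoms n k"
          by (intro mono_of_monoms) (simp add: atMost_insert_1)
        then show "?F a \<in> R" using a by (auto simp: R_def lookup_mono_of PiE_def Pi_def)
      qed
      show "finite R" by (auto simp: R_def intro: finite_subset[OF _ finite_monoms])
    qed
    finally have "m ^ n \<le> card R" .
    moreover have "card R \<le> card (monoms n k)" by (intro card_mono) (auto simp: R_def finite_monoms)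
    ultimately show ?thesis using * by linarith
  qed
  \<comment> \<open>A member of the pencil that generates at least as much as \<open>g\<close> while
    the \<open>w s \<mu>\<close> still span all forms of degree \<open>l\<close>.\<close>
  obtain s where s: "s \<notin> {s. mpolv.dim (w s ` monoms n l) < mpolv.dim (w 0 ` monoms n l)}"
      "mpolv.dim (ideal_part n m k {1..n} g) \<le> mpolv.dim (ideal_part n m k {1..n} (\<lambda>i. Var i ^ m + Const s * g i))"
  proof (rule dim_ideal_part_deform[OF _ fin1, of "{1..n}" m k g n "\<lambda>i. Var i ^ m"])
    show "Var i ^ m \<in> forms n m" if "i \<in> {1..n}" for i
      using forms_power[OF forms_Var, of i n m] that by simp
  qed (use g k in auto)
  from s(1) have "mpolv.dim (ideal_part n m k {1..n} (y s)) + m ^ n \<le> card (monoms n k)"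
    by (intro bound_y) simp
  moreover have "y s = (\<lambda>i. Var i ^ m + Const s * g i)" by (simp add: y_def fun_eq_iff)
  ultimately show ?thesis using s(2) by simp
qed

section \<open>Coordinate changes by linear forms, and the special solution of a syzygy\<close>

lemma monoms_Suc_obtain:
  assumes "m \<in> monoms n (Suc k)"
  obtains i m' where "i \<le> n" "m' \<in> monoms n k" "m = single i 1 + m'"
proof -
  have "m \<noteq> 0" using assms by (auto simp: monoms_def)
  then obtain i where i: "i \<in> keys m" by (metis all_not_in_conv keys_eq_empty)
  have m: "m = single i 1 + (m - single i 1)"
    using i by (simp add: single_add_minus in_keys_iff)
  then have "m - single i 1 \<in> monoms n k"
    using assms monoms_add_cancel[of "single i 1" "m - single i 1" n "Suc k"] by simp
  then show ?thesis using that[of i, OF _ _ m] i assms by (auto simp: monoms_def)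
qed

lemma monoms_0: "m \<in> monoms n 0 \<Longrightarrow> m = 0"
  using lookup_le_mdeg[of m] by (intro poly_mapping_eqI) (auto simp: monoms_def)

lemma monoms_1: "monoms n 1 = (\<lambda>i. single i 1) ` {..n}"
proof
  show "monoms n 1 \<subseteq> (\<lambda>i. single i 1) ` {..n}"
  proof
    fix m assume "m \<in> monoms n 1"
    then obtain i m' where "i \<le> n" "m' \<in> monoms n 0" "m = single i 1 + m'"
      using monoms_Suc_obtain[of m n 0] by auto
    then show "m \<in> (\<lambda>i. single i 1) ` {..n}" using monoms_0 by fastforce
  qed
  show "(\<lambda>i. single i 1) ` {..n} \<subseteq> monoms n 1"
    by (auto simp: monoms_def split: if_splits)
qed

lemma card_monoms_1: "card (monoms n 1) = n + 1"
proof -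
  have "inj_on (\<lambda>i. single i (1::nat)) {..n}"
    by (rule inj_onI) (metis keys_single singleton_inject zero_neq_one)
  then show ?thesis unfolding monoms_1 by (simp add: card_image)
qed

text \<open>Induction on the degree: one variable is split off from a monomial, expanded in the
  \<open>z i\<close>, and multiplied into the products of degree one less.\<close>

lemma forms_span_linear_forms:
  assumes "Var ` {..n} \<subseteq> mpolv.span (z ` {..n})" "\<And>i. i \<le> n \<Longrightarrow> z i \<in> forms n 1"
  shows "forms n k = mpolv.span (mono_eval z ` monoms n k)"
proof
  have "single m 1 \<in> mpolv.span (mono_eval z ` monoms n k)" if "m \<in> monoms n k" for m
    using that
  proof (induction k arbitrary: m)
    case 0
    then have "m = 0" by (rule monoms_0)
    then show ?case using 0 by (auto intro!: mpolv.span_base image_eqI[of _ _ 0])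
  next
    case (Suc k)
    obtain i m' where i: "i \<le> n" "m' \<in> monoms n k" "m = single i 1 + m'"
      using Suc.prems by (rule monoms_Suc_obtain)
    have step: "z j * single m' 1 \<in> mpolv.span (mono_eval z ` monoms n (Suc k))" if j: "j \<le> n" for j
    proof (rule mult_span_in[OF Suc.IH[OF i(2)]])
      fix b assume "b \<in> mono_eval z ` monoms n k"
      then obtain \<nu> where \<nu>: "\<nu> \<in> monoms n k" "b = mono_eval z \<nu>" by auto
      have "single j 1 \<in> monoms n 1" using j by (auto simp: monoms_def split: if_splits)
      then have "single j 1 + \<nu> \<in> monoms n (Suc k)" using monoms_add[OF _ \<nu>(1), of "single j 1" 1] by simp
      moreover have "z j * b = mono_eval z (single j 1 + \<nu>)" by (simp add: \<nu> mono_eval_add)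
      ultimately show "z j * b \<in> mpolv.span (mono_eval z ` monoms n (Suc k))"
        by (metis imageI mpolv.span_base)
    qed simp
    have "single m' 1 * Var i \<in> mpolv.span (mono_eval z ` monoms n (Suc k))"
      using assms(1) i(1) by (intro mult_span_in[of "Var i" "z ` {..n}"]) (auto simp: mult.commute intro: step)
    then show ?case by (simp add: i(3) Var_def mult_single add.commute)
  qed
  then show "forms n k \<subseteq> mpolv.span (mono_eval z ` monoms n k)"
    unfolding forms_span_monoms by (intro mpolv.span_minimal) auto
  show "mpolv.span (mono_eval z ` monoms n k) \<subseteq> forms n k"
  proof (rule mpolv.span_minimal)
    show "mono_eval z ` monoms n k \<subseteq> forms n k"
    proof clarify
      fix m assume m: "m \<in> monoms n k"
      have "mono_eval z m \<in> forms n (\<Sum>i\<le>n. lookup m i * 1)"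
        unfolding mono_eval_atMost[OF m] using assms(2) by (intro forms_prod forms_power) auto
      then show "mono_eval z m \<in> forms n k" using monoms_sum_lookup[OF m] by simp
    qed
  qed (rule forms_subspace)
qed

lemma mono_eval_split:
  assumes "e \<le> lookup \<mu> i"
  shows "mono_eval z \<mu> = z i ^ e * mono_eval z (\<mu> - single i e)"
proof -
  have "\<mu> = single i e + (\<mu> - single i e)" using assms by (simp add: single_add_minus)
  then show ?thesis by (metis mono_eval_add mono_eval_single)
qed

lemma monoms_diff_single:
  assumes "\<mu> \<in> monoms n k" "e \<le> lookup \<mu> i"
  shows "\<mu> - single i e \<in> monoms n (k - e)"
proof -
  have "\<mu> = single i e + (\<mu> - single i e)" using assms by (simp add: single_add_minus)
  then show ?thesis using monoms_add_cancel[of "single i e" "\<mu> - single i e" n k] assms(1) by simp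
qed

text \<open>A particular solution of \<open>\<Sum>i\<le>r. z i * f i = 0\<close> whose members with index at least 1
  cut out, on \<open>z 0 = 0\<close>, a scheme of degree at most \<open>m ^ (n - 1)\<close>.\<close>

definition special_syzygy :: "nat \<Rightarrow> nat \<Rightarrow> (nat \<Rightarrow> nat mpol) \<Rightarrow> nat \<Rightarrow> nat mpol" where
  "special_syzygy m r z i =
     (if i < r then z (Suc i) ^ m else 0) - (if 0 < i \<and> i \<le> r then z (i - 1) * z i ^ (m - 1) else 0)
       + (if r < i then z i ^ m else 0)"

text \<open>The sum telescopes: \<open>z i * z (Suc i) ^ m\<close>, contributed by index
  \<open>i\<close>, cancels against the negative term of index \<open>Suc i\<close>.\<close>

lemma special_syzygy_eq:
  assumes "m \<ge> 1"
  shows "(\<Sum>i\<le>r. z i * special_syzygy m r z i) = 0"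
proof -
  have "(\<Sum>i\<le>r. z i * special_syzygy m r z i) =
      (\<Sum>i\<le>r. if i < r then z i * z (Suc i) ^ m else 0) -
      (\<Sum>i\<le>r. if 0 < i then z i * (z (i - 1) * z i ^ (m - 1)) else 0)"
    unfolding sum_subtractf[symmetric]
    by (intro sum.cong) (auto simp: special_syzygy_def algebra_simps)
  also have "(\<Sum>i\<le>r. if i < r then z i * z (Suc i) ^ m else 0) = (\<Sum>i<r. z i * z (Suc i) ^ m)"
    by (simp add: sum.If_cases lessThan_def Collect_conj_eq[symmetric] Int_def) (auto intro!: sum.cong)
  also have "(\<Sum>i\<le>r. if 0 < i then z i * (z (i - 1) * z i ^ (m - 1)) else 0) =
      (\<Sum>i<r. z (Suc i) * (z i * z (Suc i) ^ (m - 1)))"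
    by (simp add: sum.atMost_shift)
  also have "\<dots> = (\<Sum>i<r. z i * z (Suc i) ^ m)"
  proof (intro sum.cong refl)
    fix i
    have "z (Suc i) ^ m = z (Suc i) * z (Suc i) ^ (m - 1)"
      using assms by (metis Suc_diff_1 less_eq_Suc_le One_nat_def power_Suc)
    then show "z (Suc i) * (z i * z (Suc i) ^ (m - 1)) = z i * z (Suc i) ^ m"
      by (simp add: algebra_simps)
  qed
  finally show ?thesis by simp
qed

lemma special_syzygy_forms:
  assumes "m \<ge> 1" "\<And>i. i \<le> n \<Longrightarrow> z i \<in> forms n 1" "i \<le> n" "r \<le> n"
  shows "special_syzygy m r z i \<in> forms n m"
proof -
  have "z j ^ m \<in> forms n m" if "j \<le> n" for j
    using forms_power[OF assms(2), of j m] that by simp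
  moreover have "z (i - 1) * z i ^ (m - 1) \<in> forms n m"
    using forms_mult[OF assms(2) forms_power[OF assms(2), of i "m - 1"], of "i - 1"] assms(1,3) by simp
  ultimately show ?thesis
    unfolding special_syzygy_def using assms by (intro forms_add forms_diff) auto
qed

text \<open>Exponent vectors of the products of the \<open>z i\<close> that span the forms of degree
  \<open>l\<close> modulo \<open>z 0\<close> and the members with index at least 1 of the special
  solution.\<close>

definition special_monoms :: "nat \<Rightarrow> nat \<Rightarrow> nat \<Rightarrow> (nat \<Rightarrow>\<^sub>0 nat) set" where
  "special_monoms m n l = {\<mu> \<in> monoms n l. lookup \<mu> 0 = 0 \<and> (\<forall>i\<in>{2..n}. lookup \<mu> i < m)}"

lemma finite_special_monoms: "finite (special_monoms m n l)"
  by (auto simp: special_monoms_def intro: finite_subset[OF _ finite_monoms])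

text \<open>The exponents at \<open>2..n\<close> determine the monomial, because index 0 is absent
  and the degree then fixes the exponent at index 1.\<close>

lemma card_special_monoms:
  assumes "n \<ge> 1"
  shows "card (special_monoms m n l) \<le> m ^ (n - 1)"
proof -
  have "card (special_monoms m n l) \<le> card ({2..n} \<rightarrow>\<^sub>E {..<m})"
  proof (rule card_inj_on_le)
    let ?F = "\<lambda>\<mu>. restrict (lookup \<mu>) {2..n}"
    show "?F ` special_monoms m n l \<subseteq> {2..n} \<rightarrow>\<^sub>E {..<m}"
      by (auto simp: special_monoms_def)
    show "inj_on ?F (special_monoms m n l)"
    proof (rule inj_onI)
      fix \<mu> \<nu> assume a: "\<mu> \<in> special_monoms m n l" "\<nu> \<in> special_monoms m n l" and eq: "?F \<mu> = ?F \<nu>"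
      have ge2: "lookup \<mu> i = lookup \<nu> i" if "i \<in> {2..n}" for i
        using fun_cong[OF eq, of i] that by simp
      have set: "{..n} = insert 0 (insert 1 {2..n})" using assms by auto
      have "lookup \<mu> 1 + (\<Sum>i\<in>{2..n}. lookup \<mu> i) = lookup \<nu> 1 + (\<Sum>i\<in>{2..n}. lookup \<nu> i)"
        using a monoms_sum_lookup[of \<mu> n l] monoms_sum_lookup[of \<nu> n l] unfolding set
        by (simp add: special_monoms_def)
      moreover have "(\<Sum>i\<in>{2..n}. lookup \<mu> i) = (\<Sum>i\<in>{2..n}. lookup \<nu> i)"
        using ge2 by (intro sum.cong) auto
      ultimately have "lookup \<mu> 1 = lookup \<nu> 1" by simp
      moreover have "lookup \<mu> 0 = lookup \<nu> 0" using a by (simp add: special_monoms_def)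
      moreover have "lookup \<mu> i = lookup \<nu> i" if "i \<notin> {..n}" for i
      proof -
        have "i \<notin> keys \<mu>" "i \<notin> keys \<nu>" using a that by (auto simp: special_monoms_def monoms_def)
        then show ?thesis by (simp add: in_keys_iff)
      qed
      ultimately have "lookup \<mu> i = lookup \<nu> i" for i
        using ge2 set by (metis insertE)
      then show "\<mu> = \<nu>" by (rule poly_mapping_eqI)
    qed
  qed (auto intro: finite_PiE)
  then show ?thesis by (simp add: card_PiE)
qed

text \<open>Modulo the special syzygy, \<open>z i ^ m\<close> can be replaced by \<open>z (i - 2) * z (i - 1) ^ (m - 1)\<close>, which
  decreases the weighted degree \<open>\<Sum>i. i * \<mu> i\<close> of the exponent vector \<open>\<mu>\<close>.\<close>

lemma special_syzygy_spanning:
  assumes m: "m \<ge> 1" and r: "r \<le> n" and l: "m \<le> l"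
    and z: "\<And>i. i \<le> n \<Longrightarrow> z i \<in> forms n 1"
    and U: "mpolv.subspace U" "\<And>q. q \<in> forms n (l - 1) \<Longrightarrow> z 0 * q \<in> U"
      "\<And>i q. i \<in> {1..n} \<Longrightarrow> q \<in> forms n (l - m) \<Longrightarrow> special_syzygy m r z i * q \<in> U"
      "\<And>\<mu>. \<mu> \<in> special_monoms m n l \<Longrightarrow> mono_eval z \<mu> \<in> U"
    and \<mu>: "\<mu> \<in> monoms n l"
  shows "mono_eval z \<mu> \<in> U"
  using \<mu>
proof (induction "\<Sum>i\<le>n. i * lookup \<mu> i" arbitrary: \<mu> rule: less_induct)
  case less
  have forms: "mono_eval z \<nu> \<in> forms n k" if "\<nu> \<in> monoms n k" for \<nu> k
  proof -
    have "mono_eval z \<nu> \<in> forms n (\<Sum>i\<le>n. lookup \<nu> i * 1)"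
      unfolding mono_eval_atMost[OF that] using z by (intro forms_prod forms_power) auto
    then show ?thesis using monoms_sum_lookup[OF that] by simp
  qed
  \<comment> \<open>Either \<mu> is divisible by \<open>z 0\<close>, or it is already reduced, or
    some exponent at \<open>i \<ge> 2\<close> reaches \<open>m\<close>. Beyond \<open>r\<close> the
    special solution is simply \<open>z i ^ m\<close>; up to \<open>r\<close> it has to be used as a
    rewriting rule.\<close>
  consider "lookup \<mu> 0 > 0" | "\<mu> \<in> special_monoms m n l" |
    i where "i \<in> {2..n}" "m \<le> lookup \<mu> i" "r < i" | i where "i \<in> {2..n}" "m \<le> lookup \<mu> i" "i \<le> r"
    using less.prems by (fastforce simp: special_monoms_def not_less)
  then show ?case
  proof cases
    case 1
    have "mono_eval z \<mu> = z 0 ^ 1 * mono_eval z (\<mu> - single 0 1)"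
      using 1 by (intro mono_eval_split) auto
    moreover have "mono_eval z (\<mu> - single 0 1) \<in> forms n (l - 1)"
      using 1 less.prems by (intro forms monoms_diff_single) auto
    ultimately show ?thesis using U(2) by simp
  next
    case 2
    then show ?thesis by (rule U(4))
  next
    case 3
    have "mono_eval z \<mu> = z i ^ m * mono_eval z (\<mu> - single i m)"
      using 3 by (intro mono_eval_split) auto
    moreover have "mono_eval z (\<mu> - single i m) \<in> forms n (l - m)"
      using 3 less.prems by (intro forms monoms_diff_single) auto
    moreover have "special_syzygy m r z i = z i ^ m" using 3 by (simp add: special_syzygy_def)
    ultimately show ?thesis using U(3)[of i] 3 by auto
  next
    case 4
    define \<nu> where "\<nu> = \<mu> - single i m"
    have \<nu>: "\<nu> \<in> monoms n (l - m)" unfolding \<nu>_def using 4 less.prems by (intro monoms_diff_single) auto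
    \<comment> \<open>The power \<open>z i ^ m\<close> is the first term of the member with index
      \<open>i - 1\<close>; this is \<open>Suc j\<close>, and \<open>i \<ge> 2\<close> makes the
      index at least 1.\<close>
    define j where "j = i - 2"
    have i: "i = Suc (Suc j)" using 4 by (auto simp: j_def)
    have sp: "special_syzygy m r z (Suc j) = z i ^ m - z j * z (Suc j) ^ (m - 1)"
      using 4 by (simp add: special_syzygy_def i)
    define \<mu>' where "\<mu>' = single j 1 + single (Suc j) (m - 1) + \<nu>"
    have "single j 1 + single (Suc j) (m - 1) \<in> monoms n m"
      using 4 m by (auto simp: monoms_def keys_add_nat i split: if_splits)
    then have \<mu>': "\<mu>' \<in> monoms n l" using monoms_add[OF _ \<nu>, of _ m] l by (simp add: \<mu>'_def)
    have \<mu>_eq: "\<mu> = single i m + \<nu>"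
      using 4 by (simp add: \<nu>_def single_add_minus)
    have wt_single: "(\<Sum>k\<le>n. k * lookup (single a e) k) = a * e" if "a \<le> n" for a e
    proof -
      have "(\<Sum>k\<le>n. k * lookup (single a e) k) = (\<Sum>k\<le>n. if k = a then a * e else 0)"
        by (intro sum.cong) (auto simp: lookup_single when_def)
      then show ?thesis using that by simp
    qed
    have "(\<Sum>k\<le>n. k * lookup \<mu>' k) = j * 1 + Suc j * (m - 1) + (\<Sum>k\<le>n. k * lookup \<nu> k)"
      using wt_single[of j 1] wt_single[of "Suc j" "m - 1"] 4 i
      unfolding \<mu>'_def lookup_add by (simp add: distrib_left sum.distrib)
    moreover have "(\<Sum>k\<le>n. k * lookup \<mu> k) = i * m + (\<Sum>k\<le>n. k * lookup \<nu> k)"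
      using wt_single[of i m] 4 unfolding \<mu>_eq lookup_add by (simp add: distrib_left sum.distrib)
    moreover have "j * 1 + Suc j * (m - 1) < i * m"
    proof -
      obtain m' where "m = Suc m'" using m by (cases m) auto
      then show ?thesis by (simp add: i)
    qed
    ultimately have "mono_eval z \<mu>' \<in> U" using less.hyps[of \<mu>'] \<mu>' by simp
    moreover have "special_syzygy m r z (Suc j) * mono_eval z \<nu> \<in> U"
      using 4 i by (intro U(3) forms \<nu>) auto
    moreover have "mono_eval z \<mu> = special_syzygy m r z (Suc j) * mono_eval z \<nu> + mono_eval z \<mu>'"
      unfolding sp \<mu>_eq \<mu>'_def by (simp add: mono_eval_add algebra_simps)
    ultimately show ?thesis using U(1) by (simp add: mpolv.subspace_add)
  qed
qed

text \<open>The case in which the coefficients of the syzygy are the first members of a basis of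
  linear forms, so that a special solution with the same coefficients is available. Multiplication
  by \<open>g s 0\<close> sends \<open>z 0\<close> into the ideal of the other members, so modulo
  that ideal its image is spanned by the images of the special monomials.\<close>

lemma dim_ideal_part_syzygy_basis:
  assumes n: "n \<ge> 1" and m: "m \<ge> 1" and r: "r \<le> n"
    and z: "\<And>i. i \<le> n \<Longrightarrow> z i \<in> forms n 1" "Var ` {..n} \<subseteq> mpolv.span (z ` {..n})"
    and f: "\<And>i. i \<le> n \<Longrightarrow> f i \<in> forms n m" and syz: "(\<Sum>i\<le>r. z i * f i) = 0"
    and k: "n * m + 2 * m \<le> k"
  shows "mpolv.dim (ideal_part n m k {..n} f) + m ^ n \<le> card (monoms n k) + m ^ (n - 1)"
proof -
  define l where "l = k - m"
  have l: "m \<le> l" "1 \<le> l" using k m by (auto simp: l_def)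
  define h where "h = special_syzygy m r z"
  have h: "h i \<in> forms n m" if "i \<le> n" for i
    unfolding h_def using m z(1) that r by (intro special_syzygy_forms) auto
  have h_syz: "(\<Sum>i\<le>r. z i * h i) = 0" unfolding h_def using m by (rule special_syzygy_eq)
  \<comment> \<open>Tags for three kinds of generators in degree \<open>l\<close>: multiples of
    \<open>z 0\<close> (tag 0), multiples of the members \<open>1..n\<close> of the pencil, and the
    special monomials (tag \<open>Suc n\<close>). At \<open>s = 0\<close> they span all forms of
    degree \<open>l\<close>.\<close>
  define I where "I = {0} \<times> monoms n (l - 1) \<union> {1..n} \<times> monoms n (l - m) \<union> {Suc n} \<times> special_monoms m n l"
  define H where "H s = (\<lambda>(i, \<nu>). if i = 0 then z 0 * single \<nu> 1
      else if i \<le> n then (h i + Const s * f i) * single \<nu> 1 else mono_eval z \<nu>)" for s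
  define g where "g s i = h i + Const s * f i" for s i
  have zmon: "mono_eval z \<nu> \<in> forms n k" if "\<nu> \<in> monoms n k" for \<nu> k
    using forms_span_linear_forms[OF z(2,1), of k] that by (simp add: mpolv.span_base)
  have HU: "z 0 * q \<in> mpolv.span (H s ` I)" if "q \<in> forms n (l - 1)" for q s
  proof (rule mult_span_in[of q "(\<lambda>m. single m 1) ` monoms n (l - 1)"])
    fix b assume "b \<in> (\<lambda>m. single m (1::complex)) ` monoms n (l - 1)"
    then obtain \<nu> where "\<nu> \<in> monoms n (l - 1)" "b = single \<nu> 1" by auto
    then show "z 0 * b \<in> mpolv.span (H s ` I)"
      by (intro mpolv.span_base image_eqI[of _ _ "(0, \<nu>)"]) (auto simp: H_def I_def)
  qed (use that in \<open>auto simp: forms_span_monoms\<close>)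
  have HU2: "g s i * q \<in> mpolv.span (H s ` I)" if "i \<in> {1..n}" "q \<in> forms n (l - m)" for i q s
  proof (rule mult_span_in[of q "(\<lambda>m. single m 1) ` monoms n (l - m)"])
    fix b assume "b \<in> (\<lambda>m. single m (1::complex)) ` monoms n (l - m)"
    then obtain \<nu> where "\<nu> \<in> monoms n (l - m)" "b = single \<nu> 1" by auto
    then show "g s i * b \<in> mpolv.span (H s ` I)"
      using that by (intro mpolv.span_base image_eqI[of _ _ "(i, \<nu>)"]) (auto simp: H_def I_def g_def)
  qed (use that in \<open>auto simp: forms_span_monoms\<close>)
  have H_forms: "H s ` I \<subseteq> forms n l" for s
  proof -
    have "z 0 * single \<nu> 1 \<in> forms n l" if "\<nu> \<in> monoms n (l - 1)" for \<nu>
      using forms_mult[OF z(1) forms_single[OF that], of 0 1] l by simp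
    moreover have "(h i + Const s * f i) * single \<nu> 1 \<in> forms n l"
      if "i \<in> {1..n}" "\<nu> \<in> monoms n (l - m)" for i \<nu>
      using forms_mult[OF forms_add[OF h forms_Const_mult[OF f]] forms_single[OF that(2)], of i i s 1] that l
      by simp
    ultimately show ?thesis using zmon by (auto simp: H_def I_def special_monoms_def)
  qed
  have zspan: "forms n l = mpolv.span (mono_eval z ` monoms n l)"
    by (rule forms_span_linear_forms) (use z in auto)
  have "forms n l \<subseteq> mpolv.span (H 0 ` I)"
    unfolding zspan
  proof (rule mpolv.span_minimal[OF _ mpolv.subspace_span], clarify)
    fix \<mu> assume \<mu>: "\<mu> \<in> monoms n l"
    show "mono_eval z \<mu> \<in> mpolv.span (H 0 ` I)"
    proof (rule special_syzygy_spanning[OF m r l(1) z(1) mpolv.subspace_span _ _ _ \<mu>])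
      show "special_syzygy m r z i * q \<in> mpolv.span (H 0 ` I)"
        if "i \<in> {1..n}" "q \<in> forms n (l - m)" for i q
        using HU2[OF that, of 0] by (simp add: g_def h_def)
      show "mono_eval z \<mu> \<in> mpolv.span (H 0 ` I)" if "\<mu> \<in> special_monoms m n l" for \<mu>
        using that by (intro mpolv.span_base image_eqI[of _ _ "(Suc n, \<mu>)"]) (auto simp: H_def I_def)
    qed (use HU in auto)
  qed
  then have "mpolv.span (H 0 ` I) = forms n l"
    using H_forms by (metis forms_subspace mpolv.span_minimal subset_antisym)
  then have dim_H0: "mpolv.dim (H 0 ` I) = card (monoms n l)"
    by (metis dim_forms mpolv.dim_span)
  have finI: "finite I" by (auto simp: I_def finite_monoms finite_special_monoms)
  have fin: "finite {s. mpolv.dim (H s ` I) < mpolv.dim (H 0 ` I)}"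
  proof (rule dim_poly_curve[OF finI])
    fix x assume "x \<in> I"
    show "poly_curve (\<lambda>s. H s x)"
      by (cases x; cases "fst x = 0"; cases "fst x \<le> n") (auto simp: H_def intro!: poly_curve_intros)
  qed
  \<comment> \<open>Besides comparing the ideals, \<open>s\<close> must avoid the finitely many
    values at which the generators \<open>H s\<close> fail to span degree \<open>l\<close>.\<close>
  obtain s where s: "s \<notin> {s. mpolv.dim (H s ` I) < mpolv.dim (H 0 ` I)}"
      "mpolv.dim (ideal_part n m k {..n} f) \<le> mpolv.dim (ideal_part n m k {..n} (\<lambda>i. h i + Const s * f i))"
    by (rule dim_ideal_part_deform[OF _ fin, of "{..n}" m k f n h]) (use f h k in auto)
  have g_forms: "g s i \<in> forms n m" if "i \<le> n" for i
    unfolding g_def using that by (intro forms_add forms_Const_mult h f)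
  have g_syz: "(\<Sum>i\<le>r. z i * g s i) = 0"
  proof -
    have "(\<Sum>i\<le>r. z i * g s i) = (\<Sum>i\<le>r. z i * h i) + Const s * (\<Sum>i\<le>r. z i * f i)"
      by (simp add: g_def sum_distrib_left sum.distrib algebra_simps)
    then show ?thesis using h_syz syz by simp
  qed
  have sp: "mpolv.span (H s ` I) = forms n l"
    using s(1) dim_H0 by (intro span_eq_forms H_forms) auto
  define A where "A = ideal_part n m k {1..n} (g s)"
  define T where "T = (\<lambda>\<mu>. g s 0 * mono_eval z \<mu>) ` special_monoms m n l"
  have A_forms: "A \<subseteq> forms n k" unfolding A_def using g_forms k by (intro ideal_part_forms) auto
  have A_span: "a \<in> mpolv.span (A \<union> T)" if "a \<in> A" for a using that by (simp add: mpolv.span_base)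
  have A_mult: "g s i * q \<in> A" if "i \<in> {1..n}" "q \<in> forms n l" for i q
    unfolding A_def using that by (intro ideal_part_mult) (auto simp: l_def)
  have "ideal_part n m k {..n} (g s) \<subseteq> mpolv.span (A \<union> T)"
  proof (rule ideal_part_minimal[OF mpolv.subspace_span])
    fix i q assume i: "i \<in> {..n}" and q: "q \<in> forms n (k - m)"
    show "g s i * q \<in> mpolv.span (A \<union> T)"
    proof (cases "i = 0")
      case False
      then show ?thesis using i q by (intro A_span A_mult) (auto simp: l_def)
    next
      case True
      have "g s 0 * q \<in> mpolv.span (A \<union> T)"
      proof (rule mult_span_in[of q "H s ` I"])
        show "q \<in> mpolv.span (H s ` I)" using q sp by (simp add: l_def)
        fix b assume "b \<in> H s ` I"
        then consider \<nu> where "\<nu> \<in> monoms n (l - 1)" "b = z 0 * single \<nu> 1"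
          | j \<nu> where "j \<in> {1..n}" "\<nu> \<in> monoms n (l - m)" "b = g s j * single \<nu> 1"
          | \<nu> where "\<nu> \<in> special_monoms m n l" "b = mono_eval z \<nu>"
          by (auto simp: I_def H_def g_def)
        then show "g s 0 * b \<in> mpolv.span (A \<union> T)"
        proof cases
          case 1
          \<comment> \<open>This is the place where the syzygy acts: it expresses
            \<open>z 0 * g s 0\<close> by the members \<open>g s 1, ..., g s r\<close>.\<close>
          have "(\<Sum>i\<le>r. z i * g s i) = z 0 * g s 0 + (\<Sum>i\<in>{1..r}. z i * g s i)"
            by (simp add: atMost_insert_1)
          then have "g s 0 * z 0 = - (\<Sum>i\<in>{1..r}. z i * g s i)"
            using g_syz by (simp add: mult.commute eq_neg_iff_add_eq_0)
          then have "g s 0 * b = - (\<Sum>i\<in>{1..r}. g s i * (z i * single \<nu> 1))"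
            by (simp add: 1 mult.assoc[symmetric] sum_distrib_right) (simp add: mult.commute)
          moreover have "g s i * (z i * single \<nu> 1) \<in> A" if "i \<in> {1..r}" for i
            using that r l forms_mult[OF z(1) forms_single[OF 1(1)], of i 1] by (intro A_mult) auto
          ultimately show ?thesis
            by (metis (no_types, lifting) A_span mpolv.span_neg mpolv.span_sum)
        next
          case 2
          have "g s j * (g s 0 * single \<nu> 1) \<in> A"
            using forms_mult[OF g_forms forms_single[OF 2(2)], of 0 1] l 2 by (intro A_mult) auto
          then show ?thesis using A_span by (simp add: 2 mult.left_commute)
        next
          case 3
          then show ?thesis by (intro mpolv.span_base) (auto simp: T_def)
        qed
      qed simp
      then show ?thesis using True by simp
    qed
  qed
  then have "mpolv.dim (ideal_part n m k {..n} (g s)) \<le> mpolv.dim (mpolv.span (A \<union> T))"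
  proof (rule dim_forms_mono)
    have "T \<subseteq> forms n k"
      using forms_mult[OF g_forms zmon, of 0 _ l] k by (auto simp: T_def special_monoms_def l_def)
    then show "mpolv.span (A \<union> T) \<subseteq> forms n k"
      using A_forms by (intro mpolv.span_minimal forms_subspace) auto
  qed
  also have "\<dots> \<le> mpolv.dim A + card T"
    unfolding mpolv.dim_span using A_forms forms_span_finite[of n k]
    by (intro mpolv.dim_Un_le) (auto simp: T_def finite_special_monoms)
  also have "card T \<le> m ^ (n - 1)"
    unfolding T_def
    by (rule order.trans[OF card_image_le[OF finite_special_monoms] card_special_monoms[OF n]])
  finally have "mpolv.dim (ideal_part n m k {..n} (g s)) \<le> mpolv.dim A + m ^ (n - 1)" by simp
  moreover have "mpolv.dim A + m ^ n \<le> card (monoms n k)"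
    unfolding A_def using m g_forms k by (intro dim_ideal_part_n_forms) auto
  moreover have "g s = (\<lambda>i. h i + Const s * f i)" by (simp add: g_def fun_eq_iff)
  ultimately show ?thesis using s(2) by simp
qed

text \<open>The linear forms \<open>l i\<close> may be dependent. A maximal independent subfamily,
  indexed by \<open>J\<close>, is completed to a basis, and every \<open>l j\<close> with
  \<open>j \<notin> J\<close> is expanded in it; regrouping the syzygy by basis elements changes the
  generators by a triangular substitution, under which the ideal does not shrink.\<close>

lemma dim_ideal_part_syzygy:
  assumes n: "n \<ge> 1" and m: "m \<ge> 1"
    and l: "\<And>i. i \<le> n \<Longrightarrow> l i \<in> forms n 1" and l0: "\<exists>i\<le>n. l i \<noteq> 0"
    and f: "\<And>i. i \<le> n \<Longrightarrow> f i \<in> forms n m" and syz: "(\<Sum>i\<le>n. l i * f i) = 0"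
    and k: "n * m + 2 * m \<le> k"
  shows "mpolv.dim (ideal_part n m k {..n} f) + m ^ n \<le> card (monoms n k) + m ^ (n - 1)"
proof -
  obtain B where B: "B \<subseteq> l ` {..n}" "mpolv.independent B" "l ` {..n} \<subseteq> mpolv.span B"
    by (rule mpolv.maximal_independent_subset)
  have "B \<noteq> {}"
  proof
    assume "B = {}"
    then show False using B(3) l0 by auto
  qed
  have finB: "finite B" using B(1) finite_subset by blast
  obtain J where J: "J \<subseteq> {..n}" "inj_on l J" "B = l ` J" using B(1) by (auto simp: subset_image_inj)
  have B_forms: "B \<subseteq> forms n 1" using B(1) l by auto
  obtain C where C: "B \<subseteq> C" "C \<subseteq> forms n 1" "mpolv.independent C" "forms n 1 \<subseteq> mpolv.span C"
    by (rule mpolv.maximal_independent_subset_extend[OF B_forms B(2)])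
  have cardC: "card C = n + 1"
    using mpolv.basis_card_eq_dim[OF C(2,4,3)] dim_forms[of n 1] card_monoms_1 by simp
  then have finC: "finite C" by (metis add_is_0 card.infinite one_neq_zero)
  \<comment> \<open>The regrouped syzygy runs over the indices \<open>0..r\<close>, so
    \<open>r\<close> is one less than the rank; the rank is positive since some \<open>l i\<close>
    is nonzero.\<close>
  define r where "r = card B - 1"
  have rB: "card B = Suc r" using finB \<open>B \<noteq> {}\<close> by (simp add: r_def card_gt_0_iff)
  have "card B \<le> card C" using C(1) finC by (rule card_mono[rotated])
  then have rn: "r \<le> n" using rB cardC by simp
  have cardJ: "card J = Suc r" using J rB by (simp add: card_image)
  have finJ: "finite J" using J(1) finite_subset by blast
  obtain e1 where e1: "bij_betw e1 {..r} J"
    using cardJ finJ by (metis card_atMost finite_atMost finite_same_card_bij)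
  have "card ({..n} - J) = card {r<..n}" using cardJ J(1) finJ by (simp add: card_Diff_subset)
  then obtain e2 where e2: "bij_betw e2 {r<..n} ({..n} - J)"
    by (metis finite_Diff finite_atMost finite_greaterThanAtMost finite_same_card_bij)
  have "card (C - B) = card {r<..n}" using rB cardC C(1) finB by (simp add: card_Diff_subset)
  then obtain e3 where e3: "bij_betw e3 {r<..n} (C - B)"
    using finC by (metis finite_Diff finite_greaterThanAtMost finite_same_card_bij)
  define z where "z i = (if i \<le> r then l (e1 i) else e3 i)" for i
  have bij_z1: "bij_betw (\<lambda>i. l (e1 i)) {..r} B"
    using bij_betw_trans[OF e1, of l B] J by (simp add: bij_betw_def comp_def)
  have split: "{..n} = {..r} \<union> {r<..n}" using rn by auto
  have "z ` {..n} = C"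
  proof -
    have "z ` {..r} = B" using bij_z1 by (auto simp: z_def bij_betw_def)
    moreover have "z ` {r<..n} = C - B" using e3 by (auto simp: z_def bij_betw_def)
    ultimately show ?thesis using C(1) by (auto simp: split image_Un)
  qed
  then have zC: "\<And>i. i \<le> n \<Longrightarrow> z i \<in> forms n 1" "Var ` {..n} \<subseteq> mpolv.span (z ` {..n})"
    using C forms_Var by auto
  have "\<exists>c. l i = (\<Sum>b\<in>B. Const (c b) * b)" if i: "i \<le> n" for i
  proof -
    have "l i \<in> mpolv.span B" using B(3) i by auto
    then obtain c where "l i = (\<Sum>b\<in>B. cscale (c b) b)"
      unfolding mpolv.span_finite[OF finB] by auto
    then show ?thesis by (auto simp: cscale_eq)
  qed
  then have "\<forall>i\<in>{..n}. \<exists>c. l i = (\<Sum>b\<in>B. Const (c b) * b)" by blast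
  from bchoice[OF this] obtain c where c: "\<forall>i\<in>{..n}. l i = (\<Sum>b\<in>B. Const (c i b) * b)"
    by (rule exE)
  \<comment> \<open>For \<open>i \<le> r\<close> this is the total coefficient of the basis element
    \<open>z i\<close> in the syzygy, once each dependent \<open>l j\<close> has been
    expanded.\<close>
  define g where "g i = (if i \<le> r then f (e1 i) + (\<Sum>j\<in>{..n} - J. Const (c j (z i)) * f j) else f (e2 i))" for i
  have e1J: "e1 i \<in> J" "e1 i \<le> n" if "i \<le> r" for i using e1 J(1) that by (auto simp: bij_betw_def)
  have e2J: "e2 i \<in> {..n} - J" if "i \<in> {r<..n}" for i using e2 that by (auto simp: bij_betw_def)
  have g: "g i \<in> forms n m" if "i \<le> n" for i
    using that e1J e2J unfolding g_def by (auto intro!: forms_add forms_sum forms_Const_mult f)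
  have "(\<Sum>i\<le>r. z i * g i) = (\<Sum>i\<le>r. l (e1 i) * f (e1 i)) + (\<Sum>i\<le>r. z i * (\<Sum>j\<in>{..n} - J. Const (c j (z i)) * f j))"
    by (simp add: z_def g_def algebra_simps sum.distrib)
  also have "(\<Sum>i\<le>r. l (e1 i) * f (e1 i)) = (\<Sum>j\<in>J. l j * f j)"
    by (rule sum.reindex_bij_betw[OF e1])
  also have "(\<Sum>i\<le>r. z i * (\<Sum>j\<in>{..n} - J. Const (c j (z i)) * f j)) =
      (\<Sum>j\<in>{..n} - J. (\<Sum>i\<le>r. Const (c j (z i)) * z i) * f j)"
    unfolding sum_distrib_left sum_distrib_right by (subst sum.swap) (simp add: algebra_simps)
  also have "\<dots> = (\<Sum>j\<in>{..n} - J. l j * f j)"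
  proof (intro sum.cong refl arg_cong2[of _ _ _ _ "(*)"])
    fix j assume j: "j \<in> {..n} - J"
    have "(\<Sum>i\<le>r. Const (c j (z i)) * z i) = (\<Sum>i\<le>r. Const (c j (l (e1 i))) * l (e1 i))"
      by (simp add: z_def)
    also have "\<dots> = (\<Sum>b\<in>B. Const (c j b) * b)"
      by (rule sum.reindex_bij_betw[OF bij_z1])
    finally show "(\<Sum>i\<le>r. Const (c j (z i)) * z i) = l j" using c j by simp
  qed
  also have "(\<Sum>j\<in>J. l j * f j) + (\<Sum>j\<in>{..n} - J. l j * f j) = (\<Sum>j\<le>n. l j * f j)"
    using sum.subset_diff[OF J(1), of "\<lambda>j. l j * f j"] by (simp add: add.commute)
  finally have "(\<Sum>i\<le>r. z i * g i) = 0" using syz by simp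
  note bound = dim_ideal_part_syzygy_basis[OF n m rn zC g this k]
  have g_mem: "g i * q \<in> ideal_part n m k {..n} g" if "i \<le> n" "q \<in> forms n (k - m)" for i q
    using that by (intro ideal_part_mult) auto
  have fJ: "f j * q \<in> ideal_part n m k {..n} g" if "j \<in> {..n} - J" "q \<in> forms n (k - m)" for j q
  proof -
    have "j \<in> e2 ` {r<..n}" using e2 that(1) by (simp add: bij_betw_def)
    then obtain i where "i \<in> {r<..n}" "e2 i = j" by blast
    then show ?thesis using g_mem[of i q] that by (simp add: g_def)
  qed
  have "ideal_part n m k {..n} f \<subseteq> ideal_part n m k {..n} g"
  proof (rule ideal_part_minimal)
    fix j q assume j: "j \<in> {..n}" and q: "q \<in> forms n (k - m)"
    show "f j * q \<in> ideal_part n m k {..n} g"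
    proof (cases "j \<in> J")
      case True
      then have "j \<in> e1 ` {..r}" using e1 by (simp add: bij_betw_def)
      then obtain i where i: "i \<le> r" "e1 i = j" by blast
      have "f j * q = g i * q - (\<Sum>j\<in>{..n} - J. Const (c j (z i)) * (f j * q))"
        using i by (simp add: g_def algebra_simps sum_distrib_left)
      moreover have "(\<Sum>j\<in>{..n} - J. Const (c j (z i)) * (f j * q)) \<in> ideal_part n m k {..n} g"
        using fJ q by (intro mpolv.subspace_sum mpolv_subspace_scale) auto
      ultimately show ?thesis using g_mem[of i q] i rn q by (simp add: mpolv.subspace_diff)
    qed (use fJ j q in auto)
  qed simp
  then have "mpolv.dim (ideal_part n m k {..n} f) \<le> mpolv.dim (ideal_part n m k {..n} g)"
  proof (rule dim_forms_mono)
    show "ideal_part n m k {..n} g \<subseteq> forms n k" using g k by (intro ideal_part_forms) auto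
  qed
  then show ?thesis using bound by linarith
qed

subsection \<open>The Nullstellensatz over the complex numbers\<close>

definition is_ideal :: "'a::comm_ring_1 set \<Rightarrow> bool" where
  "is_ideal I \<longleftrightarrow> 0 \<in> I \<and> (\<forall>a\<in>I. \<forall>b\<in>I. a + b \<in> I) \<and> (\<forall>a\<in>I. \<forall>q. q * a \<in> I)"

lemma is_idealI:
  "0 \<in> I \<Longrightarrow> (\<And>a b. a \<in> I \<Longrightarrow> b \<in> I \<Longrightarrow> a + b \<in> I) \<Longrightarrow> (\<And>a q. a \<in> I \<Longrightarrow> q * a \<in> I) \<Longrightarrow> is_ideal I"
  by (simp add: is_ideal_def)

lemma is_ideal_0: "is_ideal I \<Longrightarrow> 0 \<in> I"
  and is_ideal_add: "is_ideal I \<Longrightarrow> a \<in> I \<Longrightarrow> b \<in> I \<Longrightarrow> a + b \<in> I"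
  and is_ideal_mult: "is_ideal I \<Longrightarrow> a \<in> I \<Longrightarrow> q * a \<in> I"
  by (auto simp: is_ideal_def)

lemma is_ideal_mult2: "is_ideal I \<Longrightarrow> a \<in> I \<Longrightarrow> a * q \<in> I"
  using is_ideal_mult[of I a q] by (simp add: mult.commute)

lemma is_ideal_diff: "is_ideal I \<Longrightarrow> a \<in> I \<Longrightarrow> b \<in> I \<Longrightarrow> a - b \<in> I"
  using is_ideal_add[of I a "- b"] is_ideal_mult[of I b "-1"] by simp

lemma is_ideal_sum: "is_ideal I \<Longrightarrow> (\<And>x. x \<in> A \<Longrightarrow> g x \<in> I) \<Longrightarrow> sum g A \<in> I"
  by (induction A rule: infinite_finite_induct) (auto intro: is_ideal_0 is_ideal_add)

text \<open>\<open>P\<close> is maximal among the ideals above \<open>I\<close> that contain no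
  power of \<open>w\<close>. If \<open>g\<close> is outside \<open>P\<close>, the larger ideal
  generated by \<open>P\<close> and \<open>g\<close> must contain a power of \<open>w\<close>: thus
  \<open>g\<close> becomes invertible modulo \<open>P\<close> once \<open>w\<close> is inverted.
  This takes the place of the additional variable in Rabinowitsch's trick.\<close>

lemma prime_avoiding_powers:
  fixes w :: "'a::comm_ring_1"
  assumes I: "is_ideal I" and w: "\<And>N. w ^ N \<notin> I"
  shows "\<exists>P. is_ideal P \<and> I \<subseteq> P \<and> (\<forall>N. w ^ N \<notin> P) \<and>
    (\<forall>g. g \<notin> P \<longrightarrow> (\<exists>N q. w ^ N - q * g \<in> P)) \<and>
    (\<forall>g h. g * h \<in> P \<longrightarrow> g \<in> P \<or> h \<in> P)"
proof -
  define \<A> where "\<A> = {P. is_ideal P \<and> I \<subseteq> P \<and> (\<forall>N. w ^ N \<notin> P)}"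
  have "\<exists>M\<in>\<A>. \<forall>X\<in>\<A>. M \<subseteq> X \<longrightarrow> X = M"
  proof (rule subset_Zorn_nonempty)
    show "\<A> \<noteq> {}" using I w by (auto simp: \<A>_def)
    fix C assume C: "C \<noteq> {}" "subset.chain \<A> C"
    have mem: "P \<in> C \<Longrightarrow> P \<in> \<A>" for P using C(2) by (auto simp: subset.chain_def)
    have "is_ideal (\<Union>C)"
    proof (rule is_idealI)
      show "0 \<in> \<Union>C" using C(1) mem by (auto simp: \<A>_def is_ideal_0)
      show "a + b \<in> \<Union>C" if ab: "a \<in> \<Union>C" "b \<in> \<Union>C" for a b
      proof -
        obtain P Q where "P \<in> C" "a \<in> P" "Q \<in> C" "b \<in> Q" using ab by auto
        moreover then have "P \<subseteq> Q \<or> Q \<subseteq> P" using C(2) by (auto simp: subset.chain_def)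
        ultimately obtain R where "R \<in> C" "a \<in> R" "b \<in> R" by blast
        then show ?thesis using mem by (auto simp: \<A>_def intro: is_ideal_add)
      qed
      show "q * a \<in> \<Union>C" if "a \<in> \<Union>C" for a q
        using that mem by (auto simp: \<A>_def intro: is_ideal_mult)
    qed
    then show "\<Union>C \<in> \<A>" using C(1) mem by (auto simp: \<A>_def)
  qed
  then obtain P where P: "P \<in> \<A>" "\<And>X. X \<in> \<A> \<Longrightarrow> P \<subseteq> X \<Longrightarrow> X = P" by blast
  have idP: "is_ideal P" and IP: "I \<subseteq> P" and wP: "\<And>N. w ^ N \<notin> P" using P(1) by (auto simp: \<A>_def)
  have inv: "\<exists>N q. w ^ N - q * g \<in> P" if g: "g \<notin> P" for g
  proof (rule ccontr)
    assume no: "\<nexists>N q. w ^ N - q * g \<in> P"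
    define X where "X = {p + q * g | p q. p \<in> P}"
    have PX: "P \<subseteq> X" unfolding X_def by (rule subsetI) (metis (mono_tags, lifting) add.right_neutral mem_Collect_eq mult_zero_left)
    have "is_ideal X"
    proof (rule is_idealI)
      show "0 \<in> X" using PX is_ideal_0[OF idP] by blast
      show "a + b \<in> X" if ab: "a \<in> X" "b \<in> X" for a b
      proof -
        obtain p q p' q' where "a = p + q * g" "b = p' + q' * g" "p \<in> P" "p' \<in> P"
          using ab by (auto simp: X_def)
        then have "a + b = (p + p') + (q + q') * g" "p + p' \<in> P"
          using idP by (auto simp: algebra_simps is_ideal_add)
        then show ?thesis by (auto simp: X_def)
      qed
      show "r * a \<in> X" if a: "a \<in> X" for a r
      proof -
        obtain p q where "a = p + q * g" "p \<in> P" using a by (auto simp: X_def)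
        then have "r * a = r * p + (r * q) * g" "r * p \<in> P"
          using is_ideal_mult[OF idP, of p r] by (auto simp: algebra_simps)
        then show ?thesis by (auto simp: X_def)
      qed
    qed
    moreover have "w ^ N \<notin> X" for N
    proof
      assume "w ^ N \<in> X"
      then obtain p q where "w ^ N = p + q * g" "p \<in> P" by (auto simp: X_def)
      then have "w ^ N - q * g \<in> P" by simp
      with no show False by blast
    qed
    ultimately have "X \<in> \<A>" using PX IP by (auto simp: \<A>_def)
    then have "X = P" using P(2) PX by blast
    moreover have "0 + 1 * g \<in> X" using is_ideal_0[OF idP] unfolding X_def by blast
    ultimately show False using g by simp
  qed
  have prime: "g \<in> P \<or> h \<in> P" if gh: "g * h \<in> P" for g h
  proof (rule ccontr)
    assume "\<not> (g \<in> P \<or> h \<in> P)"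
    then obtain N q M r where N: "w ^ N - q * g \<in> P" and M: "w ^ M - r * h \<in> P" using inv by meson
    have "w ^ (N + M) = (w ^ N - q * g) * w ^ M + (q * g) * (w ^ M - r * h) + (q * r) * (g * h)"
      by (simp add: algebra_simps power_add)
    also have "\<dots> \<in> P"
      by (intro is_ideal_add[OF idP] is_ideal_mult2[OF idP N] is_ideal_mult[OF idP M] is_ideal_mult[OF idP gh])
    finally show False using wP by blast
  qed
  show ?thesis using idP IP wP inv prime by (intro exI[of _ P] conjI) auto
qed

lemma uncountable_fibre:
  fixes F :: "complex \<Rightarrow> 'b::countable"
  obtains b where "infinite {c. F c = b}"
proof -
  have "\<exists>b. infinite {c. F c = b}"
  proof (rule ccontr)
    assume "\<not> ?thesis"
    then have "countable (\<Union>b. {c. F c = b})"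
      by (intro countable_UN) (auto intro: countable_finite)
    moreover have "(\<Union>b. {c. F c = b}) = UNIV" by auto
    ultimately show False using uncountable_UNIV_complex by simp
  qed
  then show ?thesis using that by blast
qed

text \<open>Although there are infinitely many variables, bounding both the variables and the degree
  by \<open>D\<close> exhausts the polynomial ring by countably many finite-dimensional
  spaces.\<close>

lemma mpol_filtration: "\<exists>D. f \<in> mpolv.span ((\<lambda>m. single m 1) ` {m. keys m \<subseteq> {..D} \<and> mdeg m \<le> D})"
  for f :: "nat mpol"
proof -
  have "finite (\<Union>m\<in>keys f. insert (mdeg m) (keys m))" by auto
  then obtain D where D: "\<And>x. x \<in> (\<Union>m\<in>keys f. insert (mdeg m) (keys m)) \<Longrightarrow> x \<le> D"
    by (meson Max_ge)
  have "(\<Sum>m\<in>keys f. Const (lookup f m) * single m 1) \<in>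
      mpolv.span ((\<lambda>m. single m 1) ` {m. keys m \<subseteq> {..D} \<and> mdeg m \<le> D})"
    using D by (intro mpolv.span_sum mpolv_span_scale[OF mpolv.span_base]) auto
  then show ?thesis by (auto simp flip: single_Const poly_mapping_sum_single)
qed

lemma finite_monoms_le: "finite {m. keys m \<subseteq> {..D::nat} \<and> mdeg m \<le> E}"
proof -
  have "{m. keys m \<subseteq> {..D} \<and> mdeg m \<le> E} = (\<Union>k\<le>E. monoms D k)" by (auto simp: monoms_def)
  then show ?thesis by (simp add: finite_monoms)
qed

text \<open>For an uncountable field of coefficients, countably many variables do not matter: modulo a prime \<open>P\<close>,
  infinitely many inverses of the \<open>x\<^sub>j - c\<close> lie in one finite-dimensional space, and a linear
  relation between them is a polynomial equation for \<open>x\<^sub>j\<close>.\<close>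

lemma prime_has_point:
  fixes P :: "nat mpol set"
  assumes id: "is_ideal P" and w: "\<And>N. w ^ N \<notin> P"
    and inv: "\<And>g. g \<notin> P \<Longrightarrow> \<exists>N q. w ^ N - q * g \<in> P"
    and prime: "\<And>g h. g * h \<in> P \<Longrightarrow> g \<in> P \<or> h \<in> P"
  shows "\<exists>c. Var j - Const c \<in> P"
proof (rule ccontr)
  assume no: "\<nexists>c. Var j - Const c \<in> P"
  interpret C: comm_ring_hom "Const :: complex \<Rightarrow> nat mpol"
    by unfold_locales (auto simp: Const_add Const_mult)
  interpret M: map_poly_comm_ring_hom "Const :: complex \<Rightarrow> nat mpol" ..
  \<comment> \<open>Substitution of \<open>Var j\<close> into a univariate polynomial with complex
    coefficients.\<close>
  define ev where "ev H = poly (map_poly Const H) (Var j)" for H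
  have ev: "ev (H * K) = ev H * ev K" "ev (sum G A) = (\<Sum>a\<in>A. ev (G a))"
      "ev (prod G A) = (\<Prod>a\<in>A. ev (G a))" "ev [:a, b:] = Const a + Var j * Const b" "ev [:a:] = Const a"
    for H K a b and G :: "complex \<Rightarrow> complex poly" and A
    by (simp_all add: ev_def M.hom_mult M.hom_sum M.hom_prod poly_sum poly_prod C.map_poly_pCons_hom)
  \<comment> \<open>\<open>Var j\<close> is transcendental modulo \<open>P\<close>: a polynomial
    equation would split into linear factors over the complex numbers, and primality would put one
    of them into \<open>P\<close>.\<close>
  have not_P: "ev H \<notin> P" if "H \<noteq> 0" for H
    using that
  proof (induction "degree H" arbitrary: H)
    case 0
    then obtain a where a: "H = [:a:]" "a \<noteq> 0" by (metis degree_eq_zeroE pCons_0_0)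
    show ?case
    proof
      assume "ev H \<in> P"
      then have "Const (inverse a) * Const a \<in> P" using a id by (simp add: ev is_ideal_mult)
      moreover have "Const (inverse a) * Const a = (1 :: nat mpol)" using a by (simp flip: Const_mult)
      ultimately have "1 \<in> P" by simp
      then show False using w[of 0] by simp
    qed
  next
    case (Suc k)
    then obtain a where "poly H a = 0"
      by (metis constant_degree fundamental_theorem_of_algebra nat.distinct(1))
    then obtain K where K: "H = [:- a, 1:] * K" using poly_eq_0_iff_dvd by (metis dvdE)
    then have "K \<noteq> 0" using Suc.prems by auto
    have "degree H = Suc (degree K)" unfolding K using \<open>K \<noteq> 0\<close> by (subst degree_mult_eq) auto
    then have "ev K \<notin> P" using Suc.hyps \<open>K \<noteq> 0\<close> by simp
    moreover have "ev [:- a, 1:] = Var j - Const a" by (simp add: ev Const_uminus)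
    ultimately show ?case unfolding K ev using no prime by metis
  qed
  have "\<forall>c. \<exists>Nq. w ^ fst Nq - snd Nq * (Var j - Const c) \<in> P"
    using inv no by force
  from choice[OF this] obtain Nq where Nq: "\<forall>c. w ^ fst (Nq c) - snd (Nq c) * (Var j - Const c) \<in> P"
    by (rule exE)
  define q where "q c = snd (Nq c)" for c
  let ?B = "\<lambda>D. (\<lambda>m. single m (1::complex)) ` {m. keys m \<subseteq> {..D} \<and> mdeg m \<le> D}"
  \<comment> \<open>Modulo \<open>P\<close>, \<open>q c\<close> is an inverse of
    \<open>Var j - Const c\<close> up to a power of \<open>w\<close>. The pair of that exponent and
    the level \<open>D c\<close> ranges over a countable set, so it is constant on infinitely many
    \<open>c\<close>.\<close>
  define D where "D c = (SOME D. q c \<in> mpolv.span (?B D))" for c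
  have D: "q c \<in> mpolv.span (?B (D c))" for c
    unfolding D_def by (rule someI_ex[OF mpol_filtration])
  obtain b where b: "infinite {c. (fst (Nq c), D c) = b}" by (rule uncountable_fibre)
  obtain N d where Nd: "b = (N, d)" by (cases b)
  define C where "C = {c. fst (Nq c) = N \<and> D c = d}"
  have "infinite C" using b by (simp add: Nd C_def)
  define K where "K = Suc (card (?B d))"
  obtain F where F: "F \<subseteq> C" "card F = K" "finite F" using infinite_arbitrarily_large[OF \<open>infinite C\<close>] by blast
  obtain e where e: "bij_betw e {..<K} F"
    using ex_bij_betw_nat_finite[OF F(3)] F(2) by (auto simp: lessThan_atLeast0)
  have eF: "e i \<in> F" if "i < K" for i using e that by (auto simp: bij_betw_def)
  have "\<not> (inj_on (\<lambda>i. q (e i)) {..<K} \<and> mpolv.independent ((\<lambda>i. q (e i)) ` {..<K}))"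
  proof
    assume *: "inj_on (\<lambda>i. q (e i)) {..<K} \<and> mpolv.independent ((\<lambda>i. q (e i)) ` {..<K})"
    have "(\<lambda>i. q (e i)) ` {..<K} \<subseteq> mpolv.span (?B d)" using D eF F(1) by (auto simp: C_def)
    then have "card ((\<lambda>i. q (e i)) ` {..<K}) \<le> card (?B d)"
      using mpolv.independent_span_bound[of "?B d"] * finite_monoms_le by blast
    then show False using * by (simp add: card_image K_def)
  qed
  then obtain c i where ci: "(\<Sum>i<K. cscale (c i) (q (e i))) = 0" "i < K" "c i \<noteq> 0"
    using mpolv.family_independent[where N = K and v = "\<lambda>i. q (e i)"] by blast
  \<comment> \<open>The common denominator of the fractions \<open>1 / (x - e i)\<close>;
    \<open>L' i\<close> is \<open>L\<close> without its factor at \<open>e i\<close>.\<close>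
  define L where "L = (\<Prod>j\<in>{..<K}. [:- e j, 1:])"
  define L' where "L' i = (\<Prod>j\<in>{..<K} - {i}. [:- e j, 1:])" for i
  have LL': "ev L = (Var j - Const (e i)) * ev (L' i)" if "i < K" for i
  proof -
    have "L = [:- e i, 1:] * L' i" unfolding L_def L'_def using that by (intro prod.remove) auto
    then have "ev L = ev [:- e i, 1:] * ev (L' i)" by (simp only: ev)
    then show ?thesis by (simp add: ev Const_uminus)
  qed
  \<comment> \<open>The numerator of the sum of the \<open>c i / (x - e i)\<close>. At
    \<open>e i\<close> only its summand with index \<open>i\<close> survives, so
    \<open>c i \<noteq> 0\<close> makes it nonzero.\<close>
  define H where "H = (\<Sum>i<K. [:c i:] * L' i)"
  have "poly H (e i) = (\<Sum>k<K. if k = i then c i * poly (L' i) (e i) else 0)"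
    unfolding H_def poly_sum
  proof (intro sum.cong refl)
    fix k assume "k \<in> {..<K}"
    have "poly (L' k) (e i) = 0" if "k \<noteq> i"
      unfolding L'_def poly_prod using that ci(2) by (intro prod_zero) auto
    then show "poly ([:c k:] * L' k) (e i) = (if k = i then c i * poly (L' i) (e i) else 0)" by auto
  qed
  also have "\<dots> = c i * poly (L' i) (e i)" using ci(2) by simp
  also have "\<dots> \<noteq> 0"
  proof -
    have "e i \<noteq> e j" if "j \<in> {..<K} - {i}" for j
      using e that ci(2) by (auto simp: bij_betw_def dest: inj_onD)
    then show ?thesis using ci(3) by (auto simp: L'_def poly_prod)
  qed
  finally have "H \<noteq> 0" by auto
  have evsum: "ev (\<Sum>i<K. G i) = (\<Sum>i<K. ev (G i))" for G
    by (simp add: ev_def M.hom_sum poly_sum)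
  have evc: "ev ([:c i:] * L' i) = Const (c i) * ev (L' i)" for i by (simp only: ev)
  \<comment> \<open>Modulo \<open>P\<close> each \<open>w ^ N\<close> may be replaced by
    \<open>q (e i) * (Var j - Const (e i))\<close>; what remains is \<open>ev L\<close> times the
    linear relation, hence 0.\<close>
  have "w ^ N * ev H = (\<Sum>i<K. (w ^ N - q (e i) * (Var j - Const (e i))) * (Const (c i) * ev (L' i))) +
      (\<Sum>i<K. cscale (c i) (q (e i))) * ev L"
    unfolding H_def evsum evc sum_distrib_left sum_distrib_right sum.distrib[symmetric]
    by (intro sum.cong refl) (simp add: LL' cscale_eq algebra_simps)
  also have "\<dots> \<in> P"
  proof (rule is_ideal_add[OF id])
    show "(\<Sum>i<K. (w ^ N - q (e i) * (Var j - Const (e i))) * (Const (c i) * ev (L' i))) \<in> P"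
    proof (intro is_ideal_sum is_ideal_mult2 id)
      fix i assume "i \<in> {..<K}"
      then have "fst (Nq (e i)) = N" using eF[of i] F(1) by (auto simp: C_def)
      then show "w ^ N - q (e i) * (Var j - Const (e i)) \<in> P" using Nq[rule_format, of "e i"] by (simp add: q_def)
    qed
  qed (use ci(1) is_ideal_0[OF id] in simp)
  finally show False using prime w not_P[OF \<open>H \<noteq> 0\<close>] by blast
qed

lemma mpol_induct [case_names Const Var add mult]:
  assumes "\<And>c. Q (Const c)" "\<And>v. Q (Var v)" "\<And>f g. Q f \<Longrightarrow> Q g \<Longrightarrow> Q (f + g)" "\<And>f g. Q f \<Longrightarrow> Q g \<Longrightarrow> Q (f * g)"
  shows "Q f"
proof (induction f rule: sum_single_induct)
  case (single m c)
  have pow: "Q (Var v ^ k)" for v k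
    by (induction k) (use assms(1)[of 1] assms(2,4) in auto)
  have "Q (\<Prod>v\<in>A. Var v ^ lookup m v)" if "finite A" for A
    using that by induction (use assms(1)[of 1] assms(4) pow in auto)
  then have "Q (mono_eval Var m)" by (simp add: mono_eval_def)
  then show ?case unfolding single_Const[of m c] mono_eval_Var[symmetric] by (intro assms)
next
  case zero
  show ?case using assms(1)[of 0] by simp
qed (use assms in auto)

text \<open>If no power of \<open>w\<close> were in \<open>I\<close>, every variable would be
  congruent to a constant modulo the prime \<open>P\<close> above. Reduction modulo \<open>P\<close>
  is then evaluation at the point \<open>v\<close> of these constants, a zero of \<open>I\<close> at
  which \<open>w\<close> does not vanish.\<close>

theorem Nullstellensatz:
  fixes w :: "nat mpol"
  assumes I: "is_ideal I" and w: "\<And>v. (\<And>f. f \<in> I \<Longrightarrow> peval v f = 0) \<Longrightarrow> peval v w = 0"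
  shows "\<exists>N. w ^ N \<in> I"
proof (rule ccontr)
  assume "\<nexists>N. w ^ N \<in> I"
  then have nw: "w ^ N \<notin> I" for N by blast
  from prime_avoiding_powers[OF I nw] obtain P where P: "is_ideal P" "I \<subseteq> P" "\<forall>N. w ^ N \<notin> P"
    "\<forall>g. g \<notin> P \<longrightarrow> (\<exists>N q. w ^ N - q * g \<in> P)"
    "\<forall>g h. g * h \<in> P \<longrightarrow> g \<in> P \<or> h \<in> P"
    by (elim exE conjE) blast
  have "\<forall>j. \<exists>c. Var j - Const c \<in> P"
    using prime_has_point[of P w] P by blast
  from choice[OF this] obtain v where v: "\<forall>j. Var j - Const (v j) \<in> P" by (rule exE)
  have cong: "f - Const (peval v f) \<in> P" for f
  proof (induction f rule: mpol_induct)
    case (add f g)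
    have "f + g - Const (peval v (f + g)) = (f - Const (peval v f)) + (g - Const (peval v g))"
      by (simp add: Const_add algebra_simps)
    also have "\<dots> \<in> P" using add P(1) by (intro is_ideal_add)
    finally show ?case .
  next
    case (mult f g)
    have "f * g - Const (peval v (f * g)) =
        (f - Const (peval v f)) * g + Const (peval v f) * (g - Const (peval v g))"
      by (simp add: Const_mult algebra_simps)
    also have "\<dots> \<in> P"
      by (intro is_ideal_add[OF P(1)] is_ideal_mult2[OF P(1) mult(1)] is_ideal_mult[OF P(1) mult(2)])
    finally show ?case .
  qed (use v is_ideal_0[OF P(1)] in auto)
  have "peval v f = 0" if "f \<in> I" for f
  proof (rule ccontr)
    assume nz: "peval v f \<noteq> 0"
    have "f - (f - Const (peval v f)) \<in> P" using that P(1,2) cong by (blast intro: is_ideal_diff)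
    then have "Const (inverse (peval v f)) * Const (peval v f) \<in> P" using P(1) by (simp add: is_ideal_mult)
    moreover have "Const (inverse (peval v f)) * Const (peval v f) = (1 :: nat mpol)"
      using nz by (simp flip: Const_mult)
    ultimately show False using P(3)[rule_format, of 0] by simp
  qed
  then have "peval v w = 0" by (rule w)
  then show False using cong[of w] P(3)[rule_format, of 1] by simp
qed

subsection \<open>Points of projective space and the singular locus\<close>

lemma mono_eval_scale: "mono_eval (\<lambda>i. c * a i) m = c ^ mdeg m * mono_eval a m"
  by (simp add: mono_eval_def mdeg_def power_mult_distrib prod.distrib power_sum)

lemma peval_scale_forms:
  assumes "q \<in> forms n k"
  shows "peval (\<lambda>i. c * a i) q = c ^ k * peval a q"
proof -
  have "mdeg m = k" if "m \<in> keys q" for m using assms that by (auto simp: forms_keys monoms_def)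
  then show ?thesis
    by (simp add: peval_gen_eval gen_eval_def mono_eval_scale sum_distrib_left algebra_simps)
qed

lemma peval_smult_vec:
  assumes "q \<in> forms n k" "v \<in> carrier_vec (n + 1)"
  shows "peval (\<lambda>i. (c \<cdot>\<^sub>v v) $ i) q = c ^ k * peval (\<lambda>i. v $ i) q"
proof -
  have "peval (\<lambda>i. (c \<cdot>\<^sub>v v) $ i) q = peval (\<lambda>i. c * v $ i) q"
    using assms by (intro peval_cong_mpols[of q "{..n}"]) (auto simp: forms_def)
  then show ?thesis using peval_scale_forms[OF assms(1)] by simp
qed

lemma proj_space_mem:
  assumes "p \<in> proj_space n" "v \<in> p"
  shows "v \<in> carrier_vec (n + 1)" "v \<noteq> 0\<^sub>v (n + 1)" "p = {c \<cdot>\<^sub>v v | c. c \<noteq> 0}"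
proof -
  obtain w where w: "p = {c \<cdot>\<^sub>v w | c. c \<noteq> 0}" "w \<in> carrier_vec (n + 1)" "w \<noteq> 0\<^sub>v (n + 1)"
    using assms(1) by (auto simp: proj_space_def)
  then obtain c where c: "v = c \<cdot>\<^sub>v w" "c \<noteq> 0" using assms(2) by auto
  show "v \<in> carrier_vec (n + 1)" using w c by simp
  have wv: "w = inverse c \<cdot>\<^sub>v v" using c w by (auto simp: smult_smult_assoc)
  show "v \<noteq> 0\<^sub>v (n + 1)"
  proof
    assume "v = 0\<^sub>v (n + 1)"
    then have "w = 0\<^sub>v (n + 1)" using wv by auto
    then show False using w by simp
  qed
  show "p = {c \<cdot>\<^sub>v v | c. c \<noteq> 0}"
  proof (intro equalityI subsetI)
    fix x assume "x \<in> p"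
    then obtain d where "x = d \<cdot>\<^sub>v w" "d \<noteq> 0" using w by auto
    then have "x = (d * inverse c) \<cdot>\<^sub>v v" by (simp only: wv smult_smult_assoc)
    moreover have "d * inverse c \<noteq> 0" using \<open>d \<noteq> 0\<close> c(2) by simp
    ultimately show "x \<in> {c \<cdot>\<^sub>v v | c. c \<noteq> 0}" by blast
  next
    fix x assume "x \<in> {c \<cdot>\<^sub>v v | c. c \<noteq> 0}"
    then obtain d where "x = d \<cdot>\<^sub>v v" "d \<noteq> 0" by auto
    then have "x = (d * c) \<cdot>\<^sub>v w" by (simp only: c(1) smult_smult_assoc)
    moreover have "d * c \<noteq> 0" using \<open>d \<noteq> 0\<close> c(2) by simp
    ultimately show "x \<in> p" using w by blast
  qed
qed

lemma proj_space_coordinate: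
  assumes "p \<in> proj_space n" "v \<in> p"
  shows "\<exists>i\<le>n. v $ i \<noteq> 0"
proof (rule ccontr)
  assume "\<not> (\<exists>i\<le>n. v $ i \<noteq> 0)"
  then have "v = 0\<^sub>v (n + 1)" using proj_space_mem(1)[OF assms] by (intro eq_vecI) auto
  then show False using proj_space_mem(2)[OF assms] by simp
qed

lemma proj_space_nonempty:
  assumes "p \<in> proj_space n"
  obtains v where "v \<in> p"
proof -
  obtain w where w: "p = {c \<cdot>\<^sub>v w | c. c \<noteq> 0}" using assms by (auto simp: proj_space_def)
  then have "1 \<cdot>\<^sub>v w \<in> p" by (metis (mono_tags, lifting) mem_Collect_eq one_neq_zero)
  then show ?thesis using that by blast
qed

lemma peval_class:
  assumes "p \<in> proj_space n" "q \<in> forms n k" "v \<in> p" "w \<in> p" "peval (\<lambda>i. v $ i) q = 0"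
  shows "peval (\<lambda>i. w $ i) q = 0"
proof -
  obtain c where "w = c \<cdot>\<^sub>v v" using assms(3,4) proj_space_mem(3)[OF assms(1,3)] by auto
  then show ?thesis
    using peval_smult_vec[OF assms(2) proj_space_mem(1)[OF assms(1,3)], of c] assms(5) by simp
qed

definition proj_point :: "nat \<Rightarrow> (nat \<Rightarrow> complex) \<Rightarrow> complex vec set" where
  "proj_point n a = {c \<cdot>\<^sub>v vec (n + 1) a | c. c \<noteq> 0}"

lemma proj_point_space:
  assumes "i \<le> n" "a i \<noteq> 0"
  shows "proj_point n a \<in> proj_space n" "vec (n + 1) a \<in> proj_point n a"
proof -
  have "vec (n + 1) a $ i \<noteq> 0\<^sub>v (n + 1) $ i" using assms by simp
  then have "vec (n + 1) a \<noteq> 0\<^sub>v (n + 1)" by metis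
  then show "proj_point n a \<in> proj_space n"
    unfolding proj_space_def proj_point_def by (auto intro!: exI[of _ "vec (n + 1) a"])
  show "vec (n + 1) a \<in> proj_point n a"
    unfolding proj_point_def by (auto intro!: exI[of _ 1])
qed

lemma peval_vec:
  assumes "q \<in> mpols {..n}"
  shows "peval (\<lambda>i. vec (n + 1) a $ i) q = peval a q"
  using assms by (intro peval_cong_mpols[OF assms]) auto

text \<open>By the Euler relation the partial derivatives control \<open>f\<close> itself, because
  \<open>d\<close> is invertible.\<close>

lemma sing_pointsI:
  assumes f: "f \<in> forms n d" "d > 0" and p: "p \<in> proj_space n" "v \<in> p"
    and v: "\<And>j. j \<le> n \<Longrightarrow> peval (\<lambda>i. v $ i) (pderiv_mpol j f) = 0"
  shows "p \<in> sing_points n f"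
proof -
  have "of_nat d * peval (\<lambda>i. v $ i) f = peval (\<lambda>i. v $ i) (\<Sum>i\<le>n. Var i * pderiv_mpol i f)"
    unfolding Euler_mpol[OF f(1)] by (simp add: Const_of_nat[symmetric])
  also have "\<dots> = 0" using v by simp
  finally have f0: "peval (\<lambda>i. v $ i) f = 0" using f(2) by simp
  show ?thesis
    unfolding sing_points_def using p f0 v peval_class[OF p(1) _ p(2)] f(1) pderiv_mpol_forms[OF f(1)] by blast
qed

lemma proj_point_sing:
  assumes f: "f \<in> forms n d" "d > 0" and i: "i \<le> n" "a i \<noteq> 0"
    and a: "\<And>j. j \<le> n \<Longrightarrow> peval a (pderiv_mpol j f) = 0"
  shows "proj_point n a \<in> sing_points n f"
proof (rule sing_pointsI[OF f proj_point_space[of i n a, OF i]])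
  fix j assume "j \<le> n"
  then show "peval (\<lambda>i. vec (n + 1) a $ i) (pderiv_mpol j f) = 0"
    using a pderiv_mpol_forms[OF f(1), of j] by (subst peval_vec) (auto simp: forms_def)
qed

text \<open>The sets that generate the topology already form a basis: the intersection of two of
  them belongs to the product of the forms.\<close>

lemma zariski_nbhd:
  assumes "openin (zariski_proj n) U" "p \<in> U"
  obtains q k where "q \<in> forms n k" "\<forall>v\<in>p. peval (\<lambda>i. v $ i) q \<noteq> 0" 
    "{p \<in> proj_space n. \<forall>v\<in>p. peval (\<lambda>i. v $ i) q \<noteq> 0} \<subseteq> U"
proof -
  let ?B = "\<lambda>q. {p \<in> proj_space n. \<forall>v\<in>p. peval (\<lambda>i. v $ i) q \<noteq> 0}"
  let ?S = "{?B q | q k. q \<in> mpols {..n} \<and> homogeneous k q}"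
  have "generate_topology_on ?S U"
    using assms(1) unfolding zariski_proj_def by (rule openin_topology_generated_by)
  then have "\<forall>p\<in>U. \<exists>q k. q \<in> forms n k \<and> p \<in> ?B q \<and> ?B q \<subseteq> U"
  proof induction
    case (Int a b)
    show ?case
    proof
      fix p assume p: "p \<in> a \<inter> b"
      from bspec[OF Int.IH(1), of p] p obtain q k where q: "q \<in> forms n k" "p \<in> ?B q" "?B q \<subseteq> a"
        by (elim exE conjE IntE) blast
      from bspec[OF Int.IH(2), of p] p obtain q' k' where q': "q' \<in> forms n k'" "p \<in> ?B q'" "?B q' \<subseteq> b"
        by (elim exE conjE IntE) blast
      have "?B (q * q') = ?B q \<inter> ?B q'" by auto
      then have "q * q' \<in> forms n (k + k')" "p \<in> ?B (q * q')" "?B (q * q') \<subseteq> a \<inter> b"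
        using q q' by (auto intro: forms_mult)
      then show "\<exists>q k. q \<in> forms n k \<and> p \<in> ?B q \<and> ?B q \<subseteq> a \<inter> b" by blast
    qed
  next
    case (UN K)
    show ?case
    proof
      fix p assume "p \<in> \<Union>K"
      then obtain k where "k \<in> K" "p \<in> k" by auto
      then obtain q l where "q \<in> forms n l" "p \<in> ?B q" "?B q \<subseteq> k" using UN.IH by blast
      then show "\<exists>q k. q \<in> forms n k \<and> p \<in> ?B q \<and> ?B q \<subseteq> \<Union>K" using \<open>k \<in> K\<close> by blast
    qed
  next
    case (Basis s)
    then obtain q k where "s = ?B q" "q \<in> forms n k" by (auto simp: forms_def)
    then show ?case by blast
  qed simp
  then obtain q k where "q \<in> forms n k" "p \<in> ?B q" "?B q \<subseteq> U" using assms(2) by blast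
  then show ?thesis using that by auto
qed

lemma isolated_singularity_form:
  assumes "at_most_isolated_singularities n f" "p \<in> sing_points n f"
  obtains q k where "q \<in> forms n k" "\<forall>v\<in>p. peval (\<lambda>i. v $ i) q \<noteq> 0"
    "\<forall>p'\<in>sing_points n f. p' \<noteq> p \<longrightarrow> (\<forall>v\<in>p'. peval (\<lambda>i. v $ i) q = 0)"
proof -
  obtain U where U: "openin (zariski_proj n) U" "{p} = U \<inter> sing_points n f"
    using assms by (auto simp: at_most_isolated_singularities_def openin_subtopology)
  then have "p \<in> U" by auto
  obtain q k where q: "q \<in> forms n k" "\<forall>v\<in>p. peval (\<lambda>i. v $ i) q \<noteq> 0"
    "{p \<in> proj_space n. \<forall>v\<in>p. peval (\<lambda>i. v $ i) q \<noteq> 0} \<subseteq> U"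
    by (rule zariski_nbhd[OF U(1) \<open>p \<in> U\<close>])
  have "peval (\<lambda>i. v $ i) q = 0" if p': "p' \<in> sing_points n f" "p' \<noteq> p" and v: "v \<in> p'" for p' v
  proof -
    have "p' \<notin> U" using p' U(2) by blast
    moreover have ps: "p' \<in> proj_space n" using p' by (simp add: sing_points_def)
    ultimately obtain w where "w \<in> p'" "peval (\<lambda>i. w $ i) q = 0" using q(3) by blast
    then show ?thesis using peval_class[OF ps q(1) _ v] by blast
  qed
  then show ?thesis using that[of q k] q(1,2) by blast
qed

text \<open>Every \<open>Var i\<close> with \<open>i \<le> n\<close> vanishes on the common zeros of
  \<open>I\<close>, so a power of it is in \<open>I\<close>; the largest of these finitely many
  exponents serves for all of them.\<close>

lemma form_Nullstellensatz:
  fixes I :: "nat mpol set"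
  assumes I: "is_ideal I" and "\<And>v i. i \<le> n \<Longrightarrow> v i \<noteq> 0 \<Longrightarrow> \<exists>s\<in>I. peval v s \<noteq> 0"
  shows "\<exists>N. \<forall>i\<le>n. Var i ^ N \<in> I"
proof -
  have "\<exists>N. Var i ^ N \<in> I" if "i \<le> n" for i
  proof (rule Nullstellensatz[OF I])
    fix v assume "\<And>f. f \<in> I \<Longrightarrow> peval v f = 0"
    then show "peval v (Var i) = 0" using assms(2)[OF that, of v] by auto
  qed
  then have "\<forall>i\<in>{..n}. \<exists>N. Var i ^ N \<in> I" by blast
  from bchoice[OF this] obtain N where N: "\<forall>i\<in>{..n}. Var i ^ N i \<in> I" by (rule exE)
  have "Var i ^ Max (N ` {..n}) \<in> I" if "i \<le> n" for i
  proof -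
    have "N i \<le> Max (N ` {..n})" using that by (intro Max_ge) auto
    then have "Var i ^ Max (N ` {..n}) = Var i ^ (Max (N ` {..n}) - N i) * Var i ^ N i"
      by (simp flip: power_add)
    then show ?thesis using N that I by (simp add: is_ideal_mult)
  qed
  then show ?thesis by blast
qed

text \<open>The coefficients are arbitrary polynomials in all \<open>nat\<close>-indexed variables,
  so that this is an ideal of the full ring; \<open>jac_ideal_forms\<close> returns to
  forms.\<close>

definition jac_ideal :: "nat \<Rightarrow> nat mpol \<Rightarrow> nat mpol set" where
  "jac_ideal n f = {\<Sum>j\<le>n. q j * pderiv_mpol j f | q. True}"

lemma jac_ideal_is_ideal: "is_ideal (jac_ideal n f)"
proof (rule is_idealI)
  show "0 \<in> jac_ideal n f" by (auto simp: jac_ideal_def intro!: exI[of _ "\<lambda>_. 0"])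
  show "a + b \<in> jac_ideal n f" if ab: "a \<in> jac_ideal n f" "b \<in> jac_ideal n f" for a b
  proof -
    obtain q r where "a = (\<Sum>j\<le>n. q j * pderiv_mpol j f)" "b = (\<Sum>j\<le>n. r j * pderiv_mpol j f)"
      using ab by (auto simp: jac_ideal_def)
    then have "a + b = (\<Sum>j\<le>n. (q j + r j) * pderiv_mpol j f)" by (simp add: algebra_simps sum.distrib)
    then show ?thesis unfolding jac_ideal_def by (auto intro!: exI[of _ "\<lambda>j. q j + r j"])
  qed
  show "r * a \<in> jac_ideal n f" if a: "a \<in> jac_ideal n f" for a r
  proof -
    obtain q where "a = (\<Sum>j\<le>n. q j * pderiv_mpol j f)" using a by (auto simp: jac_ideal_def)
    then have "r * a = (\<Sum>j\<le>n. (r * q j) * pderiv_mpol j f)" by (simp add: sum_distrib_left mult.assoc)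
    then show ?thesis unfolding jac_ideal_def by (auto intro!: exI[of _ "\<lambda>j. r * q j"])
  qed
qed

lemma pderiv_jac_ideal: "j \<le> n \<Longrightarrow> pderiv_mpol j f \<in> jac_ideal n f"
  unfolding jac_ideal_def
  by (intro CollectI exI[of _ "\<lambda>i. if i = j then 1 else 0"]) (simp add: if_distrib[of "\<lambda>x. x * _"] cong: if_cong)

text \<open>Compactness in the language of ideals: the polynomials that vanish at all but finitely
  many singular points form an ideal without zeros outside the origin. At a nonsingular point some
  partial derivative shows this, at a singular point a form isolating it. Hence powers of all
  coordinates are in the ideal, and since the coordinates of a point cannot all vanish, only
  finitely many singular points exist.\<close>

lemma finite_sing_points:
  assumes f: "f \<in> forms n d" "d > 0" and iso: "at_most_isolated_singularities n f"
  shows "finite (sing_points n f)"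
proof -
  define I where "I = {s. \<exists>F. finite F \<and> (\<forall>p\<in>sing_points n f - F. \<forall>v\<in>p. peval (\<lambda>i. v $ i) s = 0)}"
  have "is_ideal I"
  proof (rule is_idealI)
    show "0 \<in> I" by (auto simp: I_def)
    show "a + b \<in> I" if ab: "a \<in> I" "b \<in> I" for a b
    proof -
      obtain F where F: "finite F" "\<And>p v. p \<in> sing_points n f - F \<Longrightarrow> v \<in> p \<Longrightarrow> peval (\<lambda>i. v $ i) a = 0"
        using ab by (auto simp: I_def)
      obtain G where G: "finite G" "\<And>p v. p \<in> sing_points n f - G \<Longrightarrow> v \<in> p \<Longrightarrow> peval (\<lambda>i. v $ i) b = 0"
        using ab by (auto simp: I_def)
      show ?thesis unfolding I_def using F G by (intro CollectI exI[of _ "F \<union> G"]) auto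
    qed
    show "q * a \<in> I" if "a \<in> I" for a q using that by (fastforce simp: I_def)
  qed
  have ex: "\<exists>s\<in>I. peval a s \<noteq> 0" if i: "i \<le> n" "a i \<noteq> 0" for a i
  proof (cases "\<exists>j\<le>n. peval a (pderiv_mpol j f) \<noteq> 0")
    case True
    then obtain j where "j \<le> n" "peval a (pderiv_mpol j f) \<noteq> 0" by auto
    moreover then have "pderiv_mpol j f \<in> I" by (auto simp: I_def sing_points_def)
    ultimately show ?thesis by blast
  next
    case False
    then have p: "proj_point n a \<in> sing_points n f" using i by (intro proj_point_sing[OF f]) auto
    obtain q k where q: "q \<in> forms n k" "\<forall>v\<in>proj_point n a. peval (\<lambda>i. v $ i) q \<noteq> 0"
      "\<forall>p'\<in>sing_points n f. p' \<noteq> proj_point n a \<longrightarrow> (\<forall>v\<in>p'. peval (\<lambda>i. v $ i) q = 0)"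
      by (rule isolated_singularity_form[OF iso p])
    have "q \<in> I" unfolding I_def using q(3) by (intro CollectI exI[of _ "{proj_point n a}"]) auto
    moreover have "peval a q \<noteq> 0"
      using bspec[OF q(2) proj_point_space(2)[of i n a, OF i]] q(1) peval_vec[of q n a] by (simp add: forms_def)
    ultimately show ?thesis by blast
  qed
  have "\<exists>N. \<forall>i\<le>n. Var i ^ N \<in> I"
    by (rule form_Nullstellensatz[OF \<open>is_ideal I\<close>]) (rule ex)
  then obtain N where N: "\<forall>i\<le>n. Var i ^ N \<in> I" by (rule exE)
  then have "\<forall>i\<in>{..n}. \<exists>F. finite F \<and> (\<forall>p\<in>sing_points n f - F. \<forall>v\<in>p. (v $ i) ^ N = 0)"
    by (auto simp: I_def)
  from bchoice[OF this] obtain F where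
    F: "\<forall>i\<in>{..n}. finite (F i) \<and> (\<forall>p\<in>sing_points n f - F i. \<forall>v\<in>p. (v $ i) ^ N = 0)" by (rule exE)
  have "sing_points n f \<subseteq> (\<Union>i\<le>n. F i)"
  proof
    fix p assume p: "p \<in> sing_points n f"
    then have ps: "p \<in> proj_space n" by (simp add: sing_points_def)
    obtain v where v: "v \<in> p" by (rule proj_space_nonempty[OF ps])
    obtain i where i: "i \<le> n" "v $ i \<noteq> 0" using proj_space_coordinate[OF ps v] by auto
    then have "p \<in> F i" using F p v by (metis DiffI atMost_iff power_not_zero)
    then show "p \<in> (\<Union>i\<le>n. F i)" using i by blast
  qed
  then show ?thesis using F by (meson finite_UN finite_atMost finite_subset)
qed

text \<open>The ideal of all multipliers of \<open>g\<close> into the Jacobian ideal has no zero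
  except where all coordinates \<open>0..n\<close> vanish: it contains the partial derivatives, and
  \<open>s\<close> at the singular points.\<close>

lemma jac_ideal_torsion:
  assumes f: "f \<in> forms n d" "d > 0"
    and g: "\<And>p. p \<in> sing_points n f \<Longrightarrow>
      \<exists>s. s \<in> mpols {..n} \<and> (\<forall>v\<in>p. peval (\<lambda>i. v $ i) s \<noteq> 0) \<and> s * g \<in> jac_ideal n f"
  shows "\<exists>N. \<forall>i\<le>n. Var i ^ N * g \<in> jac_ideal n f"
proof -
  define I where "I = {s. s * g \<in> jac_ideal n f}"
  have "is_ideal I"
    using jac_ideal_is_ideal[of n f] unfolding I_def is_ideal_def by (simp add: distrib_right mult.assoc)
  have ex: "\<exists>s\<in>I. peval a s \<noteq> 0" if i: "i \<le> n" "a i \<noteq> 0" for a i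
  proof (cases "\<exists>j\<le>n. peval a (pderiv_mpol j f) \<noteq> 0")
    case True
    then obtain j where j: "j \<le> n" "peval a (pderiv_mpol j f) \<noteq> 0" by auto
    have "pderiv_mpol j f \<in> I"
      unfolding I_def using is_ideal_mult2[OF jac_ideal_is_ideal pderiv_jac_ideal[OF j(1)]] by simp
    then show ?thesis using j by blast
  next
    case False
    then have "proj_point n a \<in> sing_points n f" using i by (intro proj_point_sing[OF f]) auto
    then obtain s where s: "s \<in> mpols {..n}" "\<forall>v\<in>proj_point n a. peval (\<lambda>i. v $ i) s \<noteq> 0" "s * g \<in> jac_ideal n f"
      using g by blast
    have "peval a s \<noteq> 0" using bspec[OF s(2) proj_point_space(2)[of i n a, OF i]] peval_vec[OF s(1), of a] by simp
    then show ?thesis using s by (auto simp: I_def)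
  qed
  have "\<exists>N. \<forall>i\<le>n. Var i ^ N \<in> I"
    by (rule form_Nullstellensatz[OF \<open>is_ideal I\<close>]) (rule ex)
  then show ?thesis by (simp add: I_def)
qed

subsection \<open>Dickson's lemma and finite generation of graded ideals\<close>

text \<open>A monotone subsequence that is decreasing becomes constant from the point where its
  minimum is attained.\<close>

lemma incseq_subseq_nat:
  fixes s :: "nat \<Rightarrow> nat"
  obtains r where "strict_mono r" "incseq (s \<circ> r)"
proof -
  obtain r where r: "strict_mono r" "monoseq (\<lambda>k. s (r k))" using seq_monosub by blast
  show ?thesis
  proof (cases "incseq (\<lambda>k. s (r k))")
    case True
    then show ?thesis using that[OF r(1)] by (simp add: comp_def)
  next
    case False
    then have dec: "decseq (\<lambda>k. s (r k))" using r(2) by (simp add: monoseq_iff)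
    define M where "M = (LEAST m. m \<in> range (\<lambda>k. s (r k)))"
    have "M \<in> range (\<lambda>k. s (r k))" unfolding M_def by (rule LeastI[of _ "s (r 0)"]) auto
    then obtain N where N: "M = s (r N)" by auto
    have const: "s (r k) = M" if "k \<ge> N" for k
    proof (rule antisym)
      show "s (r k) \<le> M" using dec that unfolding N by (auto simp: decseq_def)
      show "M \<le> s (r k)" unfolding M_def by (rule Least_le) auto
    qed
    have "strict_mono (\<lambda>k. r (k + N))" using r(1) by (simp add: strict_mono_def)
    moreover have "incseq (s \<circ> (\<lambda>k. r (k + N)))" using const by (simp add: incseq_def)
    ultimately show ?thesis by (rule that)
  qed
qed

lemma incseq_subseq_coordinates:
  fixes s :: "nat \<Rightarrow> nat \<Rightarrow> nat"
  shows "\<exists>r. strict_mono r \<and> (\<forall>i<N. incseq (\<lambda>k. s (r k) i))"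
proof (induction N)
  case 0
  show ?case by (rule exI[of _ id]) (simp add: strict_mono_def)
next
  case (Suc N)
  then obtain r where r: "strict_mono r" "\<forall>i<N. incseq (\<lambda>k. s (r k) i)" by blast
  obtain t where t: "strict_mono t" "incseq ((\<lambda>k. s (r k) N) \<circ> t)" by (rule incseq_subseq_nat)
  have "strict_mono (r \<circ> t)" using r(1) t(1) by (rule strict_mono_o)
  moreover have "incseq (\<lambda>k. s ((r \<circ> t) k) i)" if "i < Suc N" for i
  proof (cases "i = N")
    case True
    then show ?thesis using t(2) by (simp add: comp_def)
  next
    case False
    then have "incseq (\<lambda>k. s (r k) i)" using r(2) that by simp
    then show ?thesis using t(1) by (auto simp: incseq_def strict_mono_less_eq)
  qed
  ultimately show ?case by blast
qed

lemma poly_mapping_le_diff: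
  fixes a b :: "'v \<Rightarrow>\<^sub>0 nat"
  assumes "\<And>i. lookup b i \<le> lookup a i"
  shows "a = b + (a - b)"
  using assms by (intro poly_mapping_eqI) (simp add: lookup_add lookup_minus)

text \<open>\<open>B\<close> consists of the elements minimal for divisibility. In an infinite
  \<open>B\<close> a subsequence would increase in all \<open>n + 1\<close> coordinates, and one
  minimal element would properly divide another.\<close>

lemma Dickson:
  fixes A :: "(nat \<Rightarrow>\<^sub>0 nat) set"
  assumes "A \<subseteq> {m. keys m \<subseteq> {..n}}"
  obtains B where "finite B" "B \<subseteq> A" "\<forall>a\<in>A. \<exists>b\<in>B. \<exists>c. a = b + c"
proof -
  define B where "B = {a \<in> A. \<forall>b\<in>A. (\<exists>c. a = b + c) \<longrightarrow> b = a}"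
  have "\<exists>b\<in>B. \<exists>c. a = b + c" if "a \<in> A" for a
    using that
  proof (induction "mdeg a" arbitrary: a rule: less_induct)
    case less
    show ?case
    proof (cases "a \<in> B")
      case True
      then show ?thesis by (metis add.right_neutral)
    next
      case False
      then obtain b c where b: "b \<in> A" "a = b + c" "b \<noteq> a" using less.prems by (auto simp: B_def)
      have "mdeg c \<noteq> 0"
      proof
        assume "mdeg c = 0"
        then have "c = 0" using lookup_le_mdeg[of c] by (intro poly_mapping_eqI) (metis le_zero_eq lookup_zero)
        then show False using b by simp
      qed
      then have "mdeg b < mdeg a" using b(2) by simp
      then obtain b' c' where "b' \<in> B" "b = b' + c'" using less.hyps[OF _ b(1)] by blast
      then show ?thesis using b(2) by (metis add.assoc)
    qed
  qed
  moreover have "finite B"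
  proof (rule ccontr)
    assume "infinite B"
    then obtain s :: "nat \<Rightarrow> _" where s: "inj s" "range s \<subseteq> B" using infinite_countable_subset by blast
    obtain r where r: "strict_mono r" "\<forall>i<Suc n. incseq (\<lambda>k. lookup (s (r k)) i)"
      using incseq_subseq_coordinates[of "Suc n" "\<lambda>k. lookup (s k)"] by blast
    have sB: "s k \<in> B" for k using s(2) by blast
    have sn: "keys (s k) \<subseteq> {..n}" for k using sB[of k] assms by (auto simp: B_def)
    have "lookup (s (r 0)) i \<le> lookup (s (r 1)) i" for i
    proof (cases "i \<le> n")
      case True
      then show ?thesis using r(2) by (auto simp: incseq_def)
    next
      case False
      then have "i \<notin> keys (s (r 0))" using sn[of "r 0"] by auto
      then show ?thesis by (simp add: in_keys_iff)
    qed
    then have "s (r 1) = s (r 0) + (s (r 1) - s (r 0))" by (rule poly_mapping_le_diff)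
    then have "s (r 0) = s (r 1)" using sB[of "r 1"] sB[of "r 0"] unfolding B_def by blast
    then have "r 0 = r 1" using s(1) by (simp add: inj_eq)
    then show False using r(1) by (metis strict_mono_eq zero_neq_one)
  qed
  moreover have "B \<subseteq> A" by (auto simp: B_def)
  ultimately show ?thesis using that by blast
qed

text \<open>The maximum refers to the linear order on exponent vectors, which is compatible with
  addition; reductions terminate because each degree has finitely many monomials.\<close>

definition lead_mono :: "nat mpol \<Rightarrow> (nat \<Rightarrow>\<^sub>0 nat)" where
  "lead_mono g = Max (keys g)"

lemma lead_mono_in_keys: "g \<noteq> 0 \<Longrightarrow> lead_mono g \<in> keys g"
  unfolding lead_mono_def by (intro Max_in) auto

lemma lead_mono_ge: "m \<in> keys g \<Longrightarrow> m \<le> lead_mono g"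
  unfolding lead_mono_def by (intro Max_ge) auto

lemma keys_single_mult: "keys (single c (1::complex) * g) \<subseteq> (+) c ` keys g" for g :: "nat mpol"
  using keys_mult[of "single c 1" g] by auto

lemma lookup_single_mult: "lookup (single c (1::complex) * g) (c + m) = lookup g m" for g :: "nat mpol"
proof (induction g rule: sum_single_induct)
  case (single m' c')
  show ?case by (simp add: mult_single lookup_single)
qed (auto simp: distrib_left lookup_add)

lemma lead_mono_single_mult:
  assumes "g \<noteq> 0"
  shows "m \<in> keys (single c 1 * g) \<Longrightarrow> m \<le> c + lead_mono g"
    "lookup (single c 1 * g) (c + lead_mono g) \<noteq> 0"
proof -
  show "m \<in> keys (single c 1 * g) \<Longrightarrow> m \<le> c + lead_mono g"
    using keys_single_mult[of c g] lead_mono_ge[of _ g] by (auto intro!: add_left_mono)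
  show "lookup (single c 1 * g) (c + lead_mono g) \<noteq> 0"
    using lead_mono_in_keys[OF assms] by (simp add: lookup_single_mult in_keys_iff)
qed

lemma mono_split:
  assumes "c \<in> monoms n k" "e \<le> k"
  shows "\<exists>c1\<in>monoms n e. \<exists>c2\<in>monoms n (k - e). c = c1 + c2"
  using assms(2)
proof (induction e)
  case 0
  show ?case using assms(1) by (intro bexI[of _ 0] bexI[of _ c]) (auto simp: monoms_def)
next
  case (Suc e)
  then obtain c1 c2 where c: "c1 \<in> monoms n e" "c2 \<in> monoms n (k - e)" "c = c1 + c2" by auto
  have "c2 \<in> monoms n (Suc (k - Suc e))" using c(2) Suc.prems by (simp add: Suc_diff_Suc)
  then obtain i c3 where c3: "i \<le> n" "c3 \<in> monoms n (k - Suc e)" "c2 = single i 1 + c3"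
    by (rule monoms_Suc_obtain)
  have "c1 + single i 1 \<in> monoms n (e + 1)"
    using c3(1) by (intro monoms_add c(1)) (auto simp: monoms_def split: if_splits)
  then show ?case using c(3) c3 by (intro bexI[of _ "c1 + single i 1"] bexI[of _ c3]) (auto simp: add.assoc)
qed

text \<open>A Groebner basis argument: by Dickson's lemma finitely many leading monomials divide all
  others. Beyond the largest degree \<open>k1\<close> of these, every element of \<open>K k\<close>
  is reduced to 0 by monomial multiples of elements of \<open>K k1\<close>.\<close>

lemma graded_ideal_generated:
  assumes sub: "\<And>k. mpolv.subspace (K k)" and forms: "\<And>k. K k \<subseteq> forms n k"
    and mult: "\<And>k e g m. g \<in> K k \<Longrightarrow> m \<in> monoms n e \<Longrightarrow> single m 1 * g \<in> K (k + e)"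
  shows "\<exists>k1. \<forall>k\<ge>k1. K k \<subseteq> mpolv.span {single m 1 * h | m h. m \<in> monoms n (k - k1) \<and> h \<in> K k1}"
proof -
  define A where "A = {lead_mono g | g k. g \<in> K k \<and> g \<noteq> 0}"
  have lm: "lead_mono g \<in> monoms n k" if "g \<in> K k" "g \<noteq> 0" for g k
    using subsetD[OF forms that(1)] lead_mono_in_keys[OF that(2)] by (auto simp: forms_keys)
  have "A \<subseteq> {m. keys m \<subseteq> {..n}}" using lm by (auto simp: A_def monoms_def)
  then obtain B where B: "finite B" "B \<subseteq> A" "\<forall>a\<in>A. \<exists>b\<in>B. \<exists>c. a = b + c" by (rule Dickson)
  define k1 where "k1 = Max (insert 0 (mdeg ` B))"
  have k1: "mdeg b \<le> k1" if "b \<in> B" for b unfolding k1_def using B(1) that by (intro Max_ge) auto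
  have gb: "\<exists>g. g \<in> K (mdeg b) \<and> g \<noteq> 0 \<and> lead_mono g = b" if b: "b \<in> B" for b
  proof -
    obtain g k where g: "g \<in> K k" "g \<noteq> 0" "b = lead_mono g" using B(2) b by (auto simp: A_def)
    then have "mdeg b = k" using lm[of g k] by (simp add: monoms_def)
    then show ?thesis using g by blast
  qed
  show ?thesis
  proof (intro exI[of _ k1] allI impI subsetI)
    fix k g assume k: "k1 \<le> k" and g: "g \<in> K k"
    define W where "W = mpolv.span {single m 1 * h | m h. m \<in> monoms n (k - k1) \<and> h \<in> K k1}"
    show "g \<in> W"
      using g
    \<comment> \<open>The measure counts the monomials of degree \<open>k\<close> below the leading
      one; it drops whenever the leading term is cancelled.\<close>
    proof (induction "card {m \<in> monoms n k. m < lead_mono g}" arbitrary: g rule: less_induct)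
      case less
      show ?case
      proof (cases "g = 0")
        case True
        then show ?thesis by (simp add: W_def mpolv.span_zero)
      next
        case False
        define a where "a = lead_mono g"
        have "a \<in> A" using less.prems False by (auto simp: A_def a_def)
        then obtain b c where b: "b \<in> B" "a = b + c" using B(3) by blast
        obtain gb where gb: "gb \<in> K (mdeg b)" "gb \<noteq> 0" "lead_mono gb = b" using gb[OF b(1)] by blast
        have a: "a \<in> monoms n k" unfolding a_def by (rule lm[OF less.prems False])
        have c: "c \<in> monoms n (k - mdeg b)" using a b monoms_add_cancel by blast
        have "k1 - mdeg b \<le> k - mdeg b" using k by simp
        \<comment> \<open>The cofactor is split so that its first part lifts the divisor exactly to
          degree \<open>k1\<close>, the only degree from which generators are taken.\<close>
        from mono_split[OF c this] obtain c1 c2 where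
          c12: "c1 \<in> monoms n (k1 - mdeg b)" "c2 \<in> monoms n (k - mdeg b - (k1 - mdeg b))" "c = c1 + c2"
          by blast
        have c2: "c2 \<in> monoms n (k - k1)" using c12(2) k1[OF b(1)] k by simp
        have h1: "single c1 1 * gb \<in> K k1" using mult[OF gb(1) c12(1)] k1[OF b(1)] by simp
        define h where "h = single c2 1 * (single c1 1 * gb)"
        have hW: "h \<in> W" unfolding W_def h_def using c2 h1 by (intro mpolv.span_base) blast
        have hK: "h \<in> K k" unfolding h_def using mult[OF h1 c2] k by simp
        have h_eq: "h = single c 1 * gb"
          by (simp add: h_def c12(3) mult_single mult.assoc[symmetric] add.commute)
        have ac: "c + lead_mono gb = a" using gb b by (simp add: add.commute)
        have h_keys: "m \<le> a" if "m \<in> keys h" for m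
          using lead_mono_single_mult(1)[OF gb(2), of m c] that unfolding h_eq ac by simp
        have h_a: "lookup h a \<noteq> 0" using lead_mono_single_mult(2)[OF gb(2), of c] unfolding h_eq ac .
        define t where "t = lookup g a / lookup h a"
        define g' where "g' = g - Const t * h"
        have g'K: "g' \<in> K k" unfolding g'_def
          by (intro mpolv.subspace_diff[OF sub] less.prems mpolv_subspace_scale[OF sub] hK)
        have "g' \<in> W"
        proof (cases "g' = 0")
          case True
          then show ?thesis by (simp add: W_def mpolv.span_zero)
        next
          case False
          have "lookup g' a = 0" using h_a by (simp add: g'_def t_def lookup_minus lookup_Const_mult)
          then have "lead_mono g' \<noteq> a" using lead_mono_in_keys[OF False] by (auto simp: in_keys_iff)
          moreover have "lead_mono g' \<le> a"
          proof -
            have "lead_mono g' \<in> keys g \<or> lead_mono g' \<in> keys h"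
              using lead_mono_in_keys[OF False]
              by (auto simp: in_keys_iff g'_def lookup_minus lookup_Const_mult)
            then show ?thesis using h_keys lead_mono_ge[of _ g] by (auto simp: a_def)
          qed
          ultimately have lt: "lead_mono g' < a" by simp
          have "card {m \<in> monoms n k. m < lead_mono g'} < card {m \<in> monoms n k. m < a}"
          proof (rule psubset_card_mono)
            show "finite {m \<in> monoms n k. m < a}" using finite_monoms by simp
            show "{m \<in> monoms n k. m < lead_mono g'} \<subset> {m \<in> monoms n k. m < a}"
              using lt lm[OF g'K False] by (auto simp: psubset_eq)
          qed
          then show ?thesis using less.hyps[of g'] g'K by (simp add: a_def)
        qed
        then have "g' + Const t * h \<in> W"
          using hW unfolding W_def by (intro mpolv.span_add mpolv_span_scale)
        then show ?thesis by (simp add: g'_def)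
      qed
    qed
  qed
qed

section \<open>Vanishing of the torsion modulo the Jacobian ideal in some large degree\<close>

lemma mono_eval_pigeonhole:
  assumes "m \<in> monoms n ((n + 1) * N)" 
  shows "\<exists>i\<le>n. N \<le> lookup m i"
proof (rule ccontr)
  assume "\<not> ?thesis"
  then have lt: "lookup m i < N" if "i \<le> n" for i using that by auto
  have "(\<Sum>i\<le>n. lookup m i) < (\<Sum>i\<le>n. N)"
    using lt by (intro sum_strict_mono) auto
  then show False using monoms_sum_lookup[OF assms] by simp
qed

text \<open>The forms killed modulo the Jacobian ideal by powers of all variables are generated, in
  large degrees, by the finite-dimensional space \<open>K k1\<close>, so one exponent
  \<open>M\<close> works for all generators. Multiplying them by a monomial of large degree leads
  into the Jacobian ideal, since some variable occurs with exponent at least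
  \<open>M\<close>.\<close>

lemma jac_ideal_saturated:
  fixes n f k0
  shows "\<exists>k\<ge>k0. \<forall>g\<in>forms n k. (\<exists>N. \<forall>i\<le>n. Var i ^ N * g \<in> jac_ideal n f) \<longrightarrow> g \<in> jac_ideal n f"
proof -
  let ?J = "jac_ideal n f"
  note id = jac_ideal_is_ideal[of n f]
  define K where "K k = {g \<in> forms n k. \<exists>N. \<forall>i\<le>n. Var i ^ N * g \<in> ?J}" for k
  have sub: "mpolv.subspace (K k)" for k
  proof (rule mpolv_subspaceI)
    show "0 \<in> K k" using id by (simp add: K_def is_ideal_0)
    show "g + h \<in> K k" if gh: "g \<in> K k" "h \<in> K k" for g h
    proof -
      obtain N M where N: "\<forall>i\<le>n. Var i ^ N * g \<in> ?J" and M: "\<forall>i\<le>n. Var i ^ M * h \<in> ?J"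
        using gh by (auto simp: K_def)
      have "Var i ^ (N + M) * (g + h) \<in> ?J" if "i \<le> n" for i
      proof -
        have "Var i ^ (N + M) * (g + h) = Var i ^ M * (Var i ^ N * g) + Var i ^ N * (Var i ^ M * h)"
          by (simp add: power_add algebra_simps)
        then show ?thesis using N M that by (simp add: is_ideal_add[OF id] is_ideal_mult[OF id])
      qed
      then show ?thesis using gh by (auto simp: K_def intro: forms_add)
    qed
    show "Const c * g \<in> K k" if g: "g \<in> K k" for c g
    proof -
      obtain N where N: "\<forall>i\<le>n. Var i ^ N * g \<in> ?J" using g by (auto simp: K_def)
      have "Var i ^ N * (Const c * g) \<in> ?J" if "i \<le> n" for i
        using is_ideal_mult[OF id, of "Var i ^ N * g" "Const c"] N that by (simp add: mult.left_commute)
      then show ?thesis using g by (auto simp: K_def intro: forms_Const_mult)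
    qed
  qed
  have mult: "single m 1 * g \<in> K (k + e)" if g: "g \<in> K k" and m: "m \<in> monoms n e" for k e g m
  proof -
    obtain N where N: "\<forall>i\<le>n. Var i ^ N * g \<in> ?J" using g by (auto simp: K_def)
    have "Var i ^ N * (single m 1 * g) \<in> ?J" if "i \<le> n" for i
      using is_ideal_mult[OF id, of "Var i ^ N * g" "single m 1"] N that by (simp add: mult.left_commute)
    moreover have "single m 1 * g \<in> forms n (k + e)"
      using forms_mult[OF forms_single[OF m], of g k 1] g by (simp add: K_def add.commute)
    ultimately show ?thesis by (auto simp: K_def)
  qed
  obtain k1 where k1: "\<forall>k\<ge>k1. K k \<subseteq> mpolv.span {single m 1 * h | m h. m \<in> monoms n (k - k1) \<and> h \<in> K k1}"
    using graded_ideal_generated[of K n, OF sub _ mult] by (auto simp: K_def)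
  obtain C where C: "C \<subseteq> K k1" "mpolv.independent C" "K k1 \<subseteq> mpolv.span C"
    by (rule mpolv.maximal_independent_subset)
  have "K k1 \<subseteq> forms n k1" by (auto simp: K_def)
  with C(1) have "finite C" using finite_independent_forms[OF _ C(2)] by blast
  have "\<forall>g\<in>C. \<exists>N. \<forall>i\<le>n. Var i ^ N * g \<in> ?J" using C(1) by (auto simp: K_def)
  from bchoice[OF this] obtain N where N: "\<forall>g\<in>C. \<forall>i\<le>n. Var i ^ N g * g \<in> ?J" by (rule exE)
  define M where "M = Max (insert 0 (N ` C))"
  have M: "Var i ^ M * g \<in> ?J" if "g \<in> C" "i \<le> n" for g i
  proof -
    have "N g \<le> M" unfolding M_def using \<open>finite C\<close> that by (intro Max_ge) auto
    then have "Var i ^ M = Var i ^ (M - N g) * Var i ^ N g" by (simp flip: power_add)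
    then show ?thesis using N that is_ideal_mult[OF id] by (simp add: mult.assoc)
  qed
  have J_sub: "mpolv.subspace ?J"
    by (rule mpolv_subspaceI) (auto intro: is_ideal_0 is_ideal_add is_ideal_mult id)
  \<comment> \<open>Degree \<open>(n + 1) * M\<close> forces divisibility by some
    \<open>Var i ^ M\<close>; the summand \<open>k0\<close> pushes the final degree beyond the
    prescribed bound.\<close>
  define E where "E = (n + 1) * M + k0"
  have E: "single m 1 * g \<in> ?J" if g: "g \<in> K k1" and m: "m \<in> monoms n E" for g m
  proof -
    obtain m1 m2 where m12: "m1 \<in> monoms n ((n + 1) * M)" "m = m1 + m2"
      using mono_split[OF m, of "(n + 1) * M"] by (auto simp: E_def)
    obtain i where i: "i \<le> n" "M \<le> lookup m1 i" using mono_eval_pigeonhole[OF m12(1)] by blast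
    have "single m1 1 = Var i ^ M * single (m1 - single i M) (1::complex)"
      using mono_eval_split[of M m1 i Var] i by (simp add: mono_eval_Var)
    then have eq: "single m 1 = single m2 1 * single (m1 - single i M) 1 * Var i ^ M"
      by (metis (no_types, lifting) m12(2) mult.commute mult.right_neutral mult_single mult.assoc)
    show ?thesis
    proof (rule mult_span_in[of g C])
      show "g \<in> mpolv.span C" using g C(3) by blast
      show "single m 1 * b \<in> ?J" if "b \<in> C" for b
        unfolding eq mult.assoc by (intro is_ideal_mult[OF id] M that i(1))
    qed (rule J_sub)
  qed
  have "K (k1 + E) \<subseteq> ?J"
  proof -
    have "K (k1 + E) \<subseteq> mpolv.span {single m 1 * h | m h. m \<in> monoms n E \<and> h \<in> K k1}"
      using k1[rule_format, of "k1 + E"] by simp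
    also have "\<dots> \<subseteq> ?J" using E by (intro mpolv.span_minimal J_sub) auto
    finally show ?thesis .
  qed
  then show ?thesis by (intro exI[of _ "k1 + E"]) (auto simp: K_def E_def)
qed

subsection \<open>Dehomogenization\<close>

definition dehom :: "nat \<Rightarrow> nat mpol \<Rightarrow> nat mpol" where
  "dehom i = psubst (\<lambda>j. if j = i then 1 else Var j)"

lemma dehom_simps [simp]: "dehom i 0 = 0" "dehom i 1 = 1" "dehom i (f + g) = dehom i f + dehom i g"
  "dehom i (f - g) = dehom i f - dehom i g" "dehom i (f * g) = dehom i f * dehom i g"
  "dehom i (f ^ k) = dehom i f ^ k" "dehom i (Const c) = Const c" "dehom i (Var i) = 1"
  "dehom i (sum h A) = (\<Sum>x\<in>A. dehom i (h x))"
  by (simp_all add: dehom_def)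

lemma dehom_Var: "dehom i (Var j) = (if j = i then 1 else Var j)"
  by (simp add: dehom_def)

lemma dehom_mpols: "g \<in> mpols {..n} \<Longrightarrow> dehom i g \<in> mpols ({..n} - {i})"
  unfolding dehom_def by (rule psubst_mpols) (auto intro: mpols_Var)

lemma dehom_pderiv:
  assumes "j \<noteq> i"
  shows "dehom i (pderiv_mpol j f) = pderiv_mpol j (dehom i f)"
  by (induction f rule: mpol_induct)
     (use assms in \<open>auto simp: dehom_Var pderiv_mpol_Var pderiv_mpol_add pderiv_mpol_mult\<close>)

lemma peval_dehom:
  assumes "a i = 1"
  shows "peval a (dehom i f) = peval a f"
  unfolding dehom_def peval_psubst
  by (rule arg_cong[where f = "\<lambda>b. peval b f"]) (use assms in auto)

lemma mono_eval_dehom: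
  "mono_eval (\<lambda>j. if j = i then 1 else Var j) m = single (m - single i (lookup m i)) 1"
proof -
  define m' where "m' = m - single i (lookup m i)"
  have m: "m = single i (lookup m i) + m'"
    by (simp add: m'_def single_add_minus)
  have "i \<notin> keys m'" by (simp add: m'_def in_keys_iff lookup_minus)
  then have "mono_eval (\<lambda>j. if j = i then 1 else Var j) m' = mono_eval Var m'"
    by (intro mono_eval_cong) auto
  moreover have "mono_eval (\<lambda>j. if j = i then 1 else Var j) m =
      mono_eval (\<lambda>j. if j = i then 1 else Var j) m'"
    by (subst m) (simp add: mono_eval_add)
  ultimately show ?thesis by (simp add: mono_eval_Var m'_def)
qed

text \<open>In a fixed degree the lost exponent of \<open>Var i\<close> can be recovered from the
  others, so different monomials remain different.\<close>

lemma dehom_inject: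
  assumes "g \<in> forms n k" "dehom i g = 0"
  shows "g = 0"
proof (rule ccontr)
  assume "g \<noteq> 0"
  then obtain m0 where m0: "m0 \<in> keys g" by (metis all_not_in_conv keys_eq_empty)
  define \<phi> where "\<phi> m = m - single i (lookup m i)" for m :: "nat \<Rightarrow>\<^sub>0 nat"
  have inj: "m = m0" if "m \<in> keys g" "\<phi> m = \<phi> m0" for m
  proof -
    have split: "m' = single i (lookup m' i) + \<phi> m'" for m' :: "nat \<Rightarrow>\<^sub>0 nat"
      by (simp add: \<phi>_def single_add_minus)
    have "mdeg m = k" "mdeg m0 = k" using that m0 assms(1) by (auto simp: forms_keys monoms_def)
    moreover have "mdeg m = lookup m i + mdeg (\<phi> m)" "mdeg m0 = lookup m0 i + mdeg (\<phi> m0)"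
      using arg_cong[OF split[of m], of mdeg] arg_cong[OF split[of m0], of mdeg] by simp_all
    ultimately have "lookup m i = lookup m0 i" using that(2) by simp
    then show ?thesis using split[of m] split[of m0] that(2) by simp
  qed
  have "dehom i g = (\<Sum>m\<in>keys g. Const (lookup g m) * single (\<phi> m) 1)"
    unfolding dehom_def psubst_gen_eval gen_eval_def mono_eval_dehom \<phi>_def ..
  then have "lookup (dehom i g) (\<phi> m0) = (\<Sum>m\<in>keys g. lookup g m * lookup (single (\<phi> m) 1) (\<phi> m0))"
    by (simp add: lookup_sum lookup_Const_mult)
  also have "\<dots> = (\<Sum>m\<in>keys g. if m = m0 then lookup g m0 else 0)"
    using inj by (intro sum.cong) (auto simp: lookup_single when_def)
  also have "\<dots> = lookup g m0" using m0 by simp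
  finally show False using m0 assms(2) by (simp add: in_keys_iff)
qed

text \<open>Single terms are forms already; in a sum the degrees are equalized by powers of
  \<open>Var i\<close>, which become 1.\<close>

lemma dehom_surj:
  assumes "i \<le> n" "q \<in> mpols ({..n} - {i})"
  shows "\<exists>e. \<exists>Q\<in>forms n e. dehom i Q = q"
proof (induction q rule: sum_single_induct)
  case (single m c)
  then have m: "keys m \<subseteq> {..n} - {i}" using assms(2) by (auto simp: mpols_def)
  have "mono_eval (\<lambda>j. if j = i then 1 else Var j) m = mono_eval Var m"
    using m by (intro mono_eval_cong) auto
  then have "dehom i (single m c) = single m c"
    by (simp add: dehom_def psubst_single mono_eval_Var single_Const[symmetric])
  moreover have "single m c \<in> forms n (mdeg m)"
    using m by (intro forms_single) (auto simp: monoms_def)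
  ultimately show ?case by blast
next
  case (add g h)
  then obtain e Q e' Q' where Q: "Q \<in> forms n e" "dehom i Q = g" "Q' \<in> forms n e'" "dehom i Q' = h" by blast
  have "Var i ^ e' * Q \<in> forms n (e' + e)" "Var i ^ e * Q' \<in> forms n (e + e')"
    using forms_mult[OF forms_power[OF forms_Var[OF assms(1)], of e'] Q(1)]
      forms_mult[OF forms_power[OF forms_Var[OF assms(1)], of e] Q(3)] by simp_all
  then have "Var i ^ e' * Q + Var i ^ e * Q' \<in> forms n (e + e')" by (simp add: forms_add add.commute)
  moreover have "dehom i (Var i ^ e' * Q + Var i ^ e * Q') = g + h" using Q by simp
  ultimately show ?case by blast
next
  case zero
  show ?case by (intro exI[of _ 0] bexI[of _ 0]) auto
qed

subsection \<open>The local rings\<close>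

definition cst :: "complex \<Rightarrow> nat mpol fract" where
  "cst c = Fract (Const c) 1"

context
  fixes V :: "nat set" and a :: "nat \<Rightarrow> complex"
begin

lemma local_ring_simps:
  "monoid.mult (local_ring V a) = (*)" "one (local_ring V a) = 1" "zero (local_ring V a) = 0"
  "add (local_ring V a) = (+)"
  by (simp_all add: local_ring_def)

lemma local_ring_carrier:
  "x \<in> carrier (local_ring V a) \<longleftrightarrow> (\<exists>r s. x = Fract r s \<and> r \<in> mpols V \<and> s \<in> mpols V \<and> peval a s \<noteq> 0)"
  by (auto simp: local_ring_def)

lemma peval_nonzero: "peval a s \<noteq> 0 \<Longrightarrow> s \<noteq> 0"
  by auto

lemma local_ring_add_closed:
  assumes "x \<in> carrier (local_ring V a)" "y \<in> carrier (local_ring V a)"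
  shows "x + y \<in> carrier (local_ring V a)"
proof -
  obtain r s r' s' where "x = Fract r s" "y = Fract r' s'" "r \<in> mpols V" "s \<in> mpols V" "r' \<in> mpols V"
      "s' \<in> mpols V" "peval a s \<noteq> 0" "peval a s' \<noteq> 0"
    using assms by (auto simp: local_ring_carrier)
  then have "x + y = Fract (r * s' + r' * s) (s * s')" "r * s' + r' * s \<in> mpols V" "s * s' \<in> mpols V"
      "peval a (s * s') \<noteq> 0"
    by (auto simp: peval_nonzero intro: mpols_add mpols_mult)
  then show ?thesis unfolding local_ring_carrier by blast
qed

lemma local_ring_mult_closed:
  assumes "x \<in> carrier (local_ring V a)" "y \<in> carrier (local_ring V a)"
  shows "x * y \<in> carrier (local_ring V a)"
proof -
  obtain r s r' s' where "x = Fract r s" "y = Fract r' s'" "r \<in> mpols V" "s \<in> mpols V" "r' \<in> mpols V"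
      "s' \<in> mpols V" "peval a s \<noteq> 0" "peval a s' \<noteq> 0"
    using assms by (auto simp: local_ring_carrier)
  then have "x * y = Fract (r * r') (s * s')" "r * r' \<in> mpols V" "s * s' \<in> mpols V"
      "peval a (s * s') \<noteq> 0"
    by (auto intro: mpols_mult)
  then show ?thesis unfolding local_ring_carrier by blast
qed

lemma local_ring_Fract1: "r \<in> mpols V \<Longrightarrow> Fract r 1 \<in> carrier (local_ring V a)"
  unfolding local_ring_carrier by (metis mpols_1 peval_1 zero_neq_one)

lemma local_ring_0: "0 \<in> carrier (local_ring V a)" and local_ring_1: "1 \<in> carrier (local_ring V a)"
  using local_ring_Fract1[of 0] local_ring_Fract1[of 1]
  by (simp_all add: Zero_fract_def One_fract_def)

lemma local_ring_uminus: "x \<in> carrier (local_ring V a) \<Longrightarrow> - x \<in> carrier (local_ring V a)"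
  using local_ring_mult_closed[OF local_ring_Fract1[of "-1"], of x]
  by (simp add: mpols_uminus One_fract_def[symmetric] flip: minus_fract)

lemma local_ring_cring: "cring (local_ring V a)"
proof (rule cringI)
  show "abelian_group (local_ring V a)"
  proof (rule abelian_groupI)
    fix x assume "x \<in> carrier (local_ring V a)"
    then show "\<exists>y\<in>carrier (local_ring V a). y \<oplus>\<^bsub>local_ring V a\<^esub> x = \<zero>\<^bsub>local_ring V a\<^esub>"
      using local_ring_uminus[of x] by (intro bexI[of _ "- x"]) (auto simp: local_ring_simps)
  qed (auto simp: local_ring_simps local_ring_add_closed local_ring_0)
  show "comm_monoid (local_ring V a)"
    by (rule comm_monoidI) (auto simp: local_ring_simps local_ring_mult_closed local_ring_1)
qed (auto simp: local_ring_simps distrib_right)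

interpretation R: cring "local_ring V a"
  by (rule local_ring_cring)

lemma local_ring_sum: "(\<And>i. i \<in> A \<Longrightarrow> g i \<in> carrier (local_ring V a)) \<Longrightarrow> sum g A \<in> carrier (local_ring V a)"
  by (induction A rule: infinite_finite_induct) (auto intro: local_ring_0 local_ring_add_closed)

lemma local_ring_minus:
  assumes "x \<in> carrier (local_ring V a)" "y \<in> carrier (local_ring V a)"
  shows "x \<ominus>\<^bsub>local_ring V a\<^esub> y = x - y"
proof -
  have "\<ominus>\<^bsub>local_ring V a\<^esub> y = - y"
    using R.minus_equality[of "- y" y] assms(2) local_ring_uminus by (simp add: local_ring_simps)
  then show ?thesis by (simp add: a_minus_def local_ring_simps)
qed

lemma local_ring_idealI:
  assumes sub: "X \<subseteq> carrier (local_ring V a)" and 0: "0 \<in> X"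
    and add: "\<And>x y. x \<in> X \<Longrightarrow> y \<in> X \<Longrightarrow> x + y \<in> X"
    and mult: "\<And>x y. x \<in> X \<Longrightarrow> y \<in> carrier (local_ring V a) \<Longrightarrow> y * x \<in> X"
  shows "ideal X (local_ring V a)"
proof (rule idealI[OF R.ring_axioms])
  show "subgroup X (add_monoid (local_ring V a))"
  proof (rule R.add.subgroupI)
    fix x assume x: "x \<in> X"
    then have "\<ominus>\<^bsub>local_ring V a\<^esub> x = - x"
      using R.minus_equality[of "- x" x] sub local_ring_uminus by (auto simp: local_ring_simps)
    moreover have "(- 1) * x \<in> X" using mult[OF x, of "-1"] local_ring_uminus[OF local_ring_1] by simp
    ultimately show "\<ominus>\<^bsub>local_ring V a\<^esub> x \<in> X" by simp
  qed (use sub 0 add in \<open>auto simp: local_ring_simps\<close>)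
qed (use mult in \<open>auto simp: local_ring_simps mult.commute\<close>)

lemma cst_carrier: "cst c \<in> carrier (local_ring V a)"
  unfolding cst_def by (rule local_ring_Fract1) simp

text \<open>The predicate \<open>ring.dimension\<close> builds a space by successive line
  extensions. The induction follows them and picks a representative in the local ring for every new
  vector.\<close>

lemma local_quotient_spanning:
  assumes J: "ideal J (local_ring V a)"
    and dim: "ring.dimension (local_ring V a Quot J) t {J +>\<^bsub>local_ring V a\<^esub> cst c | c. True} E"
  shows "\<exists>u. (\<forall>i<t. u i \<in> carrier (local_ring V a)) \<and>
    (\<forall>e\<in>E. \<exists>c. e = J +>\<^bsub>local_ring V a\<^esub> (\<Sum>i<t. cst (c i) * u i))"
  (is "?P t E")
proof -
  let ?R = "local_ring V a"
  interpret J: ideal J ?R by (rule J)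
  have ring: "ring (?R Quot J)" by (rule J.quotient_is_ring)
  have "K = {J +>\<^bsub>?R\<^esub> cst c | c. True} \<Longrightarrow> ?P t E"
    if "ring.dimension (?R Quot J) t K E" for K t E
    using that
  proof (induction rule: ring.dimension.induct[OF ring, consumes 1])
    case (1 K)
    have "J +>\<^bsub>?R\<^esub> 0 = J"
      using J.a_rcos_const[OF J.zero_closed] by (simp add: local_ring_simps)
    then show ?case by (auto simp: FactRing_def)
  next
    case (2 v E n K)
    obtain u where u: "\<forall>i<n. u i \<in> carrier ?R"
      "\<forall>e\<in>E. \<exists>c. e = J +>\<^bsub>?R\<^esub> (\<Sum>i<n. cst (c i) * u i)"
      using 2 by blast
    obtain x where x: "x \<in> carrier ?R" "v = J +>\<^bsub>?R\<^esub> x"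
      using 2(1) by (auto simp: FactRing_def A_RCOSETS_def')
    define u' where "u' i = (if i = n then x else u i)" for i
    have u': "\<forall>i<Suc n. u' i \<in> carrier ?R" using u(1) x(1) by (simp add: u'_def less_Suc_eq)
    have "\<exists>c. e = J +>\<^bsub>?R\<^esub> (\<Sum>i<Suc n. cst (c i) * u' i)"
      if e: "e \<in> ring.line_extension (?R Quot J) K v E" for e
    proof -
      obtain k e' where k: "k \<in> K" and e': "e' \<in> E"
        and ek: "e = (k \<otimes>\<^bsub>?R Quot J\<^esub> v) \<oplus>\<^bsub>?R Quot J\<^esub> e'"
        using e by (auto simp: ring.line_extension_def[OF ring] set_add_def' r_coset_def)
      obtain b where b: "k = J +>\<^bsub>?R\<^esub> cst b" using k 2(5) by auto
      obtain c where c: "e' = J +>\<^bsub>?R\<^esub> (\<Sum>i<n. cst (c i) * u i)" using u(2) e' by blast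
      have mem: "cst b * x \<in> carrier ?R" "(\<Sum>i<n. cst (c i) * u i) \<in> carrier ?R"
        using x(1) u(1) by (auto intro!: local_ring_mult_closed local_ring_sum cst_carrier)
      have "k \<otimes>\<^bsub>?R Quot J\<^esub> v = J +>\<^bsub>?R\<^esub> (cst b * x)"
        unfolding b x(2) using J.rcoset_mult_add[OF cst_carrier x(1)] by (simp add: FactRing_def local_ring_simps)
      then have "e = J +>\<^bsub>?R\<^esub> (cst b * x + (\<Sum>i<n. cst (c i) * u i))"
        unfolding ek c using J.a_rcos_sum[OF mem] by (simp add: FactRing_def local_ring_simps)
      also have "cst b * x + (\<Sum>i<n. cst (c i) * u i) = (\<Sum>i<Suc n. cst ((c(n := b)) i) * u' i)"
        by (simp add: u'_def add.commute)
      finally show ?thesis by blast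
    qed
    then show ?case using u' by blast
  qed
  then show ?thesis using dim by blast
qed

end

section \<open>Charts, and the local Tjurina ideals compared with the Jacobian ideal\<close>

lemma chart_props:
  assumes "p \<in> proj_space n"
  shows "chart p \<le> n" "\<And>v. v \<in> p \<Longrightarrow> v $ chart p \<noteq> 0"
proof -
  obtain v where v: "v \<in> p" by (rule proj_space_nonempty[OF assms])
  note mem = proj_space_mem[OF assms v]
  obtain i where i: "i \<le> n" "v $ i \<noteq> 0" using proj_space_coordinate[OF assms v] by auto
  have all: "\<forall>w\<in>p. w $ i \<noteq> 0"
  proof
    fix w assume "w \<in> p"
    then obtain c where "w = c \<cdot>\<^sub>v v" "c \<noteq> 0" using mem(3) by auto
    then show "w $ i \<noteq> 0" using i mem(1) by simp
  qed
  show "chart p \<le> n" unfolding chart_def using Least_le[of "\<lambda>i. \<forall>v\<in>p. v $ i \<noteq> 0", OF all] i(1) by simp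
  show "\<And>v. v \<in> p \<Longrightarrow> v $ chart p \<noteq> 0"
    unfolding chart_def using LeastI[of "\<lambda>i. \<forall>v\<in>p. v $ i \<noteq> 0", OF all] by blast
qed

lemma affine_point_props:
  assumes "p \<in> proj_space n"
  obtains w where "w \<in> p" "affine_point p = ($) w" "w $ chart p = 1"
proof -
  obtain v where v: "v \<in> p" by (rule proj_space_nonempty[OF assms])
  note mem = proj_space_mem[OF assms v] and ch = chart_props[OF assms]
  define w where "w = inverse (v $ chart p) \<cdot>\<^sub>v v"
  have w: "w \<in> p" "w $ chart p = 1"
    using ch(1) ch(2)[OF v] mem(1,3) by (auto simp: w_def intro!: exI[of _ "inverse (v $ chart p)"])
  have uniq: "w' = w" if w': "w' \<in> p" "w' $ chart p = 1" for w'
  proof -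
    obtain c where c: "w' = c \<cdot>\<^sub>v w" using w'(1) proj_space_mem(3)[OF assms w(1)] by auto
    have "c = 1" using c w'(2) w(2) proj_space_mem(1)[OF assms w(1)] ch(1) by simp
    then show ?thesis using c by simp
  qed
  have "(THE v. v \<in> p \<and> v $ chart p = 1) = w"
  proof (rule the_equality)
    show "w \<in> p \<and> w $ chart p = 1" using w by (rule conjI)
    show "w' = w" if "w' \<in> p \<and> w' $ chart p = 1" for w'
      using that by (intro uniq) (erule conjunct1, erule conjunct2)
  qed
  then have "affine_point p = ($) w" by (simp add: affine_point_def fun_eq_iff)
  then show ?thesis using that w by blast
qed

lemma homogenize_degree:
  assumes "i \<le> n" "F \<in> forms n e" "F' \<in> forms n e'"
  shows "Var i ^ e' * F \<in> forms n (e + e')" "Var i ^ e * F' \<in> forms n (e + e')"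
  using forms_mult[OF forms_power[OF forms_Var[OF assms(1)], of e'] assms(2)]
    forms_mult[OF forms_power[OF forms_Var[OF assms(1)], of e] assms(3)] by (simp_all add: add.commute)

text \<open>The Euler relation makes the local Tjurina ideal the dehomogenization of the Jacobian ideal.\<close>

lemma tjurina_ideal_dehom:
  assumes f: "f \<in> forms n d" "d > 0" and p: "p \<in> proj_space n" and i: "i = chart p"
    and R: "R = local_ring_at n p" and h: "h = local_equation f p"
    and g: "g \<in> forms n k"
    and gJ: "Fract (dehom i g) 1 \<in> Idl\<^bsub>R\<^esub> (insert (Fract h 1) {Fract (pderiv_mpol j h) 1 | j. j \<in> {..n} - {i}})"
  shows "\<exists>s\<in>mpols {..n}. (\<forall>v\<in>p. peval (\<lambda>i. v $ i) s \<noteq> 0) \<and> s * g \<in> jac_ideal n f"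
proof -
  let ?J = "jac_ideal n f"
  note id = jac_ideal_is_ideal[of n f]
  have i_le: "i \<le> n" using chart_props(1)[OF p] i by simp
  obtain w where w: "w \<in> p" "affine_point p = ($) w" "w $ i = 1"
    using affine_point_props[OF p] i by metis
  define V where "V = {..n} - {i}"
  have R: "R = local_ring V (($) w)" by (simp add: R local_ring_at_def V_def i w(2))
  have h: "h = dehom i f" by (simp add: h local_equation_def dehom_def i)
  \<comment> \<open>The dehomogenized forms of the Jacobian ideal. They form an ideal of the
    coordinate ring of the chart, and fractions with numerators in \<open>D\<close> will form an
    ideal containing the local Tjurina ideal.\<close>
  define D where "D = {r. \<exists>e. \<exists>F\<in>forms n e. F \<in> ?J \<and> r = dehom i F}"
  have D_mpols: "r \<in> mpols V" if "r \<in> D" for r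
    using that by (auto simp: D_def V_def forms_def intro: dehom_mpols)
  have D_add: "r + r' \<in> D" if rr: "r \<in> D" "r' \<in> D" for r r'
  proof -
    obtain e F e' F' where F: "F \<in> forms n e" "F \<in> ?J" "r = dehom i F" "F' \<in> forms n e'" "F' \<in> ?J" "r' = dehom i F'"
      using rr by (auto simp: D_def)
    have "Var i ^ e' * F + Var i ^ e * F' \<in> forms n (e + e')"
      using homogenize_degree[OF i_le F(1,4)] by (rule forms_add)
    moreover have "Var i ^ e' * F + Var i ^ e * F' \<in> ?J"
      using F by (intro is_ideal_add[OF id] is_ideal_mult[OF id])
    moreover have "r + r' = dehom i (Var i ^ e' * F + Var i ^ e * F')" by (simp add: F)
    ultimately show ?thesis unfolding D_def by blast
  qed
  have D_mult: "q * r \<in> D" if qr: "q \<in> mpols V" "r \<in> D" for q r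
  proof -
    obtain e F where F: "F \<in> forms n e" "F \<in> ?J" "r = dehom i F" using qr(2) by (auto simp: D_def)
    obtain e' Q where Q: "Q \<in> forms n e'" "dehom i Q = q"
      using dehom_surj[OF i_le] qr(1) unfolding V_def by blast
    have "Q * F \<in> forms n (e' + e)" "Q * F \<in> ?J" "q * r = dehom i (Q * F)"
      using forms_mult[OF Q(1) F(1)] is_ideal_mult[OF id F(2)] by (simp_all add: Q F)
    then show ?thesis unfolding D_def by blast
  qed
  have D_0: "0 \<in> D" unfolding D_def using is_ideal_0[OF id] by (auto intro!: exI[of _ 0] bexI[of _ 0])
  \<comment> \<open>The local equation belongs to \<open>D\<close> because the Euler relation puts
    \<open>f\<close> into the Jacobian ideal.\<close>
  have "h \<in> D"
  proof -
    have "of_nat d * f \<in> ?J"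
      unfolding Euler_mpol[OF f(1), symmetric]
      by (intro is_ideal_sum is_ideal_mult id pderiv_jac_ideal) auto
    then have "Const (inverse (of_nat d)) * (of_nat d * f) \<in> ?J" by (rule is_ideal_mult[OF id])
    moreover have "Const (inverse (of_nat d)) * (of_nat d * f) = f"
      using f(2) by (simp add: mult.assoc[symmetric] flip: Const_of_nat Const_mult)
    ultimately have "f \<in> ?J" by simp
    then show ?thesis unfolding D_def h using f(1) by blast
  qed
  moreover have "pderiv_mpol j h \<in> D" if j: "j \<in> V" for j
  proof -
    have "pderiv_mpol j f \<in> forms n (d - 1)" by (rule pderiv_mpol_forms[OF f(1)])
    moreover have "pderiv_mpol j f \<in> ?J" using j by (intro pderiv_jac_ideal) (auto simp: V_def)
    moreover have "pderiv_mpol j h = dehom i (pderiv_mpol j f)"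
      using dehom_pderiv[of j i f] j by (simp add: h V_def)
    ultimately show ?thesis unfolding D_def by blast
  qed
  ultimately have gens: "insert h {pderiv_mpol j h | j. j \<in> V} \<subseteq> D" by blast
  define X where "X = {Fract r s | r s. r \<in> D \<and> s \<in> mpols V \<and> peval (($) w) s \<noteq> 0}"
  have X1: "Fract r 1 \<in> X" if "r \<in> D" for r
    unfolding X_def by (rule CollectI, intro exI[of _ r] exI[of _ 1]) (use that in simp)
  have "ideal X R"
    unfolding R
  proof (rule local_ring_idealI)
    show "X \<subseteq> carrier (local_ring V (($) w))"
      unfolding X_def using D_mpols local_ring_carrier[of _ V "($) w"] by blast
    show "0 \<in> X" unfolding Zero_fract_def by (rule X1[OF D_0])
    show "x + y \<in> X" if xy: "x \<in> X" "y \<in> X" for x y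
    proof -
      obtain r s r' s' where rs: "x = Fract r s" "y = Fract r' s'" "r \<in> D" "s \<in> mpols V" "r' \<in> D"
          "s' \<in> mpols V" "peval (($) w) s \<noteq> 0" "peval (($) w) s' \<noteq> 0"
        using xy by (auto simp: X_def)
      have "s' * r + s * r' \<in> D" by (intro D_add D_mult rs)
      moreover have "x + y = Fract (s' * r + s * r') (s * s')"
        using rs peval_nonzero by (simp add: mult.commute)
      moreover have "s * s' \<in> mpols V" "peval (($) w) (s * s') \<noteq> 0"
        using rs by (auto intro: mpols_mult)
      ultimately show ?thesis unfolding X_def by blast
    qed
    show "y * x \<in> X" if xy: "x \<in> X" "y \<in> carrier (local_ring V (($) w))" for x y
    proof -
      obtain r s r' s' where "x = Fract r s" "y = Fract r' s'" "r \<in> D" "s \<in> mpols V" "r' \<in> mpols V"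
          "s' \<in> mpols V" "peval (($) w) s \<noteq> 0" "peval (($) w) s' \<noteq> 0"
        using xy by (auto simp: X_def local_ring_carrier)
      then have "y * x = Fract (r' * r) (s' * s)" "r' * r \<in> D" "s' * s \<in> mpols V"
          "peval (($) w) (s' * s) \<noteq> 0"
        by (auto intro: mpols_mult D_mult)
      then show ?thesis unfolding X_def by blast
    qed
  qed
  moreover have "insert (Fract h 1) {Fract (pderiv_mpol j h) 1 | j. j \<in> {..n} - {i}} \<subseteq> X"
    using X1 gens unfolding V_def by blast
  moreover have "ring R" unfolding R by (rule cring.axioms(1)[OF local_ring_cring])
  ultimately have "Fract (dehom i g) 1 \<in> X" using gJ ring.genideal_minimal by blast
  then obtain r s where rs: "Fract (dehom i g) 1 = Fract r s" "r \<in> D" "s \<in> mpols V" "peval (($) w) s \<noteq> 0"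
    by (auto simp: X_def)
  have gr: "dehom i g * s = r"
    using rs(1) peval_nonzero[OF rs(4)] by (simp add: eq_fract)
  obtain e F where F: "F \<in> forms n e" "F \<in> ?J" "r = dehom i F" using rs(2) by (auto simp: D_def)
  obtain l S where S: "S \<in> forms n l" "dehom i S = s"
    using dehom_surj[OF i_le] rs(3) unfolding V_def by blast
  have gS: "g * S \<in> forms n (k + l)" by (rule forms_mult[OF g S(1)])
  define A where "A = Var i ^ e * S"
  have A: "A \<in> forms n (e + l)"
    unfolding A_def using forms_mult[OF forms_power[OF forms_Var[OF i_le], of e] S(1)] by simp
  \<comment> \<open>Clearing the denominator gives an equation in the chart. Powers of
    \<open>Var i\<close> bring both sides to the same degree, where dehomogenization is injective;
    they do not vanish at \<open>p\<close>.\<close>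
  have "Var i ^ e * (g * S) - Var i ^ (k + l) * F = 0"
  proof (rule dehom_inject)
    show "Var i ^ e * (g * S) - Var i ^ (k + l) * F \<in> forms n (k + l + e)"
      by (intro forms_diff homogenize_degree[OF i_le gS F(1)])
    show "dehom i (Var i ^ e * (g * S) - Var i ^ (k + l) * F) = 0"
      using gr by (simp add: S F)
  qed
  then have "A * g = Var i ^ (k + l) * F" by (simp add: A_def algebra_simps)
  then have "A * g \<in> ?J" using is_ideal_mult[OF id F(2)] by simp
  moreover have "\<forall>v\<in>p. peval (\<lambda>i. v $ i) A \<noteq> 0"
  proof
    fix v assume v: "v \<in> p"
    have "peval (($) w) A \<noteq> 0"
      using rs(4) w(3) by (simp add: A_def S(2)[symmetric] peval_dehom)
    then show "peval (\<lambda>i. v $ i) A \<noteq> 0"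
      using peval_class[OF p A v w(1)] by blast
  qed
  ultimately show ?thesis using A by (auto simp: forms_def)
qed

text \<open>The infimum of the empty set is infinite, so a finite value comes from a nonempty set
  and is attained.\<close>

lemma quot_dim_finite:
  assumes "quot_dim R J = enat t"
  shows "ring.dimension (R Quot J) t {J +>\<^bsub>R\<^esub> Fract (Const c) 1 | c. True} (carrier (R Quot J))"
proof -
  let ?A = "{enat k | k. ring.dimension (R Quot J) k {J +>\<^bsub>R\<^esub> Fract (Const c) 1 | c. True} (carrier (R Quot J))}"
  have "?A \<noteq> {}"
  proof
    assume "?A = {}"
    then have "quot_dim R J = Inf {}" unfolding quot_dim_def by (rule arg_cong)
    then show False using assms by (simp add: top_enat_def)
  qed
  then obtain x where "x \<in> ?A" by blast
  then have "Inf ?A \<in> ?A" by (rule wellorder_InfI)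
  then show ?thesis using assms unfolding quot_dim_def by auto
qed

text \<open>\<open>c g\<close> lists coefficients of the germ of \<open>g\<close> with respect to
  \<open>t\<close> elements spanning the Tjurina algebra at \<open>p\<close>. They are merely chosen
  for each \<open>g\<close> and need not depend linearly on it; the statement is therefore about
  linear combinations of chosen coefficients, whose vanishing still puts the combined germ into the
  local ideal.\<close>

lemma tjurina_coordinates:
  assumes f: "f \<in> forms n d" "d > 0" and p: "p \<in> proj_space n" and t: "tjurina_at n f p = enat t"
  shows "\<exists>c. \<forall>(b :: nat \<Rightarrow> complex) g N k. (\<forall>j<N. g j \<in> forms n k) \<longrightarrow> (\<forall>i<t. (\<Sum>j<N. b j * c (g j) i) = 0) \<longrightarrow>
    (\<exists>s\<in>mpols {..n}. (\<forall>v\<in>p. peval (\<lambda>i. v $ i) s \<noteq> 0) \<and> s * (\<Sum>j<N. Const (b j) * g j) \<in> jac_ideal n f)"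
proof -
  define i where "i = chart p"
  define V where "V = {..n} - {i}"
  define R where "R = local_ring V (affine_point p)"
  define h where "h = local_equation f p"
  define G where "G = insert (Fract h 1) {Fract (pderiv_mpol j h) 1 | j. j \<in> V}"
  define J where "J = Idl\<^bsub>R\<^esub> G"
  have Rat: "R = local_ring_at n p" by (simp add: R_def local_ring_at_def V_def i_def)
  interpret R: cring R unfolding R_def by (rule local_ring_cring)
  have i_le: "i \<le> n" using chart_props(1)[OF p] by (simp add: i_def)
  have hV: "h \<in> mpols V"
    using dehom_mpols[of f n i] f(1) by (simp add: h_def local_equation_def dehom_def V_def i_def forms_def)
  have dV: "pderiv_mpol j h \<in> mpols V" if "j \<in> V" for j
  proof -
    have "pderiv_mpol j f \<in> forms n (d - 1)" by (rule pderiv_mpol_forms[OF f(1)])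
    then have "dehom i (pderiv_mpol j f) \<in> mpols V" unfolding V_def by (intro dehom_mpols) (simp add: forms_def)
    moreover have "dehom i (pderiv_mpol j f) = pderiv_mpol j h"
      using dehom_pderiv[of j i f] that by (simp add: h_def V_def local_equation_def dehom_def i_def)
    ultimately show ?thesis by simp
  qed
  have "G \<subseteq> carrier R" unfolding G_def R_def using hV dV by (auto intro: local_ring_Fract1)
  then have J: "ideal J R" unfolding J_def by (rule R.genideal_ideal)
  have "quot_dim R J = enat t"
    using t by (simp add: tjurina_at_def Let_def Rat[symmetric] h_def[symmetric] J_def G_def V_def i_def)
  from quot_dim_finite[OF this] have dim: "ring.dimension (R Quot J) t {J +>\<^bsub>R\<^esub> cst c | c. True} (carrier (R Quot J))"
    by (simp add: cst_def)
  obtain u where u: "\<forall>i<t. u i \<in> carrier R"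
    "\<forall>e\<in>carrier (R Quot J). \<exists>c. e = J +>\<^bsub>R\<^esub> (\<Sum>i<t. cst (c i) * u i)"
    using local_quotient_spanning[of J V "affine_point p" t "carrier (R Quot J)"] J dim unfolding R_def by blast
  let ?F = "\<lambda>g. Fract (dehom i g) 1"
  have Fcarr: "?F g \<in> carrier R" if "g \<in> mpols {..n}" for g
    unfolding R_def V_def using that by (intro local_ring_Fract1 dehom_mpols)
  have "\<exists>c. ?F g - (\<Sum>i<t. cst (c i) * u i) \<in> J" if g: "g \<in> mpols {..n}" for g
  proof -
    have "J +>\<^bsub>R\<^esub> ?F g \<in> carrier (R Quot J)" using Fcarr[OF g] by (auto simp: FactRing_def A_RCOSETS_def')
    then obtain c where c: "J +>\<^bsub>R\<^esub> ?F g = J +>\<^bsub>R\<^esub> (\<Sum>i<t. cst (c i) * u i)" using u(2) by blast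
    have s: "(\<Sum>i<t. cst (c i) * u i) \<in> carrier R"
      using u(1) unfolding R_def by (auto intro!: local_ring_mult_closed local_ring_sum cst_carrier)
    have "?F g \<ominus>\<^bsub>R\<^esub> (\<Sum>i<t. cst (c i) * u i) \<in> J"
      using R.quotient_eq_iff_same_a_r_cos[OF J Fcarr[OF g] s] c by simp
    moreover have "?F g \<ominus>\<^bsub>R\<^esub> (\<Sum>i<t. cst (c i) * u i) = ?F g - (\<Sum>i<t. cst (c i) * u i)"
      using Fcarr[OF g] s unfolding R_def by (rule local_ring_minus)
    ultimately have "?F g - (\<Sum>i<t. cst (c i) * u i) \<in> J" by simp
    then show ?thesis by (rule exI[of _ c])
  qed
  then have "\<forall>g\<in>mpols {..n}. \<exists>c. ?F g - (\<Sum>i<t. cst (c i) * u i) \<in> J" by blast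
  from bchoice[OF this] obtain c where
    c: "\<forall>g\<in>mpols {..n}. ?F g - (\<Sum>i<t. cst (c g i) * u i) \<in> J" by (rule exE)
  interpret J: ideal J R by (rule J)
  have J_add: "x + y \<in> J" if "x \<in> J" "y \<in> J" for x y
    using J.a_closed[OF that] by (simp add: R_def local_ring_simps)
  have J_0: "0 \<in> J" using J.zero_closed by (simp add: R_def local_ring_simps)
  have J_cst: "cst b * x \<in> J" if "x \<in> J" for b x
    using J.I_l_closed[OF that, of "cst b"] cst_carrier by (simp add: R_def local_ring_simps)
  have J_sum: "sum x A \<in> J" if "\<And>a. a \<in> A \<Longrightarrow> x a \<in> J" for x and A :: "nat set"
    using that by (induction A rule: infinite_finite_induct) (auto intro: J_add J_0)
  have cst_add: "cst (a + b) = cst a + cst b" and cst_mult: "cst (a * b) = cst a * cst b" and cst_0: "cst 0 = 0" for a b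
    by (simp_all add: cst_def Const_add Const_mult Zero_fract_def)
  have cst_sum: "cst (\<Sum>j\<in>A. x j) = (\<Sum>j\<in>A. cst (x j))" for x and A :: "nat set"
    by (induction A rule: infinite_finite_induct) (auto simp: cst_add cst_0)
  have F_lin: "?F (\<Sum>j<N. Const (b j) * g j) = (\<Sum>j<N. cst (b j) * ?F (g j))" for b :: "nat \<Rightarrow> complex" and g N
  proof (induction N)
    case (Suc N)
    have "?F (x + y) = ?F x + ?F y" for x y :: "nat mpol" by simp
    then have "?F (\<Sum>j<Suc N. Const (b j) * g j) = ?F (\<Sum>j<N. Const (b j) * g j) + ?F (Const (b N) * g N)"
      unfolding sum.lessThan_Suc by blast
    also have "?F (Const (b N) * g N) = cst (b N) * ?F (g N)" by (simp add: cst_def)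
    finally show ?case unfolding Suc sum.lessThan_Suc .
  qed (simp add: Zero_fract_def)
  show ?thesis
  proof (intro exI[of _ c] allI impI)
    fix b :: "nat \<Rightarrow> complex" and g :: "nat \<Rightarrow> nat mpol" and N k :: nat
    assume g: "\<forall>j<N. g j \<in> forms n k" and b: "\<forall>i<t. (\<Sum>j<N. b j * c (g j) i) = 0"
    have "(\<Sum>j<N. cst (b j) * (?F (g j) - (\<Sum>i<t. cst (c (g j) i) * u i))) \<in> J"
      using c g by (intro J_sum J_cst) (auto simp: forms_def)
    also have "(\<Sum>j<N. cst (b j) * (?F (g j) - (\<Sum>i<t. cst (c (g j) i) * u i))) =
        ?F (\<Sum>j<N. Const (b j) * g j) - (\<Sum>i<t. (\<Sum>j<N. cst (b j * c (g j) i)) * u i)"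
      unfolding F_lin sum_distrib_right right_diff_distrib sum_subtractf sum_distrib_left
      by (subst sum.swap[of _ "{..<t}"]) (simp add: cst_mult mult.assoc)
    also have "(\<Sum>i<t. (\<Sum>j<N. cst (b j * c (g j) i)) * u i) = 0"
      using b by (simp add: cst_0 flip: cst_sum)
    finally have "?F (\<Sum>j<N. Const (b j) * g j) \<in> J" by simp
    then show "\<exists>s\<in>mpols {..n}. (\<forall>v\<in>p. peval (\<lambda>i. v $ i) s \<noteq> 0) \<and> s * (\<Sum>j<N. Const (b j) * g j) \<in> jac_ideal n f"
      using tjurina_ideal_dehom[OF f p i_def Rat h_def, of "\<Sum>j<N. Const (b j) * g j" k] g
      by (auto simp: J_def G_def V_def intro!: forms_sum forms_Const_mult)
  qed
qed

subsection \<open>A lower bound for the total Tjurina number\<close>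

text \<open>The columns are encoded as linear forms in \<open>T\<close> variables, so
  \<open>B > T\<close> of them are dependent.\<close>

lemma underdetermined_system:
  fixes L :: "nat \<Rightarrow> nat \<Rightarrow> complex"
  assumes "T < B"
  obtains b where "\<exists>j<B. b j \<noteq> 0" "\<forall>i<T. (\<Sum>j<B. b j * L i j) = 0"
proof -
  define v :: "nat \<Rightarrow> nat mpol" where "v j = (\<Sum>i<T. Const (L i j) * Var i)" for j
  have "\<not> (inj_on v {..<B} \<and> mpolv.independent (v ` {..<B}))"
  proof
    assume *: "inj_on v {..<B} \<and> mpolv.independent (v ` {..<B})"
    have "v ` {..<B} \<subseteq> mpolv.span (Var ` {..<T})"
      unfolding v_def by (auto intro!: mpolv.span_sum mpolv_span_scale[OF mpolv.span_base])
    then have "card (v ` {..<B}) \<le> card (Var ` {..<T} :: nat mpol set)"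
      using mpolv.independent_span_bound[of "Var ` {..<T}" "v ` {..<B}"] * by simp
    also have "\<dots> \<le> T" using card_image_le[of "{..<T}" Var] by simp
    finally show False using * assms by (simp add: card_image)
  qed
  then obtain b j where b: "(\<Sum>j<B. cscale (b j) (v j)) = 0" "j < B" "b j \<noteq> 0"
    using mpolv.family_independent[where N = B and v = v] by blast
  have "(\<Sum>j<B. b j * L i j) = 0" if "i < T" for i
  proof -
    have "lookup (v j) (single i 1) = L i j" for j
    proof -
      have "lookup (v j) (single i 1) = (\<Sum>i'<T. if i' = i then L i j else 0)"
        unfolding v_def lookup_sum lookup_Const_mult
        by (intro sum.cong) (auto simp: Var_def lookup_single when_def dest!: arg_cong[of _ _ "\<lambda>m. lookup m i"])
      then show ?thesis using that by simp
    qed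
    then have "lookup (\<Sum>j<B. cscale (b j) (v j)) (single i 1) = (\<Sum>j<B. b j * L i j)"
      by (simp add: lookup_sum cscale_eq lookup_Const_mult)
    then show ?thesis using b(1) by simp
  qed
  then show ?thesis using that[of b] b(2,3) by blast
qed

text \<open>Taking the degree \<open>k\<close> component of a representation replaces its
  coefficients by forms.\<close>

lemma jac_ideal_forms:
  assumes "f \<in> forms n d" "d - 1 \<le> k" "g \<in> forms n k" "g \<in> jac_ideal n f"
  shows "g \<in> ideal_part n (d - 1) k {..n} (\<lambda>j. pderiv_mpol j f)"
proof -
  obtain q where q: "g = (\<Sum>j\<le>n. q j * pderiv_mpol j f)" using assms(4) by (auto simp: jac_ideal_def)
  have "g = form_part n k g" using assms(3) by (simp add: form_part_id)
  also have "\<dots> = (\<Sum>j\<le>n. form_part n k (q j * pderiv_mpol j f))" unfolding q form_part_sum ..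
  also have "\<dots> = (\<Sum>j\<le>n. pderiv_mpol j f * form_part n (k - (d - 1)) (q j))"
    using form_part_mult[OF pderiv_mpol_forms[OF assms(1)] assms(2)] by (simp add: mult.commute)
  also have "\<dots> \<in> ideal_part n (d - 1) k {..n} (\<lambda>j. pderiv_mpol j f)"
  proof (rule mpolv.subspace_sum[OF ideal_part_subspace])
    fix j assume "j \<in> {..n}"
    then show "pderiv_mpol j f * form_part n (k - (d - 1)) (q j) \<in> ideal_part n (d - 1) k {..n} (\<lambda>j. pderiv_mpol j f)"
      using ideal_part_mult[of j "{..n}" "form_part n (k - (d - 1)) (q j)" n k "d - 1" "\<lambda>j. pderiv_mpol j f"]
      by (simp add: form_part_forms)
  qed
  finally show ?thesis .
qed

text \<open>The \<open>g j\<close> are taken from the part of a basis of the forms of degree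
  \<open>k\<close> that lies outside a basis of \<open>U\<close>.\<close>

lemma independent_modulo:
  assumes U: "mpolv.subspace U" "U \<subseteq> forms n k" and dim: "mpolv.dim U + B \<le> card (monoms n k)"
  obtains g where "\<forall>j<B. g j \<in> forms n k"
    "\<forall>b. (\<Sum>j<B. Const (b j) * g j) \<in> U \<longrightarrow> (\<forall>j<B. b j = 0)"
proof -
  obtain C where C: "C \<subseteq> U" "mpolv.independent C" "U \<subseteq> mpolv.span C" "card C = mpolv.dim U"
    by (rule mpolv.basis_exists)
  have "C \<subseteq> forms n k" using C(1) U(2) by simp
  obtain D where D: "C \<subseteq> D" "D \<subseteq> forms n k" "mpolv.independent D" "forms n k \<subseteq> mpolv.span D"
    by (rule mpolv.maximal_independent_subset_extend[OF \<open>C \<subseteq> forms n k\<close> C(2)])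
  have finD: "finite D" using finite_independent_forms D by blast
  have "card D = card (monoms n k)"
    using mpolv.basis_card_eq_dim[OF D(2,4,3)] by (simp add: dim_forms)
  then have "B \<le> card (D - C)"
    using dim C(4) D(1) finD finite_subset[OF D(1) finD] by (simp add: card_Diff_subset)
  then obtain S where S: "S \<subseteq> D - C" "card S = B" "finite S" by (rule obtain_subset_with_card_n)
  obtain g where g: "bij_betw g {..<B} S"
    using ex_bij_betw_nat_finite[OF S(3)] S(2) by (auto simp: lessThan_atLeast0)
  have gS: "g j \<in> S" if "j < B" for j using g that by (auto simp: bij_betw_def)
  have "b j = 0" if b: "(\<Sum>j<B. Const (b j) * g j) \<in> U" and j: "j < B" for b j
  proof -
    have finC: "finite C" using finite_subset[OF D(1) finD] .
    obtain c where c: "(\<Sum>j<B. Const (b j) * g j) = (\<Sum>v\<in>C. cscale (c v) v)"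
      using b C(3) mpolv.span_finite[OF finC] by auto
    \<comment> \<open>The combination of the \<open>g j\<close> and the negative of its expansion in
      \<open>C\<close> are joined to one relation among members of the basis
      \<open>D\<close>.\<close>
    define u where "u v = (if v \<in> C then - c v else b (inv_into {..<B} g v))" for v
    have "(\<Sum>v\<in>S. cscale (u v) v) = (\<Sum>j<B. cscale (u (g j)) (g j))"
      by (rule sum.reindex_bij_betw[OF g, symmetric])
    also have "\<dots> = (\<Sum>j<B. Const (b j) * g j)"
    proof (intro sum.cong refl)
      fix j assume "j \<in> {..<B}"
      then have "g j \<notin> C" "inv_into {..<B} g (g j) = j"
        using gS[of j] S(1) g by (auto simp: bij_betw_def)
      then show "cscale (u (g j)) (g j) = Const (b j) * g j" by (simp add: u_def cscale_eq)
    qed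
    finally have "(\<Sum>v\<in>S. cscale (u v) v) = (\<Sum>v\<in>C. cscale (c v) v)" using c by simp
    moreover have "(\<Sum>v\<in>C. cscale (u v) v) = - (\<Sum>v\<in>C. cscale (c v) v)"
      unfolding sum_negf[symmetric] by (intro sum.cong) (auto simp: u_def cscale_eq Const_uminus)
    moreover have "(\<Sum>v\<in>C \<union> S. cscale (u v) v) = (\<Sum>v\<in>C. cscale (u v) v) + (\<Sum>v\<in>S. cscale (u v) v)"
      using S finC by (intro sum.union_disjoint) auto
    ultimately have "(\<Sum>v\<in>C \<union> S. cscale (u v) v) = 0" by simp
    moreover have "g j \<in> C \<union> S" using gS[OF j] by simp
    ultimately have "u (g j) = 0"
      using mpolv.independentD[OF D(3), of "C \<union> S" u "g j"] finC S D(1) by auto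
    moreover have "g j \<notin> C" "inv_into {..<B} g (g j) = j"
      using gS[OF j] S(1) g j by (auto simp: bij_betw_def)
    ultimately show ?thesis by (simp add: u_def)
  qed
  moreover have "\<forall>j<B. g j \<in> forms n k" using gS S(1) D(2) by blast
  ultimately show ?thesis using that by blast
qed

text \<open>If the total were below \<open>B\<close>, fewer than \<open>B\<close> linear conditions
  would suffice to make a combination of \<open>B\<close> forms, independent modulo the Jacobian
  ideal in degree \<open>k\<close>, vanish in every local Tjurina algebra. Such a form is torsion,
  hence in the ideal after all.\<close>

lemma tjurina_lower_bound:
  assumes n: "n \<ge> 1" and d: "d \<ge> 2" and f: "f \<in> forms n d"
    and iso: "at_most_isolated_singularities n f"
    and l: "\<And>i. i \<le> n \<Longrightarrow> l i \<in> forms n 1" "\<exists>i\<le>n. l i \<noteq> 0"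
    and syz: "(\<Sum>i\<le>n. l i * pderiv_mpol i f) = 0"
  shows "enat ((d - 2) * (d - 1) ^ (n - 1)) \<le> tjurina n f"
proof (rule ccontr)
  define B where "B = (d - 2) * (d - 1) ^ (n - 1)"
  assume "\<not> ?thesis"
  then have lt: "tjurina n f < enat B" by (simp add: B_def)
  have d0: "d > 0" using d by simp
  define m where "m = d - 1"
  have m: "m \<ge> 1" "d = Suc m" using d by (auto simp: m_def)
  note fin = finite_sing_points[OF f d0 iso]
  \<comment> \<open>A single infinite local number would make the whole sum infinite.\<close>
  have "\<exists>t. tjurina_at n f p = enat t" if "p \<in> sing_points n f" for p
  proof -
    have "tjurina_at n f p \<le> tjurina n f"
      unfolding tjurina_def using fin that by (intro member_le_sum) auto
    then have "tjurina_at n f p < enat B" using lt by (rule order.strict_trans1)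
    then show ?thesis by (cases "tjurina_at n f p") auto
  qed
  then have "\<forall>p\<in>sing_points n f. \<exists>t. tjurina_at n f p = enat t" by blast
  from bchoice[OF this] obtain t where t: "\<forall>p\<in>sing_points n f. tjurina_at n f p = enat (t p)" by (rule exE)
  have "enat (\<Sum>p\<in>sing_points n f. t p) = (\<Sum>p\<in>sing_points n f. enat (t p))"
    using fin by induction (auto simp: zero_enat_def simp flip: plus_enat_simps(1))
  also have "\<dots> = tjurina n f" unfolding tjurina_def using t by (intro sum.cong) auto
  finally have tB: "(\<Sum>p\<in>sing_points n f. t p) < B" using lt by (metis enat_ord_simps(2))
  obtain k where k: "k \<ge> n * m + 2 * m"
    and sat: "\<forall>g\<in>forms n k. (\<exists>N. \<forall>i\<le>n. Var i ^ N * g \<in> jac_ideal n f) \<longrightarrow> g \<in> jac_ideal n f"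
    using jac_ideal_saturated[of "n * m + 2 * m" n f] by blast
  define U where "U = ideal_part n m k {..n} (\<lambda>j. pderiv_mpol j f)"
  have pd: "pderiv_mpol j f \<in> forms n m" for j unfolding m_def by (rule pderiv_mpol_forms[OF f])
  have "mpolv.dim U + m ^ n \<le> card (monoms n k) + m ^ (n - 1)"
    unfolding U_def by (rule dim_ideal_part_syzygy[OF n m(1) l pd syz k])
  moreover have "m ^ n = B + m ^ (n - 1)"
  proof -
    obtain n' where n': "n = Suc n'" using n by (cases n) auto
    obtain m' where m': "m = Suc m'" using m(1) by (cases m) auto
    show ?thesis using m(2) by (simp add: B_def n' m')
  qed
  ultimately have dimU: "mpolv.dim U + B \<le> card (monoms n k)" by simp
  have UF: "U \<subseteq> forms n k" unfolding U_def using pd k by (intro ideal_part_forms) auto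
  have "mpolv.subspace U" by (simp add: U_def)
  then obtain g where g: "\<forall>j<B. g j \<in> forms n k"
    "\<forall>b. (\<Sum>j<B. Const (b j) * g j) \<in> U \<longrightarrow> (\<forall>j<B. b j = 0)"
    by (rule independent_modulo[OF _ UF dimU])
  have ps: "p \<in> proj_space n" if "p \<in> sing_points n f" for p using that by (simp add: sing_points_def)
  have "\<forall>p\<in>sing_points n f. \<exists>c. \<forall>(b :: nat \<Rightarrow> complex) g N k. (\<forall>j<N. g j \<in> forms n k) \<longrightarrow>
      (\<forall>i<t p. (\<Sum>j<N. b j * c (g j) i) = 0) \<longrightarrow>
      (\<exists>s\<in>mpols {..n}. (\<forall>v\<in>p. peval (\<lambda>i. v $ i) s \<noteq> 0) \<and> s * (\<Sum>j<N. Const (b j) * g j) \<in> jac_ideal n f)"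
    using tjurina_coordinates[OF f d0 ps] t by blast
  from bchoice[OF this] obtain c where c: "\<forall>p\<in>sing_points n f. \<forall>(b :: nat \<Rightarrow> complex) g N k. (\<forall>j<N. g j \<in> forms n k) \<longrightarrow>
      (\<forall>i<t p. (\<Sum>j<N. b j * c p (g j) i) = 0) \<longrightarrow>
      (\<exists>s\<in>mpols {..n}. (\<forall>v\<in>p. peval (\<lambda>i. v $ i) s \<noteq> 0) \<and> s * (\<Sum>j<N. Const (b j) * g j) \<in> jac_ideal n f)"
    by (rule exE)
  define T where "T = (\<Sum>p\<in>sing_points n f. t p)"
  \<comment> \<open>One equation for every singular point and each of its local coordinates.\<close>
  define Eq where "Eq = Sigma (sing_points n f) (\<lambda>p. {..<t p})"
  have "card Eq = T" using fin by (simp add: Eq_def T_def)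
  moreover have "finite Eq" using fin by (simp add: Eq_def)
  ultimately obtain e where e: "bij_betw e {..<T} Eq"
    using ex_bij_betw_nat_finite[of Eq] by (auto simp: lessThan_atLeast0)
  define L where "L r j = c (fst (e r)) (g j) (snd (e r))" for r j
  obtain b where b: "\<exists>j<B. b j \<noteq> 0" "\<forall>r<T. (\<Sum>j<B. b j * L r j) = 0"
    by (rule underdetermined_system[OF tB[folded T_def]])
  define G where "G = (\<Sum>j<B. Const (b j) * g j)"
  have G: "G \<in> forms n k" unfolding G_def using g(1) by (intro forms_sum forms_Const_mult) auto
  have "\<exists>s. s \<in> mpols {..n} \<and> (\<forall>v\<in>p. peval (\<lambda>i. v $ i) s \<noteq> 0) \<and> s * G \<in> jac_ideal n f"
    if p: "p \<in> sing_points n f" for p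
  proof -
    have "(\<Sum>j<B. b j * c p (g j) i) = 0" if "i < t p" for i
    proof -
      have "(p, i) \<in> e ` {..<T}" using e p that by (auto simp: bij_betw_def Eq_def)
      then obtain r where "r < T" "e r = (p, i)" by force
      then show ?thesis using b(2) by (auto simp: L_def)
    qed
    then show ?thesis using c p g(1) unfolding G_def by blast
  qed
  from jac_ideal_torsion[OF f d0 this] have "\<exists>N. \<forall>i\<le>n. Var i ^ N * G \<in> jac_ideal n f" by blast
  then have "G \<in> jac_ideal n f" using sat G by blast
  then have "G \<in> U" unfolding U_def m_def using k m(2) by (intro jac_ideal_forms[OF f] G) auto
  then show False using g(2) b(1) unfolding G_def by blast
qed

subsection \<open>Polynomial functions of the entries of a matrix\<close>

text \<open>Polynomial functions instead of polynomials, so that determinants and matrix products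
  can be formed pointwise. The degree is kept because the open sets generating
  \<open>zariski_PGL\<close> come from homogeneous polynomials.\<close>

definition hpoly :: "'v set \<Rightarrow> nat \<Rightarrow> (('v \<Rightarrow> complex) \<Rightarrow> complex) \<Rightarrow> bool" where
  "hpoly V e F \<longleftrightarrow> (\<exists>q\<in>mpols V. homogeneous e q \<and> (\<forall>c. peval c q = F c))"

lemma hpoly_0: "hpoly V e (\<lambda>c. 0)"
  unfolding hpoly_def by (rule bexI[of _ 0]) auto

lemma hpoly_const: "hpoly V 0 (\<lambda>c. a)"
  unfolding hpoly_def by (rule bexI[of _ "Const a"]) auto

lemma hpoly_var: "v \<in> V \<Longrightarrow> hpoly V 1 (\<lambda>c. c v)"
  unfolding hpoly_def using homogeneous_Var by (intro bexI[of _ "Var v"]) (auto intro: mpols_Var)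

lemma hpoly_add: "hpoly V e F \<Longrightarrow> hpoly V e G \<Longrightarrow> hpoly V e (\<lambda>c. F c + G c)"
  unfolding hpoly_def
proof (elim bexE conjE)
  fix q r assume "q \<in> mpols V" "homogeneous e q" "\<forall>c. peval c q = F c"
    "r \<in> mpols V" "homogeneous e r" "\<forall>c. peval c r = G c"
  then show "\<exists>q\<in>mpols V. homogeneous e q \<and> (\<forall>c. peval c q = F c + G c)"
    by (intro bexI[of _ "q + r"]) (auto intro: homogeneous_add mpols_add)
qed

lemma hpoly_mult: "hpoly V e F \<Longrightarrow> hpoly V e' G \<Longrightarrow> hpoly V (e + e') (\<lambda>c. F c * G c)"
  unfolding hpoly_def
proof (elim bexE conjE)
  fix q r assume "q \<in> mpols V" "homogeneous e q" "\<forall>c. peval c q = F c"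
    "r \<in> mpols V" "homogeneous e' r" "\<forall>c. peval c r = G c"
  then show "\<exists>q\<in>mpols V. homogeneous (e + e') q \<and> (\<forall>c. peval c q = F c * G c)"
    by (intro bexI[of _ "q * r"]) (auto intro: homogeneous_mult mpols_mult)
qed

lemma hpoly_cmult: "hpoly V e F \<Longrightarrow> hpoly V e (\<lambda>c. a * F c)"
  using hpoly_mult[OF hpoly_const] by fastforce

lemma hpoly_sum: "(\<And>i. i \<in> A \<Longrightarrow> hpoly V e (F i)) \<Longrightarrow> hpoly V e (\<lambda>c. \<Sum>i\<in>A. F i c)"
  by (induction A rule: infinite_finite_induct) (auto intro: hpoly_0 hpoly_add)

lemma hpoly_power: "hpoly V e F \<Longrightarrow> hpoly V (k * e) (\<lambda>c. F c ^ k)"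
  by (induction k) (auto intro: hpoly_const hpoly_mult)

lemma hpoly_prod: "finite A \<Longrightarrow> (\<And>i. i \<in> A \<Longrightarrow> hpoly V e (F i)) \<Longrightarrow> hpoly V (card A * e) (\<lambda>c. \<Prod>i\<in>A. F i c)"
  by (induction A rule: finite_induct) (auto intro: hpoly_const hpoly_mult)

lemma hpoly_det:
  assumes "\<And>i j. i < M \<Longrightarrow> j < M \<Longrightarrow> hpoly V e (F i j)"
  shows "hpoly V (M * e) (\<lambda>c. Determinant.det (mat M M (\<lambda>(i, j). F i j c)))"
proof -
  have *: "hpoly V (M * e) (\<lambda>c. \<Sum>p\<in>{p. p permutes {0..<M}}. signof p * (\<Prod>i = 0..<M. F i (p i) c))"
  proof (intro hpoly_sum hpoly_cmult)
    fix p assume "p \<in> {p. p permutes {0..<M}}"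
    then have "p i < M" if "i < M" for i using that permutes_in_image[of p "{0..<M}" i] by auto
    then show "hpoly V (M * e) (\<lambda>c. \<Prod>i = 0..<M. F i (p i) c)"
      using hpoly_prod[of "{0..<M}" V e "\<lambda>i. F i (p i)"] assms by simp
  qed
  have eq: "(\<lambda>c. \<Sum>p\<in>{p. p permutes {0..<M}}. signof p * (\<Prod>i = 0..<M. F i (p i) c)) =
      (\<lambda>c. Determinant.det (mat M M (\<lambda>(i, j). F i j c)))"
    by (rule ext, subst det_def'[of _ M]) (auto intro!: sum.cong prod.cong simp: permutes_in_image)
  show ?thesis using * unfolding eq .
qed

text \<open>The values of \<open>b\<close> are prescribed on \<open>V\<close> only, since matrix
  entries outside the dimensions are unspecified.\<close>

lemma hpoly_subst:
  assumes F: "hpoly V e F" and L: "\<And>v. v \<in> V \<Longrightarrow> hpoly W 1 (L v)"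
  shows "\<exists>G. hpoly W e G \<and> (\<forall>c b. (\<forall>v\<in>V. b v = L v c) \<longrightarrow> G c = F b)"
proof -
  obtain q where q: "q \<in> mpols V" "homogeneous e q" "\<And>c. peval c q = F c"
    using F by (auto simp: hpoly_def)
  have "\<forall>v\<in>V. \<exists>r. r \<in> mpols W \<and> homogeneous 1 r \<and> (\<forall>c. peval c r = L v c)"
    by (rule ballI) (rule L[unfolded hpoly_def Bex_def])
  from bchoice[of V "\<lambda>v r. r \<in> mpols W \<and> homogeneous 1 r \<and> (\<forall>c. peval c r = L v c)", OF this]
  obtain r where r: "\<forall>v\<in>V. r v \<in> mpols W \<and> homogeneous 1 (r v) \<and> (\<forall>c. peval c (r v) = L v c)"
    by (rule exE)
  have 1: "psubst r q \<in> mpols W" using q(1) r by (intro psubst_mpols) auto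
  have 2: "homogeneous e (psubst r q)"
    unfolding psubst_def
  proof (rule homogeneous_sum)
    fix m assume m: "m \<in> keys q"
    then have mV: "keys m \<subseteq> V" and "mdeg m = e" using q by (auto simp: mpols_def homogeneous_mdeg)
    have "homogeneous (\<Sum>v\<in>keys m. lookup m v * 1) (\<Prod>v\<in>keys m. r v ^ lookup m v)"
      using r mV by (intro homogeneous_prod homogeneous_power) auto
    then have "homogeneous e (\<Prod>v\<in>keys m. r v ^ lookup m v)"
      using \<open>mdeg m = e\<close> by (simp add: mdeg_def)
    then show "homogeneous e (Const (lookup q m) * (\<Prod>v\<in>keys m. r v ^ lookup m v))"
      by (rule homogeneous_Const_mult)
  qed
  have 3: "peval c (psubst r q) = F b" if "\<forall>v\<in>V. b v = L v c" for c b
    unfolding peval_psubst q(3)[symmetric] using q(1) r that by (intro peval_cong_mpols[OF q(1)]) auto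
  have "hpoly W e (\<lambda>c. peval c (psubst r q))" unfolding hpoly_def using 1 2 by blast
  then show ?thesis using 3 by (intro exI[of _ "\<lambda>c. peval c (psubst r q)"] conjI allI impI)
qed

subsection \<open>First order expansion of a linear substitution\<close>

definition lin_functional :: "('w mpol \<Rightarrow> complex) \<Rightarrow> bool" where
  "lin_functional \<phi> \<longleftrightarrow> (\<forall>x y. \<phi> (x + y) = \<phi> x + \<phi> y) \<and> (\<forall>c x. \<phi> (Const c * x) = c * \<phi> x)"

text \<open>Polynomial dependence of a polynomial-valued map, tested by linear functionals: these
  tests are exactly the entries of the matrix in \<open>inf_rigid_isolated\<close>.\<close>

definition vpoly :: "'v set \<Rightarrow> nat \<Rightarrow> (('v \<Rightarrow> complex) \<Rightarrow> 'w mpol) \<Rightarrow> bool" where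
  "vpoly V e U \<longleftrightarrow> (\<forall>\<phi>. lin_functional \<phi> \<longrightarrow> hpoly V e (\<lambda>c. \<phi> (U c)))"

lemma lin_functional_0: "lin_functional \<phi> \<Longrightarrow> \<phi> 0 = 0"
  unfolding lin_functional_def by (metis Const_0 mult_zero_left)

lemma vpoly_0: "vpoly V e (\<lambda>c. 0)"
  by (simp add: vpoly_def lin_functional_0 hpoly_0)

lemma vpoly_add:
  fixes U :: "('v \<Rightarrow> complex) \<Rightarrow> 'b mpol"
  shows "vpoly V e U \<Longrightarrow> vpoly V e W \<Longrightarrow> vpoly V e (\<lambda>c. U c + W c)"
  unfolding vpoly_def
proof (intro allI impI)
  fix \<phi> :: "'b mpol \<Rightarrow> complex"
  assume U: "\<forall>\<phi>. lin_functional \<phi> \<longrightarrow> hpoly V e (\<lambda>c. \<phi> (U c))" "\<forall>\<phi>. lin_functional \<phi> \<longrightarrow> hpoly V e (\<lambda>c. \<phi> (W c))"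
    and \<phi>: "lin_functional \<phi>"
  have "hpoly V e (\<lambda>c. \<phi> (U c) + \<phi> (W c))"
    by (rule hpoly_add[OF U(1)[rule_format, OF \<phi>] U(2)[rule_format, OF \<phi>]])
  then show "hpoly V e (\<lambda>c. \<phi> (U c + W c))" using \<phi> by (simp add: lin_functional_def)
qed

lemma vpoly_sum: "(\<And>i. i \<in> A \<Longrightarrow> vpoly V e (U i)) \<Longrightarrow> vpoly V e (\<lambda>c. \<Sum>i\<in>A. U i c)"
proof (induction A rule: infinite_finite_induct)
  case (insert x A)
  then have "vpoly V e (\<lambda>c. U x c + (\<Sum>i\<in>A. U i c))" by (intro vpoly_add) auto
  then show ?case using insert.hyps by simp
qed (simp_all add: vpoly_0)

lemma vpoly_mult:
  fixes U :: "('v \<Rightarrow> complex) \<Rightarrow> 'w mpol"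
  shows "vpoly V e U \<Longrightarrow> vpoly V e (\<lambda>c. b * U c)"
  unfolding vpoly_def
proof (intro allI impI)
  fix \<phi> :: "'w mpol \<Rightarrow> complex"
  assume U: "\<forall>\<phi>. lin_functional \<phi> \<longrightarrow> hpoly V e (\<lambda>c. \<phi> (U c))" and \<phi>: "lin_functional \<phi>"
  have "lin_functional (\<lambda>x. \<phi> (b * x))"
    using \<phi> unfolding lin_functional_def by (simp add: distrib_left mult.left_commute[of b])
  then show "hpoly V e (\<lambda>c. \<phi> (b * U c))" using U by blast
qed

lemma vpoly_cmult:
  fixes U :: "('v \<Rightarrow> complex) \<Rightarrow> 'b mpol"
  shows "hpoly V e' F \<Longrightarrow> vpoly V e U \<Longrightarrow> vpoly V (e' + e) (\<lambda>c. Const (F c) * U c)"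
  unfolding vpoly_def
proof (intro allI impI)
  fix \<phi> :: "'b mpol \<Rightarrow> complex"
  assume F: "hpoly V e' F" and U: "\<forall>\<phi>. lin_functional \<phi> \<longrightarrow> hpoly V e (\<lambda>c. \<phi> (U c))" and \<phi>: "lin_functional \<phi>"
  have "hpoly V (e' + e) (\<lambda>c. F c * \<phi> (U c))" by (rule hpoly_mult[OF F U[rule_format, OF \<phi>]])
  then show "hpoly V (e' + e) (\<lambda>c. \<phi> (Const (F c) * U c))" using \<phi> by (simp add: lin_functional_def)
qed

lemma vpoly_const: "vpoly V 0 (\<lambda>c. b)"
  unfolding vpoly_def by (auto intro: hpoly_const)

section \<open>Linear substitutions near scalar matrices\<close>

definition lin_sub :: "nat \<Rightarrow> (nat \<times> nat \<Rightarrow> complex) \<Rightarrow> nat \<Rightarrow> nat mpol" where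
  "lin_sub n C i = (\<Sum>j\<le>n. Const (C (i, j)) * Var j)"

text \<open>Homogeneous linear coordinates for the deviation from scalar matrices; they vanish
  exactly on these.\<close>

definition off_scalar :: "(nat \<times> nat \<Rightarrow> complex) \<Rightarrow> nat \<times> nat \<Rightarrow> complex" where
  "off_scalar C = (\<lambda>(k, l). C (k, l) - (if k = l then C (0, 0) else 0))"

definition scalar_entries :: "complex \<Rightarrow> nat \<times> nat \<Rightarrow> complex" where
  "scalar_entries t = (\<lambda>(k, l). if k = l then t else 0)"

lemma lin_sub_off_scalar:
  assumes "i \<le> n"
  shows "lin_sub n C i = Const (C (0, 0)) * Var i + (\<Sum>l\<le>n. Const (off_scalar C (i, l)) * Var l)"
proof -
  have "(\<Sum>l\<le>n. Const (off_scalar C (i, l)) * Var l) =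
      lin_sub n C i - (\<Sum>l\<le>n. if l = i then Const (C (0, 0)) * Var l else 0)"
    unfolding lin_sub_def sum_subtractf[symmetric] off_scalar_def
    by (intro sum.cong) (auto simp: Const_diff algebra_simps)
  then show ?thesis using assms by simp
qed

lemma lin_sub_scalar: "i \<le> n \<Longrightarrow> lin_sub n (scalar_entries t) i = Const t * Var i"
  by (subst lin_sub_off_scalar) (auto simp: scalar_entries_def off_scalar_def)

lemma off_scalar_00 [simp]: "off_scalar C (0, 0) = 0"
  by (simp add: off_scalar_def)

text \<open>\<open>g(Cx) = t\<^sup>e g(x) + \<Sum> y\<^sub>k\<^sub>l U\<^sub>k\<^sub>l(C)\<close> with \<open>t = C\<^sub>0\<^sub>0\<close> and \<open>C = t + y\<close>, where \<open>U\<^sub>k\<^sub>l\<close> has degree \<open>e - 1\<close> in the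
  entries of \<open>C\<close> and the partial derivative in direction \<open>E\<^sub>k\<^sub>l\<close> as its value at scalar matrices.\<close>

definition expandable :: "nat \<Rightarrow> nat \<Rightarrow> nat mpol \<Rightarrow> bool" where
  "expandable n e g \<longleftrightarrow> (\<exists>U. (\<forall>kl. vpoly ({..n} \<times> {..n}) (e - 1) (U kl)) \<and>
     (e = 0 \<longrightarrow> (\<forall>kl C. U kl C = 0)) \<and>
     (\<forall>C. psubst (lin_sub n C) g = Const (C (0, 0) ^ e) * g + (\<Sum>kl\<in>{..n} \<times> {..n}. Const (off_scalar C kl) * U kl C)) \<and>
     (\<forall>k l t. U (k, l) (scalar_entries t) = Const (t ^ (e - 1)) * (Var l * pderiv_mpol k g)))"

lemma expandable_add:
  assumes "expandable n e g" "expandable n e h"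
  shows "expandable n e (g + h)"
proof -
  obtain U where U: "\<forall>kl. vpoly ({..n} \<times> {..n}) (e - 1) (U kl)" "e = 0 \<longrightarrow> (\<forall>kl C. U kl C = 0)"
    "\<forall>C. psubst (lin_sub n C) g = Const (C (0, 0) ^ e) * g + (\<Sum>kl\<in>{..n} \<times> {..n}. Const (off_scalar C kl) * U kl C)"
    "\<forall>k l t. U (k, l) (scalar_entries t) = Const (t ^ (e - 1)) * (Var l * pderiv_mpol k g)"
    using assms(1) by (auto simp: expandable_def)
  obtain W where W: "\<forall>kl. vpoly ({..n} \<times> {..n}) (e - 1) (W kl)" "e = 0 \<longrightarrow> (\<forall>kl C. W kl C = 0)"
    "\<forall>C. psubst (lin_sub n C) h = Const (C (0, 0) ^ e) * h + (\<Sum>kl\<in>{..n} \<times> {..n}. Const (off_scalar C kl) * W kl C)"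
    "\<forall>k l t. W (k, l) (scalar_entries t) = Const (t ^ (e - 1)) * (Var l * pderiv_mpol k h)"
    using assms(2) by (auto simp: expandable_def)
  show ?thesis
    unfolding expandable_def
    by (rule exI[of _ "\<lambda>kl C. U kl C + W kl C"])
      (use U W in \<open>auto simp: vpoly_add distrib_left sum.distrib pderiv_mpol_add\<close>)
qed

lemma expandable_0: "expandable n e 0"
  unfolding expandable_def by (rule exI[of _ "\<lambda>kl C. 0"]) (auto simp: vpoly_0)

lemma expandable_Const_mult:
  assumes "expandable n e g"
  shows "expandable n e (Const c * g)"
proof -
  obtain U where U: "\<forall>kl. vpoly ({..n} \<times> {..n}) (e - 1) (U kl)" "e = 0 \<longrightarrow> (\<forall>kl C. U kl C = 0)"
    "\<forall>C. psubst (lin_sub n C) g = Const (C (0, 0) ^ e) * g + (\<Sum>kl\<in>{..n} \<times> {..n}. Const (off_scalar C kl) * U kl C)"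
    "\<forall>k l t. U (k, l) (scalar_entries t) = Const (t ^ (e - 1)) * (Var l * pderiv_mpol k g)"
    using assms(1) by (auto simp: expandable_def)
  show ?thesis
    unfolding expandable_def
    by (rule exI[of _ "\<lambda>kl C. Const c * U kl C"])
      (use U in \<open>auto simp: vpoly_mult distrib_left sum_distrib_left pderiv_mpol_mult mult.left_commute\<close>)
qed

lemma expandable_1: "expandable n 0 1"
  unfolding expandable_def by (rule exI[of _ "\<lambda>kl C. 0"]) (auto simp: vpoly_0)

text \<open>The product rule: the deviation in row \<open>i\<close> multiplies the leading term of
  \<open>g\<close>, while the old coefficients \<open>U\<close> are multiplied by the whole
  substituted variable \<open>lin_sub n C i\<close>.\<close>

lemma expandable_Var_mult:
  assumes "expandable n e g" "i \<le> n"
  shows "expandable n (Suc e) (Var i * g)"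
proof -
  obtain U where U: "\<forall>kl. vpoly ({..n} \<times> {..n}) (e - 1) (U kl)" "e = 0 \<longrightarrow> (\<forall>kl C. U kl C = 0)"
    "\<forall>C. psubst (lin_sub n C) g = Const (C (0, 0) ^ e) * g + (\<Sum>kl\<in>{..n} \<times> {..n}. Const (off_scalar C kl) * U kl C)"
    "\<forall>k l t. U (k, l) (scalar_entries t) = Const (t ^ (e - 1)) * (Var l * pderiv_mpol k g)"
    using assms(1) by (auto simp: expandable_def)
  define W where "W kl C = (if fst kl = i then Const (C (0, 0) ^ e) * (Var (snd kl) * g) else 0) + lin_sub n C i * U kl C" for kl C
  have vp: "vpoly ({..n} \<times> {..n}) e (W kl)" for kl
  proof -
    have "vpoly ({..n} \<times> {..n}) (e * 1 + 0) (\<lambda>C. Const (C (0, 0) ^ e) * (Var (snd kl) * g))"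
      by (intro vpoly_cmult hpoly_power hpoly_var vpoly_const) auto
    then have 1: "vpoly ({..n} \<times> {..n}) e (\<lambda>C. if fst kl = i then Const (C (0, 0) ^ e) * (Var (snd kl) * g) else 0)"
      by (cases "fst kl = i") (simp_all add: vpoly_0)
    have 2: "vpoly ({..n} \<times> {..n}) e (\<lambda>C. lin_sub n C i * U kl C)"
    proof (cases "e = 0")
      case True
      then show ?thesis using U(2) by (cases kl) (simp add: vpoly_0)
    next
      case False
      have "vpoly ({..n} \<times> {..n}) (1 + (e - 1)) (\<lambda>C. \<Sum>j\<le>n. Const (C (i, j)) * (Var j * U kl C))"
        using assms(2) by (intro vpoly_sum vpoly_cmult hpoly_var vpoly_mult U(1)[rule_format]) auto
      then show ?thesis using False by (simp add: lin_sub_def sum_distrib_right mult.assoc)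
    qed
    show ?thesis unfolding W_def by (intro vpoly_add 1 2)
  qed
  have exp: "psubst (lin_sub n C) (Var i * g) = Const (C (0, 0) ^ Suc e) * (Var i * g) +
      (\<Sum>kl\<in>{..n} \<times> {..n}. Const (off_scalar C kl) * W kl C)" for C
  proof -
    have "psubst (lin_sub n C) (Var i * g) = lin_sub n C i * (Const (C (0, 0) ^ e) * g) +
        lin_sub n C i * (\<Sum>kl\<in>{..n} \<times> {..n}. Const (off_scalar C kl) * U kl C)"
      using U(3) by (simp add: distrib_left)
    also have "lin_sub n C i * (Const (C (0, 0) ^ e) * g) = Const (C (0, 0) ^ Suc e) * (Var i * g) +
        (\<Sum>l\<le>n. Const (off_scalar C (i, l)) * (Const (C (0, 0) ^ e) * (Var l * g)))"
      unfolding lin_sub_off_scalar[OF assms(2)]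
      by (simp add: Const_mult sum_distrib_right sum_distrib_left algebra_simps)
    also have "(\<Sum>l\<le>n. Const (off_scalar C (i, l)) * (Const (C (0, 0) ^ e) * (Var l * g))) =
        (\<Sum>kl\<in>{..n} \<times> {..n}. Const (off_scalar C kl) * (if fst kl = i then Const (C (0, 0) ^ e) * (Var (snd kl) * g) else 0))"
    proof -
      have "(\<Sum>kl\<in>{..n} \<times> {..n}. Const (off_scalar C kl) * (if fst kl = i then Const (C (0, 0) ^ e) * (Var (snd kl) * g) else 0)) =
          (\<Sum>k\<le>n. \<Sum>l\<le>n. Const (off_scalar C (k, l)) * (if k = i then Const (C (0, 0) ^ e) * (Var l * g) else 0))"
        by (simp add: sum.cartesian_product case_prod_unfold)
      also have "\<dots> = (\<Sum>k\<le>n. if k = i then \<Sum>l\<le>n. Const (off_scalar C (i, l)) * (Const (C (0, 0) ^ e) * (Var l * g)) else 0)"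
        by (intro sum.cong) auto
      finally show ?thesis using assms(2) by simp
    qed
    finally show ?thesis
      unfolding W_def by (simp add: distrib_left sum.distrib sum_distrib_left mult.left_commute)
  qed
  have diag: "W (k, l) (scalar_entries t) = Const (t ^ e) * (Var l * pderiv_mpol k (Var i * g))" for k l t
  proof -
    have 00: "scalar_entries t (0, 0) = t" by (simp add: scalar_entries_def)
    have "lin_sub n (scalar_entries t) i * U (k, l) (scalar_entries t) = Const (t ^ e) * (Var l * (Var i * pderiv_mpol k g))"
    proof (cases "e = 0")
      \<comment> \<open>In degree 0 the exponent \<open>e - 1\<close> is truncated, and the required
        value holds because both sides vanish: the formula for \<open>U\<close> at
        \<open>t = 1\<close> yields \<open>Var l * pderiv_mpol k g = 0\<close>.\<close>
      case True
      then have "U (k, l) (scalar_entries 1) = 0" "U (k, l) (scalar_entries t) = 0" using U(2) by auto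
      moreover have "U (k, l) (scalar_entries 1) = Const (1 ^ (e - 1)) * (Var l * pderiv_mpol k g)" using U(4) by blast
      ultimately have 0: "Var l * pderiv_mpol k g = 0" by simp
      have "Const (t ^ e) * (Var l * (Var i * pderiv_mpol k g)) = Const (t ^ e) * Var i * (Var l * pderiv_mpol k g)"
        by (simp only: mult.assoc mult.left_commute)
      then have "Const (t ^ e) * (Var l * (Var i * pderiv_mpol k g)) = 0" unfolding 0 by simp
      then show ?thesis using \<open>U (k, l) (scalar_entries t) = 0\<close> by simp
    next
      case False
      then obtain e' where "e = Suc e'" by (cases e) auto
      then show ?thesis using U(4) lin_sub_scalar[OF assms(2)] by (simp add: Const_mult mult_ac)
    qed
    then show ?thesis by (auto simp: W_def 00 pderiv_mpol_mult pderiv_mpol_Var distrib_left)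
  qed
  show ?thesis
    unfolding expandable_def by (rule exI[of _ W]) (use vp exp diag in auto)
qed

lemma expandable_forms:
  assumes "g \<in> forms n e"
  shows "expandable n e g"
proof -
  have mono: "expandable n e (single m 1)" if "m \<in> monoms n e" for m e
    using that
  proof (induction e arbitrary: m)
    case 0
    then have "m = 0" by (rule monoms_0)
    then show ?case using expandable_1 by simp
  next
    case (Suc e)
    obtain i m' where i: "i \<le> n" "m' \<in> monoms n e" "m = single i 1 + m'"
      using Suc.prems by (rule monoms_Suc_obtain)
    have "single m 1 = Var i * single m' 1" by (simp add: i(3) Var_def mult_single)
    then show ?case using expandable_Var_mult[OF Suc.IH[OF i(2)] i(1)] by simp
  qed
  have "mpolv.subspace {g. expandable n e g}"
    by (rule mpolv_subspaceI) (auto intro: expandable_0 expandable_add expandable_Const_mult)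
  then have "mpolv.span ((\<lambda>m. single m 1) ` monoms n e) \<subseteq> {g. expandable n e g}"
    using mono by (intro mpolv.span_minimal) auto
  then show ?thesis using assms by (auto simp: forms_span_monoms)
qed

text \<open>The infinitesimal stabilizer of \<open>[f]\<close> consists of scalar matrices.\<close>

definition inf_rigid :: "nat \<Rightarrow> nat mpol \<Rightarrow> bool" where
  "inf_rigid n f \<longleftrightarrow> (\<forall>a c. (\<Sum>(k, l)\<in>{..n} \<times> {..n}. Const (a (k, l)) * (Var l * pderiv_mpol k f)) = Const c * f \<longrightarrow>
     (\<exists>t. \<forall>k\<le>n. \<forall>l\<le>n. a (k, l) = (if k = l then t else 0)))"

text \<open>Rigidity makes \<open>f\<close> and the products \<open>Var l * pderiv_mpol k f\<close>
  with \<open>(k, l) \<noteq> (0, 0)\<close> linearly independent, and the functionals belong to the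
  dual family. Leaving out \<open>(0, 0)\<close> removes the Euler relation.\<close>

lemma inf_rigid_functionals:
  fixes M :: nat
  assumes rigid: "inf_rigid n f" and f0: "f \<noteq> 0"
    and E: "bij_betw E {..<M} ({..n} \<times> {..n} - {(0, 0)})"
  obtains \<phi> where "\<forall>i. lin_functional (\<phi> i)" "\<forall>i<M. \<phi> i f = 0"
    "\<forall>i<M. \<forall>j<M. \<phi> i (Var (snd (E j)) * pderiv_mpol (fst (E j)) f) = (if i = j then 1 else 0)"
proof -
  define v where "v i = (if i < M then Var (snd (E i)) * pderiv_mpol (fst (E i)) f else f)" for i
  have ind: "inj_on v {..<Suc M} \<and> mpolv.independent (v ` {..<Suc M})"
  proof (rule mpolv.family_independent)
    fix c i assume c: "(\<Sum>i<Suc M. cscale (c i) (v i)) = 0" and i: "i < Suc M"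
    define a where "a kl = (if kl = (0, 0) then 0 else c (inv_into {..<M} E kl))" for kl
    have "(\<Sum>(k, l)\<in>{..n} \<times> {..n}. Const (a (k, l)) * (Var l * pderiv_mpol k f)) =
        (\<Sum>(k, l)\<in>{..n} \<times> {..n} - {(0, 0)}. Const (a (k, l)) * (Var l * pderiv_mpol k f))"
      by (rule sum.mono_neutral_right) (auto simp: a_def)
    also have "\<dots> = (\<Sum>i<M. case E i of (k, l) \<Rightarrow> Const (a (k, l)) * (Var l * pderiv_mpol k f))"
      by (rule sum.reindex_bij_betw[OF E, symmetric])
    also have "\<dots> = (\<Sum>i<M. cscale (c i) (v i))"
    proof (intro sum.cong refl)
      fix i assume "i \<in> {..<M}"
      then have "E i \<noteq> (0, 0)" "inv_into {..<M} E (E i) = i" using E by (auto simp: bij_betw_def)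
      then show "(case E i of (k, l) \<Rightarrow> Const (a (k, l)) * (Var l * pderiv_mpol k f)) = cscale (c i) (v i)"
        using \<open>i \<in> {..<M}\<close> by (cases "E i") (auto simp: a_def v_def cscale_eq)
    qed
    also have "\<dots> = Const (- c M) * f"
      using c by (simp add: v_def[of M] cscale_eq Const_uminus eq_neg_iff_add_eq_0)
    finally obtain t where t: "\<forall>k\<le>n. \<forall>l\<le>n. a (k, l) = (if k = l then t else 0)"
      using rigid unfolding inf_rigid_def by blast
    \<comment> \<open>The coefficient at \<open>(0, 0)\<close> was set to 0, which rules out nonzero
      scalar matrices.\<close>
    have "a (0, 0) = t" using t by simp
    then have "t = 0" by (simp add: a_def)
    have ci: "c i = 0" if "i < M" for i
    proof -
      have "E i \<in> {..n} \<times> {..n} - {(0, 0)}" using E that by (auto simp: bij_betw_def)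
      moreover have "inv_into {..<M} E (E i) = i" using E that by (auto simp: bij_betw_def)
      ultimately show ?thesis using t \<open>t = 0\<close> by (cases "E i") (auto simp: a_def split: if_splits)
    qed
    then have "(\<Sum>i<M. cscale (c i) (v i)) = 0" by (simp add: cscale_eq)
    then have "Const (c M) * f = 0" using c by (simp add: v_def[of M] cscale_eq)
    then have "c M = 0" using f0 by simp
    then show "c i = 0" using ci i by (cases "i = M") auto
  qed
  obtain \<phi> where \<phi>: "\<forall>i x y. \<phi> i (x + y) = \<phi> i x + \<phi> i y" "\<forall>i c x. \<phi> i (cscale c x) = c * \<phi> i x"
    "\<forall>i<Suc M. \<forall>j<Suc M. \<phi> i (v j) = (if i = j then 1 else 0)"
    by (rule mpolv.dual_functionals[OF conjunct1[OF ind] conjunct2[OF ind]])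
  have 1: "\<forall>i. lin_functional (\<phi> i)" using \<phi>(1,2) by (simp add: lin_functional_def cscale_eq)
  have 2: "\<forall>i<M. \<phi> i f = 0" 
  proof (intro allI impI)
    fix i assume "i < M"
    then show "\<phi> i f = 0" using \<phi>(3)[rule_format, of i M] by (simp add: v_def)
  qed
  have 3: "\<forall>i<M. \<forall>j<M. \<phi> i (Var (snd (E j)) * pderiv_mpol (fst (E j)) f) = (if i = j then 1 else 0)"
  proof (intro allI impI)
    fix i j assume "i < M" "j < M"
    then show "\<phi> i (Var (snd (E j)) * pderiv_mpol (fst (E j)) f) = (if i = j then 1 else 0)"
      using \<phi>(3)[rule_format, of i j] by (simp add: v_def)
  qed
  show ?thesis by (rule that[OF 1 2 3])
qed

lemma lin_functional_sum:
  assumes "lin_functional \<phi>"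
  shows "\<phi> (\<Sum>x\<in>A. g x) = (\<Sum>x\<in>A. \<phi> (g x))"
  by (induction A rule: infinite_finite_induct)
    (use assms in \<open>auto simp: lin_functional_0 lin_functional_def\<close>)

text \<open>A determinant trick as in Nakayama's lemma: \<open>M(C) y = 0\<close> on the stabilizer, and \<open>M\<close> is invertible
  at scalar matrices.\<close>

lemma inf_rigid_isolated:
  assumes f: "f \<in> forms n d" and f0: "f \<noteq> 0" and rigid: "inf_rigid n f"
  shows "\<exists>D \<Delta>. hpoly ({..n} \<times> {..n}) D \<Delta> \<and> (\<forall>t. t \<noteq> 0 \<longrightarrow> \<Delta> (scalar_entries t) \<noteq> 0) \<and>
    (\<forall>C c. psubst (lin_sub n C) f = Const c * f \<longrightarrow> (\<exists>kl\<in>{..n} \<times> {..n}. off_scalar C kl \<noteq> 0) \<longrightarrow> \<Delta> C = 0)"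
proof -
  define P where "P = {..n} \<times> {..n} - {(0::nat, 0::nat)}"
  define M where "M = card P"
  have "finite P" by (simp add: P_def)
  then obtain E where E: "bij_betw E {..<M} P"
    using ex_bij_betw_nat_finite[of P] by (auto simp: M_def lessThan_atLeast0)
  obtain \<phi> where \<phi>: "\<forall>i. lin_functional (\<phi> i)" "\<forall>i<M. \<phi> i f = 0"
    "\<forall>i<M. \<forall>j<M. \<phi> i (Var (snd (E j)) * pderiv_mpol (fst (E j)) f) = (if i = j then 1 else 0)"
    by (rule inf_rigid_functionals[OF rigid f0 E[unfolded P_def]])
  from expandable_forms[OF f] obtain U where U: "\<forall>kl. vpoly ({..n} \<times> {..n}) (d - 1) (U kl)"
    "\<forall>C. psubst (lin_sub n C) f = Const (C (0, 0) ^ d) * f + (\<Sum>kl\<in>{..n} \<times> {..n}. Const (off_scalar C kl) * U kl C)"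
    "\<forall>k l t. U (k, l) (scalar_entries t) = Const (t ^ (d - 1)) * (Var l * pderiv_mpol k f)"
    unfolding expandable_def by blast
  \<comment> \<open>At a scalar matrix the entries become those of \<open>t ^ (d - 1)\<close> times
    the identity, by the choice of the functionals.\<close>
  define A where "A C = mat M M (\<lambda>(i, j). \<phi> i (U (E j) C))" for C
  define \<Delta> where "\<Delta> C = Determinant.det (A C)" for C
  have A: "A C \<in> carrier_mat M M" for C by (simp add: A_def)
  have 1: "hpoly ({..n} \<times> {..n}) (M * (d - 1)) \<Delta>"
    unfolding \<Delta>_def A_def
  proof (rule hpoly_det)
    fix i j
    show "hpoly ({..n} \<times> {..n}) (d - 1) (\<lambda>C. \<phi> i (U (E j) C))"
      using U(1) \<phi>(1) unfolding vpoly_def by blast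
  qed
  have 2: "\<Delta> (scalar_entries t) \<noteq> 0" if "t \<noteq> 0" for t
  proof -
    have "A (scalar_entries t) = t ^ (d - 1) \<cdot>\<^sub>m 1\<^sub>m M"
    proof (rule eq_matI)
      fix i j assume ij: "i < dim_row (t ^ (d - 1) \<cdot>\<^sub>m 1\<^sub>m M)" "j < dim_col (t ^ (d - 1) \<cdot>\<^sub>m 1\<^sub>m M)"
      have "U (E j) (scalar_entries t) = Const (t ^ (d - 1)) * (Var (snd (E j)) * pderiv_mpol (fst (E j)) f)"
        using U(3)[rule_format, of "fst (E j)" "snd (E j)" t] by simp
      then have "\<phi> i (U (E j) (scalar_entries t)) = t ^ (d - 1) * (if i = j then 1 else 0)"
        using \<phi>(1,3) ij by (simp add: lin_functional_def)
      then show "A (scalar_entries t) $$ (i, j) = (t ^ (d - 1) \<cdot>\<^sub>m 1\<^sub>m M) $$ (i, j)"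
        using ij by (simp add: A_def)
    qed (auto simp: A_def)
    then show ?thesis using that by (simp add: \<Delta>_def)
  qed
  have 3: "\<Delta> C = 0" if C: "psubst (lin_sub n C) f = Const c * f" and y: "kl \<in> {..n} \<times> {..n}" "off_scalar C kl \<noteq> 0" for C c kl
  proof -
    define y where "y = vec M (\<lambda>i. off_scalar C (E i))"
    have "A C *\<^sub>v y = 0\<^sub>v M"
    proof (rule eq_vecI)
      fix i assume i: "i < dim_vec (0\<^sub>v M :: complex vec)"
      have lin: "lin_functional (\<phi> i)" using \<phi>(1) by blast
      \<comment> \<open>The functional kills every multiple of \<open>f\<close>; applied to the
        expansion of a stabilizing substitution it leaves row \<open>i\<close> of
        \<open>A C *\<^sub>v y\<close>.\<close>
      have "0 = \<phi> i (Const c * f)" using \<phi>(2) i lin by (simp add: lin_functional_def)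
      also have "\<dots> = \<phi> i (Const (C (0, 0) ^ d) * f) + \<phi> i (\<Sum>kl\<in>{..n} \<times> {..n}. Const (off_scalar C kl) * U kl C)"
        using U(2)[rule_format, of C] C lin unfolding lin_functional_def by metis
      also have "\<phi> i (Const (C (0, 0) ^ d) * f) = 0" using \<phi>(2) i lin by (simp add: lin_functional_def)
      also have "\<phi> i (\<Sum>kl\<in>{..n} \<times> {..n}. Const (off_scalar C kl) * U kl C) =
          (\<Sum>kl\<in>{..n} \<times> {..n}. off_scalar C kl * \<phi> i (U kl C))"
        unfolding lin_functional_sum[OF lin] using lin by (simp add: lin_functional_def)
      also have "\<dots> = (\<Sum>kl\<in>P. off_scalar C kl * \<phi> i (U kl C))"
        unfolding P_def by (rule sum.mono_neutral_right) auto
      also have "\<dots> = (\<Sum>j<M. off_scalar C (E j) * \<phi> i (U (E j) C))"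
        by (rule sum.reindex_bij_betw[OF E, symmetric])
      finally show "(A C *\<^sub>v y) $ i = 0\<^sub>v M $ i"
        using i by (simp add: A_def y_def scalar_prod_def lessThan_atLeast0 mult.commute)
    qed (simp add: A_def)
    moreover have "y \<noteq> 0\<^sub>v M"
    proof
      assume "y = 0\<^sub>v M"
      have "kl \<in> P" using that(2,3) by (auto simp: P_def)
      then have "kl \<in> E ` {..<M}" using E by (simp add: bij_betw_def)
      then obtain i where "i < M" "E i = kl" by auto
      then have "y $ i = off_scalar C kl" by (simp add: y_def)
      then show False using \<open>y = 0\<^sub>v M\<close> \<open>i < M\<close> that(3) by simp
    qed
    moreover have "y \<in> carrier_vec M" by (simp add: y_def)
    ultimately show ?thesis unfolding \<Delta>_def using det_0_iff_vec_prod_zero[OF A] by blast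
  qed
  show ?thesis using 1 2 3 by (intro exI[of _ "M * (d - 1)"] exI[of _ \<Delta>]) blast
qed

subsection \<open>The automorphism group\<close>

lemma GL_facts:
  "carrier (GL m) = Units (ring_mat TYPE(complex) m ())" "monoid.mult (GL m) = (*)" "one (GL m) = 1\<^sub>m m" "group (GL m)"
proof -
  interpret ring "ring_mat TYPE(complex) m ()" by (rule ring_mat)
  show "group (GL m)" unfolding GL_def by (rule units_group)
qed (simp_all add: GL_def units_of_def ring_mat_simps)

lemma GL_inverse:
  assumes "A \<in> carrier (GL m)"
  shows "A \<in> carrier_mat m m" "inv\<^bsub>GL m\<^esub> A \<in> carrier_mat m m"
    "inv\<^bsub>GL m\<^esub> A * A = 1\<^sub>m m" "A * inv\<^bsub>GL m\<^esub> A = 1\<^sub>m m"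
proof -
  interpret group "GL m" by (rule GL_facts)
  have sub: "carrier (GL m) \<subseteq> carrier_mat m m" unfolding GL_facts Units_def by (auto simp: ring_mat_simps)
  show "A \<in> carrier_mat m m" using sub assms by blast
  show "inv\<^bsub>GL m\<^esub> A \<in> carrier_mat m m" using sub inv_closed[OF assms] by blast
  show "inv\<^bsub>GL m\<^esub> A * A = 1\<^sub>m m" using l_inv[OF assms] by (simp add: GL_facts)
  show "A * inv\<^bsub>GL m\<^esub> A = 1\<^sub>m m" using r_inv[OF assms] by (simp add: GL_facts)
qed

lemma PGL_carrier:
  assumes "g \<in> carrier (PGL m)"
  obtains A where "A \<in> carrier (GL m)" "g = {c \<cdot>\<^sub>m A | c. c \<noteq> 0}"
proof -
  obtain A where A: "A \<in> carrier (GL m)" "g = {c \<cdot>\<^sub>m 1\<^sub>m m | c. c \<noteq> 0} #>\<^bsub>GL m\<^esub> A"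
    using assms by (auto simp: PGL_def FactGroup_def RCOSETS_def)
  have "(c \<cdot>\<^sub>m 1\<^sub>m m) * A = c \<cdot>\<^sub>m A" for c
    using GL_inverse(1)[OF A(1)] by (subst mult_smult_assoc_mat[of _ m m]) auto
  then have "g = {c \<cdot>\<^sub>m A | c. c \<noteq> 0}" unfolding A(2) r_coset_def GL_facts by auto
  then show ?thesis using that A(1) by blast
qed

lemma lin_sub_mult:
  assumes "A \<in> carrier_mat (n + 1) (n + 1)" "B \<in> carrier_mat (n + 1) (n + 1)" "i \<le> n"
  shows "psubst (lin_sub n (\<lambda>ij. B $$ ij)) (lin_sub n (\<lambda>ij. A $$ ij) i) = lin_sub n (\<lambda>ij. (A * B) $$ ij) i"
proof -
  have "psubst (lin_sub n (\<lambda>ij. B $$ ij)) (lin_sub n (\<lambda>ij. A $$ ij) i) =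
      (\<Sum>j\<le>n. \<Sum>k\<le>n. Const (A $$ (i, j) * B $$ (j, k)) * Var k)"
    by (simp add: lin_sub_def sum_distrib_left Const_mult mult.assoc)
  also have "\<dots> = (\<Sum>k\<le>n. Const (\<Sum>j\<le>n. A $$ (i, j) * B $$ (j, k)) * Var k)"
    by (subst sum.swap) (simp add: Const_sum sum_distrib_right)
  also have "\<dots> = lin_sub n (\<lambda>ij. (A * B) $$ ij) i"
    unfolding lin_sub_def using assms
    by (intro sum.cong refl) (auto simp: scalar_prod_def atLeast0LessThan lessThan_Suc_atMost)
  finally show ?thesis .
qed

lemma psubst_lin_sub_mult:
  assumes "A \<in> carrier_mat (n + 1) (n + 1)" "B \<in> carrier_mat (n + 1) (n + 1)" "f \<in> mpols {..n}"
  shows "psubst (lin_sub n (\<lambda>ij. B $$ ij)) (psubst (lin_sub n (\<lambda>ij. A $$ ij)) f) = psubst (lin_sub n (\<lambda>ij. (A * B) $$ ij)) f"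
  unfolding psubst_psubst using lin_sub_mult[OF assms(1,2)] by (intro psubst_cong_mpols[OF assms(3)]) auto

lemma psubst_lin_sub_one:
  assumes "f \<in> mpols {..n}"
  shows "psubst (lin_sub n (\<lambda>ij. 1\<^sub>m (n + 1) $$ ij)) f = f"
proof -
  have "lin_sub n (\<lambda>ij. 1\<^sub>m (n + 1) $$ ij) i = Var i" if "i \<le> n" for i
  proof -
    have "lin_sub n (\<lambda>ij. 1\<^sub>m (n + 1) $$ ij) i = (\<Sum>j\<le>n. if j = i then Var j else 0)"
      unfolding lin_sub_def using that by (intro sum.cong) auto
    then show ?thesis using that by simp
  qed
  then have "psubst (lin_sub n (\<lambda>ij. 1\<^sub>m (n + 1) $$ ij)) f = psubst Var f"
    by (intro psubst_cong_mpols[OF assms]) auto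
  then show ?thesis by simp
qed

lemma GL_act_lin_sub:
  "GL_act (n + 1) A f = psubst (lin_sub n (\<lambda>ij. (inv\<^bsub>GL (n + 1)\<^esub> A) $$ ij)) f"
  by (simp add: GL_act_def lin_sub_def[abs_def] lessThan_Suc_atMost)

text \<open>The action substitutes the inverse of \<open>A\<close>; substituting \<open>A\<close>
  afterwards gives the statement for \<open>A\<close> itself.\<close>

lemma Aut_element:
  assumes f: "f \<in> mpols {..n}" and g: "g \<in> Aut_hypersurface n f" and A: "A \<in> g" "A \<in> carrier (GL (n + 1))"
  shows "\<exists>c. psubst (lin_sub n (\<lambda>ij. (inv\<^bsub>GL (n + 1)\<^esub> A) $$ ij)) f = Const c * f"
    "\<exists>c. psubst (lin_sub n (\<lambda>ij. A $$ ij)) f = Const c * f"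
proof -
  let ?Ai = "inv\<^bsub>GL (n + 1)\<^esub> A"
  have stab: "PGL_act (n + 1) g {Const c * f | c. c \<noteq> 0} = {Const c * f | c. c \<noteq> 0}"
    using g by (simp add: Aut_hypersurface_def stabilizer_def)
  have "f \<in> {Const c * f | c. c \<noteq> 0}" by (auto intro!: exI[of _ 1])
  then have "GL_act (n + 1) A f \<in> PGL_act (n + 1) g {Const c * f | c. c \<noteq> 0}"
    unfolding PGL_act_def using A(1) by blast
  then obtain c where c: "GL_act (n + 1) A f = Const c * f" "c \<noteq> 0" unfolding stab by blast
  then show 1: "\<exists>c. psubst (lin_sub n (\<lambda>ij. ?Ai $$ ij)) f = Const c * f" unfolding GL_act_lin_sub by blast
  note inv = GL_inverse[OF A(2)]
  have "f = psubst (lin_sub n (\<lambda>ij. (?Ai * A) $$ ij)) f" unfolding inv(3) psubst_lin_sub_one[OF f] ..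
  also have "\<dots> = psubst (lin_sub n (\<lambda>ij. A $$ ij)) (psubst (lin_sub n (\<lambda>ij. ?Ai $$ ij)) f)"
    using psubst_lin_sub_mult[OF inv(2,1) f] ..
  also have "\<dots> = Const c * psubst (lin_sub n (\<lambda>ij. A $$ ij)) f"
    using c(1) unfolding GL_act_lin_sub by simp
  finally have "Const (inverse c) * f = Const (inverse c) * Const c * psubst (lin_sub n (\<lambda>ij. A $$ ij)) f"
    by (metis mult.assoc)
  also have "Const (inverse c) * Const c = (1 :: nat mpol)" using c(2) by (simp flip: Const_mult)
  finally show "\<exists>c. psubst (lin_sub n (\<lambda>ij. A $$ ij)) f = Const c * f"
    by (metis mult_1)
qed

lemma off_scalar_zero:
  assumes "C \<in> carrier_mat (n + 1) (n + 1)" "\<forall>kl\<in>{..n} \<times> {..n}. off_scalar (\<lambda>ij. C $$ ij) kl = 0"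
  shows "C = (C $$ (0, 0)) \<cdot>\<^sub>m 1\<^sub>m (n + 1)"
proof (rule eq_matI)
  fix i j assume "i < dim_row ((C $$ (0, 0)) \<cdot>\<^sub>m 1\<^sub>m (n + 1))" "j < dim_col ((C $$ (0, 0)) \<cdot>\<^sub>m 1\<^sub>m (n + 1))"
  then have ij: "i \<le> n" "j \<le> n" by auto
  then have "off_scalar (\<lambda>ij. C $$ ij) (i, j) = 0" using assms(2) by blast
  then show "C $$ (i, j) = ((C $$ (0, 0)) \<cdot>\<^sub>m 1\<^sub>m (n + 1)) $$ (i, j)"
    using ij by (auto simp: off_scalar_def split: if_splits)
qed (use assms(1) in auto)

text \<open>Translation by the inverse of \<open>A\<close> moves \<open>g\<close> to the identity.
  If \<open>B\<close> represents another point of the stabilizer, \<open>Ai * B\<close> stabilizes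
  the class of \<open>f\<close> as well, and unless it is scalar \<Delta> vanishes there; so the
  locus where \<Delta> of \<open>Ai * B\<close> is nonzero meets the stabilizer only in
  \<open>g\<close>.\<close>

lemma Aut_isolated:
  assumes f: "f \<in> forms n d" and f0: "f \<noteq> 0" and rigid: "inf_rigid n f" and g: "g \<in> Aut_hypersurface n f"
  shows "openin (subtopology (zariski_PGL (n + 1)) (Aut_hypersurface n f)) {g}"
proof -
  let ?Aut = "Aut_hypersurface n f" and ?V = "{..n} \<times> {..n}"
  have fm: "f \<in> mpols {..n}" using f by (simp add: forms_def)
  have Aut_PGL: "?Aut \<subseteq> carrier (PGL (n + 1))" by (auto simp: Aut_hypersurface_def stabilizer_def)
  obtain A where A: "A \<in> carrier (GL (n + 1))" "g = {c \<cdot>\<^sub>m A | c. c \<noteq> 0}"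
    by (rule PGL_carrier[OF subsetD[OF Aut_PGL g]])
  have Ag: "A \<in> g"
  proof -
    have "1 \<cdot>\<^sub>m A = A" by (rule eq_matI) auto
    then show ?thesis unfolding A(2) by (metis (mono_tags, lifting) mem_Collect_eq one_neq_zero)
  qed
  define Ai where "Ai = inv\<^bsub>GL (n + 1)\<^esub> A"
  note inv = GL_inverse[OF A(1), folded Ai_def]
  obtain \<nu> where \<nu>: "psubst (lin_sub n (\<lambda>ij. Ai $$ ij)) f = Const \<nu> * f"
    using Aut_element(1)[OF fm g Ag A(1)] by (auto simp: Ai_def)
  from inf_rigid_isolated[OF f f0 rigid] obtain D \<Delta> where
    \<Delta>: "hpoly ?V D \<Delta>" "\<forall>t. t \<noteq> 0 \<longrightarrow> \<Delta> (scalar_entries t) \<noteq> 0"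
      "\<forall>C c. psubst (lin_sub n C) f = Const c * f \<longrightarrow> (\<exists>kl\<in>?V. off_scalar C kl \<noteq> 0) \<longrightarrow> \<Delta> C = 0"
    by blast
  \<comment> \<open>The entries of \<open>Ai * B\<close> as linear functions of those of
    \<open>B\<close>, so that the translated \<Delta> remains a homogeneous polynomial.\<close>
  define L where "L = (\<lambda>(k, l) (c :: nat \<times> nat \<Rightarrow> complex). \<Sum>j\<le>n. Ai $$ (k, j) * c (j, l))"
  have L1: "hpoly ?V 1 (L v)" if "v \<in> ?V" for v
    using that unfolding L_def case_prod_unfold by (intro hpoly_sum hpoly_cmult hpoly_var) auto
  have "\<exists>G. hpoly ?V D G \<and> (\<forall>c b. (\<forall>v\<in>?V. b v = L v c) \<longrightarrow> G c = \<Delta> b)"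
    by (rule hpoly_subst[OF \<Delta>(1)]) (rule L1)
  then obtain G where G: "hpoly ?V D G" "\<forall>c b. (\<forall>v\<in>?V. b v = L v c) \<longrightarrow> G c = \<Delta> b"
    by (elim exE conjE)
  obtain q where q: "q \<in> mpols ?V" "homogeneous D q" "\<forall>c. peval c q = G c"
    using G(1) unfolding hpoly_def by blast
  have L_mult: "L v (\<lambda>ij. B $$ ij) = (Ai * B) $$ v" if "B \<in> carrier_mat (n + 1) (n + 1)" "v \<in> ?V" for B v
    using that inv(2) by (cases v) (auto simp: L_def scalar_prod_def atLeast0LessThan lessThan_Suc_atMost)
  have q_eval: "peval (\<lambda>ij. B $$ ij) q = \<Delta> (\<lambda>ij. (Ai * B) $$ ij)" if "B \<in> carrier_mat (n + 1) (n + 1)" for B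
    using q(3) G(2) L_mult[OF that] by auto
  define O' where "O' = {g' \<in> carrier (PGL (n + 1)). \<forall>B\<in>g'. peval (\<lambda>ij. B $$ ij) q \<noteq> 0}"
  have "openin (zariski_PGL (n + 1)) O'"
  proof -
    have V: "{..<n + 1} \<times> {..<n + 1} = ?V" by auto
    show ?thesis
      unfolding zariski_PGL_def openin_topology_generated_by_iff V O'_def
      by (rule generate_topology_on.Basis) (use q in blast)
  qed
  \<comment> \<open>Each representative of \<open>g\<close> becomes a nonzero scalar matrix after
    the translation, where \<Delta> does not vanish.\<close>
  moreover have "g \<in> O'"
  proof -
    have "peval (\<lambda>ij. B $$ ij) q \<noteq> 0" if B: "B \<in> g" for B
    proof -
      obtain c where c: "B = c \<cdot>\<^sub>m A" "c \<noteq> 0" using B A(2) by blast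
      have carr: "B \<in> carrier_mat (n + 1) (n + 1)" using c inv(1) by simp
      have "Ai * B = c \<cdot>\<^sub>m 1\<^sub>m (n + 1)" using c inv(1-3) by (simp add: mult_smult_distrib)
      then have "\<forall>v\<in>?V. scalar_entries c v = L v (\<lambda>ij. B $$ ij)"
        using L_mult[OF carr] by (auto simp: scalar_entries_def)
      then have "peval (\<lambda>ij. B $$ ij) q = \<Delta> (scalar_entries c)" using q(3) G(2) by simp
      then show ?thesis using \<Delta>(2) c(2) by simp
    qed
    then show ?thesis using g Aut_PGL by (auto simp: O'_def)
  qed
  moreover have "h = g" if h: "h \<in> ?Aut" "h \<in> O'" for h
  proof -
    obtain B where B: "B \<in> carrier (GL (n + 1))" "h = {c \<cdot>\<^sub>m B | c. c \<noteq> 0}"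
      by (rule PGL_carrier[OF subsetD[OF Aut_PGL h(1)]])
    have Bh: "B \<in> h"
    proof -
      have "1 \<cdot>\<^sub>m B = B" by (rule eq_matI) auto
      then show ?thesis unfolding B(2) by (metis (mono_tags, lifting) mem_Collect_eq one_neq_zero)
    qed
    note Binv = GL_inverse[OF B(1)]
    obtain \<mu> where \<mu>: "psubst (lin_sub n (\<lambda>ij. B $$ ij)) f = Const \<mu> * f"
      using Aut_element(2)[OF fm h(1) Bh B(1)] by blast
    have "psubst (lin_sub n (\<lambda>ij. (Ai * B) $$ ij)) f = Const (\<nu> * \<mu>) * f"
      unfolding psubst_lin_sub_mult[OF inv(2) Binv(1) fm, symmetric] \<nu> by (simp add: \<mu> Const_mult mult.assoc)
    moreover have "\<Delta> (\<lambda>ij. (Ai * B) $$ ij) \<noteq> 0"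
      using h(2) Bh q_eval[OF Binv(1)] by (auto simp: O'_def)
    ultimately have "\<forall>kl\<in>?V. off_scalar (\<lambda>ij. (Ai * B) $$ ij) kl = 0" using \<Delta>(3) by blast
    then have "Ai * B = ((Ai * B) $$ (0, 0)) \<cdot>\<^sub>m 1\<^sub>m (n + 1)"
      using inv(2) Binv(1) by (intro off_scalar_zero) auto
    then obtain t where AiB: "Ai * B = t \<cdot>\<^sub>m 1\<^sub>m (n + 1)" by blast
    have "B = (A * Ai) * B" using inv(4) Binv(1) by simp
    also have "\<dots> = A * (Ai * B)" using inv(1,2) Binv(1) by simp
    also have "\<dots> = t \<cdot>\<^sub>m A" unfolding AiB using inv(1) by (subst mult_smult_distrib[of _ "n + 1" "n + 1"]) auto
    finally have Bt: "B = t \<cdot>\<^sub>m A" .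
    have "t \<noteq> 0"
    proof
      assume "t = 0"
      then have "B = 0\<^sub>m (n + 1) (n + 1)" using inv(1) by (subst Bt) (intro eq_matI, auto)
      then have "1\<^sub>m (n + 1) = (0\<^sub>m (n + 1) (n + 1) :: complex mat)" using Binv(2,3) by simp
      then have "(1\<^sub>m (n + 1) :: complex mat) $$ (0, 0) = 0\<^sub>m (n + 1) (n + 1) $$ (0, 0)" by simp
      then show False by simp
    qed
    have "h = {c \<cdot>\<^sub>m (t \<cdot>\<^sub>m A) | c. c \<noteq> 0}" using B(2) Bt by simp
    also have "\<dots> = {c \<cdot>\<^sub>m A | c. c \<noteq> 0}"
    proof (intro equalityI subsetI)
      fix X assume "X \<in> {c \<cdot>\<^sub>m (t \<cdot>\<^sub>m A) | c. c \<noteq> 0}"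
      then obtain c where "X = c \<cdot>\<^sub>m (t \<cdot>\<^sub>m A)" "c \<noteq> 0" by blast
      then have "X = (c * t) \<cdot>\<^sub>m A" "c * t \<noteq> 0" using \<open>t \<noteq> 0\<close> by (auto intro!: eq_matI)
      then show "X \<in> {c \<cdot>\<^sub>m A | c. c \<noteq> 0}" by blast
    next
      fix X assume "X \<in> {c \<cdot>\<^sub>m A | c. c \<noteq> 0}"
      then obtain c where "X = c \<cdot>\<^sub>m A" "c \<noteq> 0" by blast
      then have "X = (c / t) \<cdot>\<^sub>m (t \<cdot>\<^sub>m A)" "c / t \<noteq> 0" using \<open>t \<noteq> 0\<close> by (auto intro!: eq_matI)
      then show "X \<in> {c \<cdot>\<^sub>m (t \<cdot>\<^sub>m A) | c. c \<noteq> 0}" by blast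
    qed
    finally show ?thesis using A(2) by simp
  qed
  ultimately have "{g} = O' \<inter> ?Aut" using g by blast
  then show ?thesis using \<open>openin (zariski_PGL (n + 1)) O'\<close> unfolding openin_subtopology by blast
qed

text \<open>A chain of length 1 would end in an irreducible set with two distinct points, but such a
  set is the union of its two closed subsets that omit one of them.\<close>

lemma krull_dim_discrete:
  assumes "\<And>x. x \<in> topspace T \<Longrightarrow> openin T {x}"
  shows "krull_dim T = 0"
proof -
  have "k = 0" if Z: "\<forall>i\<le>k. closedin T (Z i) \<and> irreducible_in T (Z i)" "\<forall>i<k. Z i \<subset> Z (Suc i)" for k and Z :: "nat \<Rightarrow> 'a set"
  proof (rule ccontr)
    assume "k \<noteq> 0"
    then have Z01: "Z 0 \<subset> Z 1" "irreducible_in T (Z 0)" "irreducible_in T (Z 1)" "closedin T (Z 1)"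
      using Z by auto
    then obtain p where p: "p \<in> Z 0" by (auto simp: irreducible_in_def)
    obtain r where r: "r \<in> Z 1" "r \<notin> Z 0" using Z01(1) by blast
    have cl: "closedin T (Z 1 - {x})" if "x \<in> Z 1" for x
      using Z01(3,4) assms that by (intro closedin_diff) (auto simp: irreducible_in_def)
    have "Z 1 \<subseteq> (Z 1 - {p}) \<union> (Z 1 - {r})" using p r by auto
    moreover have "p \<in> Z 1" using p Z01(1) by blast
    moreover have "\<forall>A B. closedin T A \<and> closedin T B \<and> Z 1 \<subseteq> A \<union> B \<longrightarrow> Z 1 \<subseteq> A \<or> Z 1 \<subseteq> B"
      using Z01(3) by (simp add: irreducible_in_def)
    ultimately have "Z 1 \<subseteq> Z 1 - {p} \<or> Z 1 \<subseteq> Z 1 - {r}" using cl r(1) by simp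
    then show False using p r Z01(1) by blast
  qed
  then have "krull_dim T \<le> 0"
    unfolding krull_dim_def by (intro Sup_least) (auto simp: zero_enat_def)
  then show ?thesis by simp
qed

lemma dim_Aut_inf_rigid:
  assumes "f \<in> forms n d" "f \<noteq> 0" "inf_rigid n f"
  shows "dim_Aut n f = 0"
  unfolding dim_Aut_def
proof (rule krull_dim_discrete)
  fix g assume "g \<in> topspace (subtopology (zariski_PGL (n + 1)) (Aut_hypersurface n f))"
  then show "openin (subtopology (zariski_PGL (n + 1)) (Aut_hypersurface n f)) {g}"
    using Aut_isolated[OF assms] by auto
qed

lemma not_inf_rigid_syzygy:
  assumes f: "f \<in> forms n d" and d: "d > 0" and not: "\<not> inf_rigid n f"
  obtains l where "\<forall>i\<le>n. l i \<in> forms n 1" "\<exists>i\<le>n. l i \<noteq> 0" "(\<Sum>i\<le>n. l i * pderiv_mpol i f) = 0"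
proof -
  obtain a c where a: "(\<Sum>(k, l)\<in>{..n} \<times> {..n}. Const (a (k, l)) * (Var l * pderiv_mpol k f)) = Const c * f"
    and no: "\<nexists>t. \<forall>k\<le>n. \<forall>l\<le>n. a (k, l) = (if k = l then t else 0)"
    using not unfolding inf_rigid_def by blast
  \<comment> \<open>The Euler relation produces \<open>d\<close> times \<open>f\<close>, so this
    multiple of it cancels the right hand side \<open>Const c * f\<close>.\<close>
  define t where "t = c / of_nat d"
  define b where "b k l = a (k, l) - (if k = l then t else 0)" for k l
  define L where "L k = (\<Sum>l\<le>n. Const (b k l) * Var l)" for k
  have 1: "\<forall>i\<le>n. L i \<in> forms n 1"
    unfolding L_def by (intro allI impI forms_sum forms_Const_mult forms_Var) auto
  have 2: "\<exists>i\<le>n. L i \<noteq> 0"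
  proof (rule ccontr)
    assume "\<not> (\<exists>i\<le>n. L i \<noteq> 0)"
    have "a (k, l) = (if k = l then t else 0)" if "k \<le> n" "l \<le> n" for k l
    proof -
      have "lookup (L k) (single l 1) = (\<Sum>j\<le>n. if j = l then b k l else 0)"
        unfolding L_def lookup_sum lookup_Const_mult
        by (intro sum.cong) (auto simp: Var_def lookup_single when_def dest!: arg_cong[of _ _ "\<lambda>m. lookup m l"])
      then have "b k l = 0" using \<open>\<not> (\<exists>i\<le>n. L i \<noteq> 0)\<close> that by simp
      then show ?thesis by (simp add: b_def)
    qed
    then show False using no by blast
  qed
  have "(\<Sum>k\<le>n. L k * pderiv_mpol k f) = (\<Sum>k\<le>n. (\<Sum>l\<le>n. Const (a (k, l)) * (Var l * pderiv_mpol k f)) - Const t * (Var k * pderiv_mpol k f))"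
  proof (intro sum.cong refl)
    fix k assume k: "k \<in> {..n}"
    have "L k = (\<Sum>l\<le>n. Const (a (k, l)) * Var l) - (\<Sum>l\<le>n. if l = k then Const t * Var l else 0)"
      unfolding L_def sum_subtractf[symmetric]
      by (intro sum.cong) (auto simp: b_def Const_diff algebra_simps)
    then have "L k = (\<Sum>l\<le>n. Const (a (k, l)) * Var l) - Const t * Var k" using k by simp
    then show "L k * pderiv_mpol k f = (\<Sum>l\<le>n. Const (a (k, l)) * (Var l * pderiv_mpol k f)) - Const t * (Var k * pderiv_mpol k f)"
      by (simp add: left_diff_distrib sum_distrib_right mult.assoc)
  qed
  also have "\<dots> = Const c * f - Const t * (\<Sum>k\<le>n. Var k * pderiv_mpol k f)"
    unfolding a[symmetric] by (simp add: sum_subtractf sum_distrib_left sum.cartesian_product)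
  also have "\<dots> = Const (c - t * of_nat d) * f"
    unfolding Euler_mpol[OF f] by (simp add: Const_diff Const_mult Const_of_nat algebra_simps)
  also have "\<dots> = 0" using d by (simp add: t_def)
  finally show ?thesis using that[OF 1 2] by blast
qed

theorem corollary2p12:
  fixes n d :: nat and f :: "nat mpol"
  assumes "n \<ge> 1" and "d \<ge> 3"
    and "f \<in> mpols {..n}" and "homogeneous d f" and "f \<noteq> 0"
    and "at_most_isolated_singularities n f"
    and "tjurina n f < enat ((d - 2) * (d - 1) ^ (n - 1))"
  shows "dim_Aut n f = 0"
proof -
  have f: "f \<in> forms n d" using assms(3,4) by (simp add: forms_def)
  have "inf_rigid n f"
  proof (rule ccontr)
    assume "\<not> inf_rigid n f"
    then obtain l where l: "\<forall>i\<le>n. l i \<in> forms n 1" "\<exists>i\<le>n. l i \<noteq> 0" "(\<Sum>i\<le>n. l i * pderiv_mpol i f) = 0"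
      using not_inf_rigid_syzygy[OF f] assms(2) by auto
    have "enat ((d - 2) * (d - 1) ^ (n - 1)) \<le> tjurina n f"
      using assms(2) l by (intro tjurina_lower_bound[OF assms(1) _ f assms(6), of l]) auto
    then show False using assms(7) by simp
  qed
  then show ?thesis using f assms(5) by (intro dim_Aut_inf_rigid)
qed

end
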